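(* Suppose that $\Sigma\in L^\infty(G\times S\times I)$, that $K_r=K^1+K^2+K^3$ where $\sigma^1,\sigma^2,\hat\sigma^3$ satisfy the bounds listed in the context, that $\hat\sigma_1\in C(\overline G,C^1(I\times I'))$, $\hat\sigma_2\in C(\overline G,C^2(I\times I'))$, that $f\in L^2(G\times S\times I)$, $g\in T^2(\Gamma)$, and that $\psi\in C^1(\overline G,C^2(I,C^3(S)))$ is a solution of the problem $T\psi=f$, $\psi_{|\Gamma_-}=g$, $\psi(\cdot,\cdot,E_m)=0$. Let $$B_2(\psi,v)=-\int_G\int_S\int_{I}\psi(x,\omega,E')\Big(\mathrm{p.f.}\int_{E_0}^{E'}\frac1{(E'-E)^2}\hat\sigma_2(x,E',E)\int_0^{2\pi}v(x,\gamma(E',E,\omega)(s),E)\,ds\,dE\Big)dE'd\omega\,dx.$$ Then for every $v\in\mathcal D_{(0)}$ $$\begin{aligned}B_2(\psi,v)=&\int_G\int_{I}\int_S\psi(x,\omega,E')\Big(\mathrm{p.f.}\int_{E_0}^{E'}\frac1{E'-E}\hat\sigma_2(x,E',E)\int_0^{2\pi}\frac{\partial v}{\partial E}(x,\gamma(E',E,\omega)(s),E)\,ds\,dE\Big)d\omega\,dE'dx\\&+2\pi\int_G\int_{I}\int_S\psi(x,\omega,E')\hat\sigma_2(x,E',E')\frac{\partial v}{\partial E}(x,\omega,E')\,d\omega\,dE'dx\\&+\int_G\int_S\int_{I}\psi(x,\omega,E')\Big(\mathrm{p.f.}\int_{E_0}^{E'}\frac1{E'-E}\hat\sigma_2(x,E',E)\\&\qquad\cdot\int_0^{2\pi}\Big\langle(\nabla_Sv)(x,\gamma(E',E,\omega)(s),E),\frac{\partial\gamma}{\partial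 E}(E',E,\omega)(s)\Big\rangle ds\,dE\Big)dE'd\omega\,dx\\&+\pi\int_G\int_{I}\int_S\hat\sigma_2(x,E',E')(\partial_E\mu)(E',E')\,\langle\nabla_S\psi(x,\omega,E'),\nabla_Sv(x,\omega,E')\rangle\,d\omega\,dE'dx\\&+\int_G\int_S\int_{I}\psi(x,\omega,E')\Big(\mathrm{p.f.}\int_{E_0}^{E'}\frac1{E'-E}\frac{\partial\hat\sigma_2}{\partial E}(x,E',E)\int_0^{2\pi}v(x,\gamma(E',E,\omega)(s),E)\,ds\,dE\Big)dE'd\omega\,dx\\&+2\pi\int_G\int_I\int_S\psi(x,\omega,E)\frac{\partial\hat\sigma_2}{\partial E}(x,E,E)v(x,\omega,E)\,d\omega\,dE\,dx.\end{aligned}$$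
   Context: $G\subset\mathbb R^3$ is open and bounded with $\overline G$ a $C^1$-manifold with boundary (submanifold of $\mathbb R^3$), $\nu$ the outward unit normal on $\partial G$, $d\sigma$ the surface measure; $S$ the unit sphere of $\mathbb R^3$ with surface measure $d\omega$; $I=[E_0,E_m]$, $0<E_0<E_m<\infty$, $I'$ a copy of $I$. $\Gamma=\partial G\times S\times I$, $\Gamma_-=\{(y,\omega,E)\in\Gamma:\omega\cdot\nu(y)<0\}$, $T^2(\Gamma)=L^2(\Gamma,|\omega\cdot\nu|\,d\sigma\,d\omega\,dE)$. All functions are real. $\mathcal D_{(0)}=\{v\in C^1(\overline G,C^2(I,C^3(S))):v(x,\omega,E_0)=0\}$. $\nabla_S$ is the gradient on $S$ (a tangent vector regarded as a vector of $\mathbb R^3$), $\langle\cdot,\cdot\rangle$ the Euclidean inner product. $\partial/\partial E$ applied to $\hat\sigma_2(x,E',E)$, $\mu(E',E)$, $\gamma(E',E,\omega)$ is the partial derivative in the second energy argument $E$; $\frac{\partial\hat\sigma_2}{\partial E}(x,E,E)$ and $(\partial_E\mu)(E',E')$ denote its values on the diagonal. For $E'\ge E$: $\mu=\mu(E',E)=\sqrt{\frac{E(E'+2)}{E'(E+2)}}$ and $\gamma(E',E,\omega)(s)=R(\omega)(\sqrt{1-\mu^2}\cos s,\sqrt{1-\mu^2}\sin s,\mu)$, $s\in[0,2\pi]$, with $R(\omega)$ a rotation matrix (depending only on $\omega$) such that $R(\omega)(0,0,1)=\omega$. The transport operator is $$T\psi=-\mathcal H_2\big((\overline{\mathcal K}_2\psi)(x,\omega,\cdot,E)\big)(E)+\mathcal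 H_1\big((\overline{\mathcal K}_1\psi)(x,\omega,\cdot,E)\big)(E)+\omega\cdot\nabla_x\psi+\Sigma\psi-K_r\psi,$$ $(\overline{\mathcal K}_j\psi)(x,\omega,E',E)=\hat\sigma_j(x,E',E)\int_0^{2\pi}\psi(x,\gamma(E',E,\omega)(s),E')\,ds$, $(\mathcal H_ju)(E)=\mathrm{p.f.}\int_E^{E_m}\frac{u(E')}{(E'-E)^j}dE'$, $j=1,2$. Hadamard finite parts (limits as $\epsilon\to0^+$): $\mathrm{p.f.}\int_x^b\frac{f(t)}{t-x}dt=\lim\big(\int_{x+\epsilon}^b\frac{f(t)}{t-x}dt+f(x^+)\ln\epsilon\big)$; $\mathrm{p.f.}\int_x^b\frac{f(t)}{(t-x)^2}dt=\lim\big(\int_{x+\epsilon}^b\frac{f(t)}{(t-x)^2}dt+f'(x^+)\ln\epsilon-\frac1\epsilon f(x^+)\big)$; $\mathrm{p.f.}\int_a^x\frac{f(t)}{x-t}dt=\lim\big(\int_a^{x-\epsilon}\frac{f(t)}{x-t}dt+f(x^-)\ln\epsilon\big)$; $\mathrm{p.f.}\int_a^x\frac{f(t)}{(t-x)^2}dt=\lim\big(\int_a^{x-\epsilon}\frac{f(t)}{(t-x)^2}dt-f'(x^-)\ln\epsilon-\frac1\epsilon f(x^-)\big)$. Restricted collision operator $K_r=K^1+K^2+K^3$: $(K^1\psi)(x,\omega,E)=\int_{S\times I}\sigma^1(x,\omega',\omega,E',E)\psi(x,\omega',E')d\omega'dE'$, $(K^2\psi)(x,\omega,E)=\int_S\sigma^2(x,\omega',\omega,E)\psi(x,\omega',E)d\omega'$,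 $(K^3\psi)(x,\omega,E)=\int_I\int_0^{2\pi}\hat\sigma^3(x,E',E)\psi(x,\gamma(E',E,\omega)(s),E')ds\,dE'$, where $\sigma^1,\sigma^2,\hat\sigma^3$ are nonnegative measurable functions on $G\times S^2\times I^2$, $G\times S^2\times I$, $G\times I^2$, $\hat\sigma^3(x,E',E)=0$ for $E'<E$, and for constants $M_1,M_2$ and a.e. arguments $\int_{S\times I}\sigma^1(x,\omega',\omega,E',E)d\omega'dE'\le M_1$, $\int_{S\times I}\sigma^1(x,\omega,\omega',E,E')d\omega'dE'\le M_2$; $\int_S\sigma^2(x,\omega',\omega,E)d\omega'\le M_1$, $\int_S\sigma^2(x,\omega,\omega',E)d\omega'\le M_2$; $\int_I\hat\sigma^3(x,E',E)dE'\le M_1$, $\int_I\hat\sigma^3(x,E,E')dE'\le M_2$. *)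

theory Defs
  imports "HOL-Analysis.Analysis"
begin

type_synonym r3 = "real^3"


section \<open>Geometry of the spatial domain\<close>

definition C1_map :: "'a::real_normed_vector set \<Rightarrow> ('a \<Rightarrow> 'b::real_normed_vector) \<Rightarrow> bool" where
  "C1_map U f \<longleftrightarrow>
     (\<exists>f'. (\<forall>x\<in>U. (f has_derivative blinfun_apply (f' x)) (at x)) \<and> continuous_on U f')"

text \<open>A \<open>C\<^sup>1\<close> diffeomorphism between open sets of \<open>\<real>\<^sup>3\<close> straightening \<open>M\<close> to the half space
  \<open>z\<^sub>3 \<ge> 0\<close>; charts whose image does not meet \<open>z\<^sub>3 = 0\<close> are the interior charts.\<close>

definition C1_chart :: "r3 set \<Rightarrow> r3 set \<Rightarrow> (r3 \<Rightarrow> r3) \<Rightarrow> bool" where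
  "C1_chart M U \<phi> \<longleftrightarrow>
     open U \<and> open (\<phi> ` U) \<and> C1_map U \<phi> \<and>
     (\<exists>\<eta>. C1_map (\<phi> ` U) \<eta> \<and> (\<forall>x\<in>U. \<eta> (\<phi> x) = x)) \<and>
     \<phi> ` (U \<inter> M) = \<phi> ` U \<inter> {z. z $ 3 \<ge> 0}"

definition C1_manifold_with_boundary :: "r3 set \<Rightarrow> bool" where
  "C1_manifold_with_boundary M \<longleftrightarrow> (\<forall>p\<in>M. \<exists>U \<phi>. p \<in> U \<and> C1_chart M U \<phi>)"

text \<open>Only points of the manifold boundary of \<open>M\<close> have an outward unit normal.\<close>

definition outward_unit_normal :: "r3 set \<Rightarrow> r3 \<Rightarrow> r3 \<Rightarrow> bool" where
  "outward_unit_normal M y n \<longleftrightarrow> norm n = 1 \<and>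
     (\<exists>U \<phi>. y \<in> U \<and> C1_chart M U \<phi> \<and> \<phi> y $ 3 = 0 \<and>
        (\<forall>w. frechet_derivative \<phi> (at y) w $ 3 = 0 \<longrightarrow> n \<bullet> w = 0) \<and>
        frechet_derivative \<phi> (at y) n $ 3 < 0)"

definition C1_parametrization :: "r3 set \<Rightarrow> (real^2) set \<Rightarrow> (real^2 \<Rightarrow> r3) \<Rightarrow> bool" where
  "C1_parametrization M U X \<longleftrightarrow>
     open U \<and> C1_map U X \<and> openin (top_of_set M) (X ` U) \<and>
     (\<exists>Y. homeomorphism U (X ` U) X Y) \<and> (\<forall>u\<in>U. inj (frechet_derivative X (at u)))"

text \<open>The area formula in every local parametrization determines the surface measure of a
  \<open>C\<^sup>1\<close> surface \<open>M\<close> uniquely.\<close>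

definition is_surface_measure :: "r3 set \<Rightarrow> r3 measure \<Rightarrow> bool" where
  "is_surface_measure M \<sigma> \<longleftrightarrow>
     space \<sigma> = M \<and> sets \<sigma> = sets (restrict_space borel M) \<and>
     (\<forall>U X A. C1_parametrization M U X \<and> A \<in> sets borel \<and> A \<subseteq> U \<longrightarrow>
        emeasure \<sigma> (X ` A) =
          (\<integral>\<^sup>+u. ennreal (norm (cross3 (frechet_derivative X (at u) (axis 1 1))
                                  (frechet_derivative X (at u) (axis 2 1)))) * indicator A u \<partial>lborel))"


section \<open>The unit sphere\<close>

abbreviation S2 :: "r3 set" where "S2 \<equiv> sphere 0 1"

text \<open>Surface measure of the unit sphere, \<open>d\<omega> = sin \<theta> d\<theta> d\<phi>\<close> in spherical coordinates.\<close>

definition sphere_measure :: "r3 measure" where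
  "sphere_measure =
     distr (density lborel (\<lambda>(\<theta>, \<phi>). ennreal (sin \<theta>) * indicator ({0..pi} \<times> {0..2*pi}) (\<theta>, \<phi>)))
       (restrict_space borel S2)
       (\<lambda>(\<theta>, \<phi>). vector [sin \<theta> * cos \<phi>, sin \<theta> * sin \<phi>, cos \<theta>])"

text \<open>The derivative \<^emph>\<open>within\<close> the sphere fixes only the tangential part of the representing
  vector, so tangency makes the gradient unique.\<close>

definition sphere_grad :: "(r3 \<Rightarrow> real) \<Rightarrow> r3 \<Rightarrow> r3" where
  "sphere_grad h \<omega> =
     (THE w. w \<bullet> \<omega> = 0 \<and> (h has_derivative (\<lambda>\<xi>. w \<bullet> \<xi>)) (at \<omega> within S2))"

definition grad :: "(r3 \<Rightarrow> real) \<Rightarrow> r3 \<Rightarrow> r3" where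
  "grad h x = (THE d. GDERIV h x :> d)"


section \<open>Function spaces\<close>

text \<open>A normed space of real functions is represented by a membership predicate and a norm.
  Neither looks at function values outside the intended domain.\<close>

definition sup_norm :: "'a set \<Rightarrow> ('a \<Rightarrow> real) \<Rightarrow> real" where
  "sup_norm A h = (SUP z\<in>A. \<bar>h z\<bar>)"

text \<open>\<open>C\<^sup>k(S)\<close>: the components in \<open>\<real>\<^sup>3\<close> of the gradient are again functions on the sphere.\<close>

primrec Ck_sphere :: "nat \<Rightarrow> (r3 \<Rightarrow> real) \<Rightarrow> bool" where
  "Ck_sphere 0 h \<longleftrightarrow> continuous_on S2 h"
| "Ck_sphere (Suc k) h \<longleftrightarrow>
     h differentiable_on S2 \<and> (\<forall>i. Ck_sphere k (\<lambda>\<omega>. sphere_grad h \<omega> $ i))"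

primrec Ck_sphere_norm :: "nat \<Rightarrow> (r3 \<Rightarrow> real) \<Rightarrow> real" where
  "Ck_sphere_norm 0 h = sup_norm S2 h"
| "Ck_sphere_norm (Suc k) h =
     sup_norm S2 h + (\<Sum>i\<in>UNIV. Ck_sphere_norm k (\<lambda>\<omega>. sphere_grad h \<omega> $ i))"

text \<open>Derivative on \<open>[a, b]\<close>, one-sided at the end points.\<close>

definition deriv_in :: "real \<Rightarrow> real \<Rightarrow> (real \<Rightarrow> real) \<Rightarrow> real \<Rightarrow> real" where
  "deriv_in a b f t = vector_derivative f (at t within {a..b})"

definition partial1 :: "real \<Rightarrow> real \<Rightarrow> (real \<times> real \<Rightarrow> real) \<Rightarrow> real \<times> real \<Rightarrow> real" where
  "partial1 a b w = (\<lambda>(t, s). deriv_in a b (\<lambda>t'. w (t', s)) t)"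

definition partial2 :: "real \<Rightarrow> real \<Rightarrow> (real \<times> real \<Rightarrow> real) \<Rightarrow> real \<times> real \<Rightarrow> real" where
  "partial2 a b w = (\<lambda>(t, s). deriv_in a b (\<lambda>s'. w (t, s')) s)"

primrec Ck_square :: "real \<Rightarrow> real \<Rightarrow> nat \<Rightarrow> (real \<times> real \<Rightarrow> real) \<Rightarrow> bool" where
  "Ck_square a b 0 w \<longleftrightarrow> continuous_on ({a..b} \<times> {a..b}) w"
| "Ck_square a b (Suc k) w \<longleftrightarrow>
     continuous_on ({a..b} \<times> {a..b}) w \<and>
     (\<forall>t\<in>{a..b}. \<forall>s\<in>{a..b}. (\<lambda>t'. w (t', s)) differentiable (at t within {a..b}) \<and>
                              (\<lambda>s'. w (t, s')) differentiable (at s within {a..b})) \<and>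
     Ck_square a b k (partial1 a b w) \<and> Ck_square a b k (partial2 a b w)"

primrec Ck_square_norm :: "real \<Rightarrow> real \<Rightarrow> nat \<Rightarrow> (real \<times> real \<Rightarrow> real) \<Rightarrow> real" where
  "Ck_square_norm a b 0 w = sup_norm ({a..b} \<times> {a..b}) w"
| "Ck_square_norm a b (Suc k) w =
     sup_norm ({a..b} \<times> {a..b}) w +
     Ck_square_norm a b k (partial1 a b w) + Ck_square_norm a b k (partial2 a b w)"

text \<open>\<open>C(K, X)\<close> for a normed function space \<open>X\<close> with norm \<open>N\<close>.\<close>

definition C0_into ::
  "'b::topological_space set \<Rightarrow> (('a \<Rightarrow> real) \<Rightarrow> bool) \<Rightarrow> (('a \<Rightarrow> real) \<Rightarrow> real) \<Rightarrow> ('b \<Rightarrow> 'a \<Rightarrow> real) \<Rightarrow> bool" where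
  "C0_into K X N u \<longleftrightarrow>
     (\<forall>x\<in>K. X (u x) \<and> ((\<lambda>y. N (\<lambda>z. u y z - u x z)) \<longlongrightarrow> 0) (at x within K))"

text \<open>\<open>C\<^sup>k([a,b], X)\<close>: the difference quotients converge in the norm of \<open>X\<close>; the limit is
  necessarily the pointwise derivative.\<close>

definition deriv_param :: "real \<Rightarrow> real \<Rightarrow> (real \<Rightarrow> 'a \<Rightarrow> real) \<Rightarrow> real \<Rightarrow> 'a \<Rightarrow> real" where
  "deriv_param a b u t z = deriv_in a b (\<lambda>s. u s z) t"

primrec Ck_interval_into ::
  "real \<Rightarrow> real \<Rightarrow> (('a \<Rightarrow> real) \<Rightarrow> bool) \<Rightarrow> (('a \<Rightarrow> real) \<Rightarrow> real) \<Rightarrow> nat \<Rightarrow> (real \<Rightarrow> 'a \<Rightarrow> real) \<Rightarrow> bool" where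
  "Ck_interval_into a b X N 0 u \<longleftrightarrow> C0_into {a..b} X N u"
| "Ck_interval_into a b X N (Suc k) u \<longleftrightarrow>
     C0_into {a..b} X N u \<and>
     (\<forall>t\<in>{a..b}. ((\<lambda>s. N (\<lambda>z. (u s z - u t z) / (s - t) - deriv_param a b u t z)) \<longlongrightarrow> 0)
                   (at t within {a..b})) \<and>
     Ck_interval_into a b X N k (deriv_param a b u)"

primrec Ck_interval_norm ::
  "real \<Rightarrow> real \<Rightarrow> (('a \<Rightarrow> real) \<Rightarrow> real) \<Rightarrow> nat \<Rightarrow> (real \<Rightarrow> 'a \<Rightarrow> real) \<Rightarrow> real" where
  "Ck_interval_norm a b N 0 u = sup_norm {a..b} (\<lambda>t. N (u t))"
| "Ck_interval_norm a b N (Suc k) u =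
     sup_norm {a..b} (\<lambda>t. N (u t)) + Ck_interval_norm a b N k (deriv_param a b u)"

text \<open>\<open>C\<^sup>1\<close> on the closure of the open set \<open>G\<close>, with values in \<open>X\<close>: continuously differentiable
  in \<open>G\<close>, all first partial derivatives extending continuously to the closure.\<close>

definition C1_closure_into ::
  "r3 set \<Rightarrow> (('a \<Rightarrow> real) \<Rightarrow> bool) \<Rightarrow> (('a \<Rightarrow> real) \<Rightarrow> real) \<Rightarrow> (r3 \<Rightarrow> 'a \<Rightarrow> real) \<Rightarrow> bool" where
  "C1_closure_into G X N u \<longleftrightarrow>
     C0_into (closure G) X N u \<and>
     (\<exists>D :: 3 \<Rightarrow> r3 \<Rightarrow> 'a \<Rightarrow> real.
        (\<forall>i. C0_into (closure G) X N (D i)) \<and>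
        (\<forall>x\<in>G. ((\<lambda>y. N (\<lambda>z. u y z - u x z - (\<Sum>i\<in>UNIV. (y $ i - x $ i) * D i x z)) / norm (y - x))
                  \<longlongrightarrow> 0) (at x)))"

text \<open>\<open>C\<^sup>1(closure G, C\<^sup>2(I, C\<^sup>3(S)))\<close>; functions are written \<open>v x \<omega> E\<close>.\<close>

definition C123 :: "r3 set \<Rightarrow> real \<Rightarrow> real \<Rightarrow> (r3 \<Rightarrow> r3 \<Rightarrow> real \<Rightarrow> real) \<Rightarrow> bool" where
  "C123 G E0 Em v \<longleftrightarrow>
     C1_closure_into G
       (\<lambda>w. Ck_interval_into E0 Em (Ck_sphere 3) (Ck_sphere_norm 3) 2 (\<lambda>E \<omega>. w (E, \<omega>)))
       (\<lambda>w. Ck_interval_norm E0 Em (Ck_sphere_norm 3) 2 (\<lambda>E \<omega>. w (E, \<omega>)))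
       (\<lambda>x (E, \<omega>). v x \<omega> E)"

definition D_zero :: "r3 set \<Rightarrow> real \<Rightarrow> real \<Rightarrow> (r3 \<Rightarrow> r3 \<Rightarrow> real \<Rightarrow> real) set" where
  "D_zero G E0 Em =
     {v. C123 G E0 Em v \<and> (\<forall>x\<in>closure G. \<forall>\<omega>\<in>S2. v x \<omega> E0 = 0)}"

text \<open>\<open>C(closure G, C\<^sup>k(I \<times> I'))\<close>; functions are written \<open>h x E' E\<close>.\<close>

definition C0k :: "r3 set \<Rightarrow> real \<Rightarrow> real \<Rightarrow> nat \<Rightarrow> (r3 \<Rightarrow> real \<Rightarrow> real \<Rightarrow> real) \<Rightarrow> bool" where
  "C0k G E0 Em k h \<longleftrightarrow>
     C0_into (closure G) (Ck_square E0 Em k) (Ck_square_norm E0 Em k) (\<lambda>x (E', E). h x E' E)"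

definition L2 :: "'a measure \<Rightarrow> ('a \<Rightarrow> real) set" where
  "L2 M = {f. f \<in> borel_measurable M \<and> integrable M (\<lambda>z. (f z)\<^sup>2)}"

definition Linfty :: "'a measure \<Rightarrow> ('a \<Rightarrow> real) set" where
  "Linfty M = {f. f \<in> borel_measurable M \<and> (\<exists>C. AE z in M. \<bar>f z\<bar> \<le> C)}"


section \<open>Phase space measures\<close>

abbreviation mG :: "r3 set \<Rightarrow> r3 measure" where "mG G \<equiv> restrict_space lborel G"
abbreviation mI :: "real \<Rightarrow> real \<Rightarrow> real measure" where "mI E0 Em \<equiv> restrict_space lborel {E0..Em}"
abbreviation mS :: "r3 measure" where "mS \<equiv> sphere_measure"

text \<open>Completed, so that measurability means Lebesgue measurability.\<close>

definition phase_measure :: "r3 set \<Rightarrow> real \<Rightarrow> real \<Rightarrow> (r3 \<times> r3 \<times> real) measure" where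
  "phase_measure G E0 Em = completion (mG G \<Otimes>\<^sub>M mS \<Otimes>\<^sub>M mI E0 Em)"

text \<open>\<open>|\<omega> \<cdot> \<nu>| d\<sigma> d\<omega> dE\<close> on \<open>\<Gamma>\<close>.\<close>

definition boundary_measure ::
  "r3 measure \<Rightarrow> (r3 \<Rightarrow> r3) \<Rightarrow> real \<Rightarrow> real \<Rightarrow> (r3 \<times> r3 \<times> real) measure" where
  "boundary_measure \<sigma> \<nu> E0 Em =
     completion (density (\<sigma> \<Otimes>\<^sub>M mS \<Otimes>\<^sub>M mI E0 Em) (\<lambda>(y, \<omega>, E). ennreal \<bar>\<omega> \<bullet> \<nu> y\<bar>))"

definition Gamma_minus ::
  "r3 set \<Rightarrow> (r3 \<Rightarrow> r3) \<Rightarrow> real \<Rightarrow> real \<Rightarrow> (r3 \<times> r3 \<times> real) set" where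
  "Gamma_minus G \<nu> E0 Em =
     {(y, \<omega>, E). y \<in> frontier G \<and> \<omega> \<in> S2 \<and> E \<in> {E0..Em} \<and> \<omega> \<bullet> \<nu> y < 0}"


section \<open>Hadamard finite parts\<close>

text \<open>\<open>f(x\<^sup>+)\<close>, \<open>f'(x\<^sup>+)\<close>, \<open>f(x\<^sup>-)\<close>, \<open>f'(x\<^sup>-)\<close> are one-sided limits of \<open>f\<close> and of its derivative; the
  value of \<open>f\<close> at \<open>x\<close> itself is not used.\<close>

definition pf_right1 :: "(real \<Rightarrow> real) \<Rightarrow> real \<Rightarrow> real \<Rightarrow> real" where
  "pf_right1 f x b =
     Lim (at_right 0) (\<lambda>\<epsilon>. (LINT t:{x+\<epsilon>..b}|lborel. f t / (t - x)) + Lim (at_right x) f * ln \<epsilon>)"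

definition pf_right2 :: "(real \<Rightarrow> real) \<Rightarrow> real \<Rightarrow> real \<Rightarrow> real" where
  "pf_right2 f x b =
     Lim (at_right 0) (\<lambda>\<epsilon>. (LINT t:{x+\<epsilon>..b}|lborel. f t / (t - x)\<^sup>2)
                          + Lim (at_right x) (deriv f) * ln \<epsilon> - 1 / \<epsilon> * Lim (at_right x) f)"

definition pf_left1 :: "real \<Rightarrow> real \<Rightarrow> (real \<Rightarrow> real) \<Rightarrow> real" where
  "pf_left1 a x f =
     Lim (at_right 0) (\<lambda>\<epsilon>. (LINT t:{a..x-\<epsilon>}|lborel. f t / (x - t)) + Lim (at_left x) f * ln \<epsilon>)"

definition pf_left2 :: "real \<Rightarrow> real \<Rightarrow> (real \<Rightarrow> real) \<Rightarrow> real" where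
  "pf_left2 a x f =
     Lim (at_right 0) (\<lambda>\<epsilon>. (LINT t:{a..x-\<epsilon>}|lborel. f t / (t - x)\<^sup>2)
                          - Lim (at_left x) (deriv f) * ln \<epsilon> - 1 / \<epsilon> * Lim (at_left x) f)"


section \<open>The transport operator\<close>

definition mu :: "real \<Rightarrow> real \<Rightarrow> real" where
  "mu E' E = sqrt (E * (E' + 2) / (E' * (E + 2)))"

definition gam :: "(r3 \<Rightarrow> real^3^3) \<Rightarrow> real \<Rightarrow> real \<Rightarrow> r3 \<Rightarrow> real \<Rightarrow> r3" where
  "gam R E' E \<omega> s =
     R \<omega> *v vector [sqrt (1 - (mu E' E)\<^sup>2) * cos s, sqrt (1 - (mu E' E)\<^sup>2) * sin s, mu E' E]"

definition rotation_to :: "(r3 \<Rightarrow> real^3^3) \<Rightarrow> bool" where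
  "rotation_to R \<longleftrightarrow> (\<forall>\<omega>\<in>S2. rotation_matrix (R \<omega>) \<and> R \<omega> *v vector [0, 0, 1] = \<omega>)"

definition Kbar ::
  "(r3 \<Rightarrow> real^3^3) \<Rightarrow> (r3 \<Rightarrow> real \<Rightarrow> real \<Rightarrow> real) \<Rightarrow> (r3 \<Rightarrow> r3 \<Rightarrow> real \<Rightarrow> real) \<Rightarrow>
   r3 \<Rightarrow> r3 \<Rightarrow> real \<Rightarrow> real \<Rightarrow> real" where
  "Kbar R \<sigma>h \<psi> x \<omega> E' E = \<sigma>h x E' E * (LINT s:{0..2*pi}|lborel. \<psi> x (gam R E' E \<omega> s) E')"

definition K1 ::
  "real \<Rightarrow> real \<Rightarrow> (r3 \<Rightarrow> r3 \<Rightarrow> r3 \<Rightarrow> real \<Rightarrow> real \<Rightarrow> real) \<Rightarrow>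
   (r3 \<Rightarrow> r3 \<Rightarrow> real \<Rightarrow> real) \<Rightarrow> r3 \<Rightarrow> r3 \<Rightarrow> real \<Rightarrow> real" where
  "K1 E0 Em \<sigma>1 \<psi> x \<omega> E =
     (LINT (\<omega>', E')|completion (mS \<Otimes>\<^sub>M mI E0 Em). \<sigma>1 x \<omega>' \<omega> E' E * \<psi> x \<omega>' E')"

definition K2 ::
  "(r3 \<Rightarrow> r3 \<Rightarrow> r3 \<Rightarrow> real \<Rightarrow> real) \<Rightarrow> (r3 \<Rightarrow> r3 \<Rightarrow> real \<Rightarrow> real) \<Rightarrow> r3 \<Rightarrow> r3 \<Rightarrow> real \<Rightarrow> real" where
  "K2 \<sigma>2 \<psi> x \<omega> E = (LINT \<omega>'|completion mS. \<sigma>2 x \<omega>' \<omega> E * \<psi> x \<omega>' E)"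

definition K3 ::
  "real \<Rightarrow> real \<Rightarrow> (r3 \<Rightarrow> real^3^3) \<Rightarrow> (r3 \<Rightarrow> real \<Rightarrow> real \<Rightarrow> real) \<Rightarrow>
   (r3 \<Rightarrow> r3 \<Rightarrow> real \<Rightarrow> real) \<Rightarrow> r3 \<Rightarrow> r3 \<Rightarrow> real \<Rightarrow> real" where
  "K3 E0 Em R \<sigma>3 \<psi> x \<omega> E =
     (LINT E'|completion (mI E0 Em).
        (LINT s:{0..2*pi}|lborel. \<sigma>3 x E' E * \<psi> x (gam R E' E \<omega> s) E'))"

definition collision_kernel1 ::
  "r3 set \<Rightarrow> real \<Rightarrow> real \<Rightarrow> real \<Rightarrow> real \<Rightarrow> (r3 \<Rightarrow> r3 \<Rightarrow> r3 \<Rightarrow> real \<Rightarrow> real \<Rightarrow> real) \<Rightarrow> bool" where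
  "collision_kernel1 G E0 Em M1 M2 \<sigma>1 \<longleftrightarrow>
     (\<lambda>(x, \<omega>', \<omega>, E', E). \<sigma>1 x \<omega>' \<omega> E' E) \<in>
        borel_measurable (completion (mG G \<Otimes>\<^sub>M mS \<Otimes>\<^sub>M mS \<Otimes>\<^sub>M mI E0 Em \<Otimes>\<^sub>M mI E0 Em)) \<and>
     (\<forall>x\<in>G. \<forall>\<omega>'\<in>S2. \<forall>\<omega>\<in>S2. \<forall>E'\<in>{E0..Em}. \<forall>E\<in>{E0..Em}. 0 \<le> \<sigma>1 x \<omega>' \<omega> E' E) \<and>
     (AE (x, \<omega>, E) in phase_measure G E0 Em.
        (\<integral>\<^sup>+(\<omega>', E'). ennreal (\<sigma>1 x \<omega>' \<omega> E' E) \<partial>completion (mS \<Otimes>\<^sub>M mI E0 Em)) \<le> ennreal M1) \<and>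
     (AE (x, \<omega>, E) in phase_measure G E0 Em.
        (\<integral>\<^sup>+(\<omega>', E'). ennreal (\<sigma>1 x \<omega> \<omega>' E E') \<partial>completion (mS \<Otimes>\<^sub>M mI E0 Em)) \<le> ennreal M2)"

definition collision_kernel2 ::
  "r3 set \<Rightarrow> real \<Rightarrow> real \<Rightarrow> real \<Rightarrow> real \<Rightarrow> (r3 \<Rightarrow> r3 \<Rightarrow> r3 \<Rightarrow> real \<Rightarrow> real) \<Rightarrow> bool" where
  "collision_kernel2 G E0 Em M1 M2 \<sigma>2 \<longleftrightarrow>
     (\<lambda>(x, \<omega>', \<omega>, E). \<sigma>2 x \<omega>' \<omega> E) \<in>
        borel_measurable (completion (mG G \<Otimes>\<^sub>M mS \<Otimes>\<^sub>M mS \<Otimes>\<^sub>M mI E0 Em)) \<and>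
     (\<forall>x\<in>G. \<forall>\<omega>'\<in>S2. \<forall>\<omega>\<in>S2. \<forall>E\<in>{E0..Em}. 0 \<le> \<sigma>2 x \<omega>' \<omega> E) \<and>
     (AE (x, \<omega>, E) in phase_measure G E0 Em.
        (\<integral>\<^sup>+\<omega>'. ennreal (\<sigma>2 x \<omega>' \<omega> E) \<partial>completion mS) \<le> ennreal M1) \<and>
     (AE (x, \<omega>, E) in phase_measure G E0 Em.
        (\<integral>\<^sup>+\<omega>'. ennreal (\<sigma>2 x \<omega> \<omega>' E) \<partial>completion mS) \<le> ennreal M2)"

definition collision_kernel3 ::
  "r3 set \<Rightarrow> real \<Rightarrow> real \<Rightarrow> real \<Rightarrow> real \<Rightarrow> (r3 \<Rightarrow> real \<Rightarrow> real \<Rightarrow> real) \<Rightarrow> bool" where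
  "collision_kernel3 G E0 Em M1 M2 \<sigma>3 \<longleftrightarrow>
     (\<lambda>(x, E', E). \<sigma>3 x E' E) \<in>
        borel_measurable (completion (mG G \<Otimes>\<^sub>M mI E0 Em \<Otimes>\<^sub>M mI E0 Em)) \<and>
     (\<forall>x\<in>G. \<forall>E'\<in>{E0..Em}. \<forall>E\<in>{E0..Em}. 0 \<le> \<sigma>3 x E' E \<and> (E' < E \<longrightarrow> \<sigma>3 x E' E = 0)) \<and>
     (AE (x, E) in completion (mG G \<Otimes>\<^sub>M mI E0 Em).
        (\<integral>\<^sup>+E'. ennreal (\<sigma>3 x E' E) \<partial>completion (mI E0 Em)) \<le> ennreal M1) \<and>
     (AE (x, E) in completion (mG G \<Otimes>\<^sub>M mI E0 Em).
        (\<integral>\<^sup>+E'. ennreal (\<sigma>3 x E E') \<partial>completion (mI E0 Em)) \<le> ennreal M2)"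

definition Kr ::
  "real \<Rightarrow> real \<Rightarrow> (r3 \<Rightarrow> real^3^3) \<Rightarrow> (r3 \<Rightarrow> r3 \<Rightarrow> r3 \<Rightarrow> real \<Rightarrow> real \<Rightarrow> real) \<Rightarrow>
   (r3 \<Rightarrow> r3 \<Rightarrow> r3 \<Rightarrow> real \<Rightarrow> real) \<Rightarrow> (r3 \<Rightarrow> real \<Rightarrow> real \<Rightarrow> real) \<Rightarrow>
   (r3 \<Rightarrow> r3 \<Rightarrow> real \<Rightarrow> real) \<Rightarrow> r3 \<Rightarrow> r3 \<Rightarrow> real \<Rightarrow> real" where
  "Kr E0 Em R \<sigma>1 \<sigma>2 \<sigma>3 \<psi> x \<omega> E =
     K1 E0 Em \<sigma>1 \<psi> x \<omega> E + K2 \<sigma>2 \<psi> x \<omega> E + K3 E0 Em R \<sigma>3 \<psi> x \<omega> E"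

text \<open>\<open>\<sigma>h1\<close>, \<open>\<sigma>h2\<close> are the hatted cross sections of the singular part, \<open>\<sigma>1\<close>, \<open>\<sigma>2\<close>, \<open>\<sigma>3\<close> the kernels
  of the restricted collision operator.\<close>

definition transport_op ::
  "real \<Rightarrow> real \<Rightarrow> (r3 \<Rightarrow> real^3^3) \<Rightarrow>
   (r3 \<Rightarrow> real \<Rightarrow> real \<Rightarrow> real) \<Rightarrow> (r3 \<Rightarrow> real \<Rightarrow> real \<Rightarrow> real) \<Rightarrow>
   (r3 \<Rightarrow> r3 \<Rightarrow> real \<Rightarrow> real) \<Rightarrow>
   (r3 \<Rightarrow> r3 \<Rightarrow> r3 \<Rightarrow> real \<Rightarrow> real \<Rightarrow> real) \<Rightarrow> (r3 \<Rightarrow> r3 \<Rightarrow> r3 \<Rightarrow> real \<Rightarrow> real) \<Rightarrow>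
   (r3 \<Rightarrow> real \<Rightarrow> real \<Rightarrow> real) \<Rightarrow>
   (r3 \<Rightarrow> r3 \<Rightarrow> real \<Rightarrow> real) \<Rightarrow> r3 \<Rightarrow> r3 \<Rightarrow> real \<Rightarrow> real" where
  "transport_op E0 Em R \<sigma>h1 \<sigma>h2 \<Sigma> \<sigma>1 \<sigma>2 \<sigma>3 \<psi> x \<omega> E =
     - pf_right2 (\<lambda>E'. Kbar R \<sigma>h2 \<psi> x \<omega> E' E) E Em
     + pf_right1 (\<lambda>E'. Kbar R \<sigma>h1 \<psi> x \<omega> E' E) E Em
     + \<omega> \<bullet> grad (\<lambda>y. \<psi> y \<omega> E) x
     + \<Sigma> x \<omega> E * \<psi> x \<omega> E
     - Kr E0 Em R \<sigma>1 \<sigma>2 \<sigma>3 \<psi> x \<omega> E"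

definition B2 ::
  "r3 set \<Rightarrow> real \<Rightarrow> real \<Rightarrow> (r3 \<Rightarrow> real^3^3) \<Rightarrow> (r3 \<Rightarrow> real \<Rightarrow> real \<Rightarrow> real) \<Rightarrow>
   (r3 \<Rightarrow> r3 \<Rightarrow> real \<Rightarrow> real) \<Rightarrow> (r3 \<Rightarrow> r3 \<Rightarrow> real \<Rightarrow> real) \<Rightarrow> real" where
  "B2 G E0 Em R \<sigma>h2 \<psi> v =
     - (LINT x|mG G. LINT \<omega>|mS. LINT E'|mI E0 Em. \<psi> x \<omega> E' *
          pf_left2 E0 E' (\<lambda>E. \<sigma>h2 x E' E * (LINT s:{0..2*pi}|lborel. v x (gam R E' E \<omega> s) E)))"

end

theory Submission
  imports Defs
begin

text \<open>Fix \<open>x\<close>, \<open>\<omega>\<close>, \<open>E'\<close> and let \<open>F(E) = \<sigma>(E', E) \<integral> v(\<gamma>(s), E) ds\<close>, so that \<open>F(E\<^sub>0) = 0\<close>. Integration by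
  parts gives \<open>p.f. \<integral> F / (E' - E)\<^sup>2 dE = - F'(E'-) - p.f. \<integral> F' / (E' - E) dE\<close>, provided \<open>F'\<close> has a limit at
  \<open>E'\<close> with a Hoelder rate. The three summands of \<open>F'\<close> yield the three finite part integrals. Only the
  limit of \<open>\<integral> \<langle>\<nabla>v, \<partial>\<gamma>/\<partial>E\<rangle> ds\<close> is delicate, since \<open>\<partial>\<gamma>/\<partial>E\<close> blows up: writing
  \<open>\<gamma> = cos \<theta> \<omega> + sin \<theta> e(s)\<close>, the first order term of \<open>v\<close> averages to zero over the circle and the second
  order term leaves \<open>- \<pi> (\<partial>\<^sub>E\<mu>)(E', E') \<Delta>v\<close>, which Green's formula on the sphere turns into the gradient
  term. The Hoelder exponent is \<open>1/2\<close>, because \<open>\<theta>\<close> is of the order of the square root of \<open>E' - E\<close>.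

  The rotations \<open>R\<close> need not be measurable. An average over a circle does not depend on the
  orthonormal frame that parametrizes it, so for Fubini's theorem \<open>R\<close> may be replaced by a Borel choice of frames.\<close>

section \<open>Gradients on the sphere\<close>

text \<open>The obstacle is the factor \<open>muE / nu\<close> in the velocity of the scattering
  curve. Since \<open>nu\<close> is of the order of sqrt (E' - E), the circle average of the
  gradient must be known to order \<open>nu\<close> with an error of order \<open>nu\<close>
  squared, one power of which is lost in the division. This is a second order expansion of a first
  derivative and consumes three derivatives on the sphere. Four minus signs combine to the plus of
  the gradient term: the definition of \<open>B2\<close>, the integration by parts, the velocity and
  Green's formula.

  For the outer integrals every rate has to be uniform in the point, the direction, the energy and
  the frame. Even then a finite part over [E0, E'] contains a multiple of ln (E' - E0), which is
  unbounded as E' approaches \<open>E0\<close>, and at E' = E0 the interval degenerates. Integrands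
  are therefore controlled on (E0, Em] only, by a multiple of 1 / sqrt (E' - E0), and the slice E' =
  E0 is discarded as a null set.\<close>

lemma great_circle_in_sphere:
  fixes \<omega> e :: r3
  assumes "norm \<omega> = 1" "norm e = 1" "e \<bullet> \<omega> = 0"
  shows "norm (cos t *\<^sub>R \<omega> + sin t *\<^sub>R e) = 1"
proof -
  have "(norm (cos t *\<^sub>R \<omega> + sin t *\<^sub>R e))\<^sup>2 = (cos t)\<^sup>2 * (norm \<omega>)\<^sup>2 + (sin t)\<^sup>2 * (norm e)\<^sup>2"
    using assms(3) unfolding power2_norm_eq_inner
    by (simp add: inner_add_left inner_add_right inner_commute power2_eq_square algebra_simps)
  then have "(norm (cos t *\<^sub>R \<omega> + sin t *\<^sub>R e))\<^sup>2 = 1"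
    using assms(1,2) by simp
  then show ?thesis
    by (smt (verit) norm_ge_zero power2_eq_1_iff)
qed

text \<open>\<open>h\<close> has a derivative only within the sphere, so the chain rule is applied
  within the image of the curve, which is a subset of the sphere.\<close>

lemma has_derivative_along_sphere_curve:
  fixes h :: "r3 \<Rightarrow> real"
  assumes h: "(h has_derivative (\<lambda>\<xi>. w \<bullet> \<xi>)) (at (c t) within S2)"
    and c: "(c has_vector_derivative c') (at t within T)" and cS: "\<And>s. s \<in> T \<Longrightarrow> c s \<in> S2"
  shows "((\<lambda>t. h (c t)) has_real_derivative (w \<bullet> c')) (at t within T)"
proof -
  have "(h has_derivative (\<lambda>\<xi>. w \<bullet> \<xi>)) (at (c t) within c ` T)"
    by (rule has_derivative_subset[OF h]) (use cS in auto)
  from diff_chain_within[OF c[unfolded has_vector_derivative_def] this]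
  show ?thesis
    by (auto simp: o_def has_field_derivative_def mult.commute[of _ "w \<bullet> c'"]
        elim!: has_derivative_eq_rhs)
qed

lemma great_circle_derivative:
  fixes \<omega> e :: "'a::real_normed_vector"
  shows "((\<lambda>t. cos t *\<^sub>R \<omega> + sin t *\<^sub>R e) has_vector_derivative (- sin t *\<^sub>R \<omega> + cos t *\<^sub>R e))
    (at t within T)"
  by (auto intro!: derivative_eq_intros simp: has_vector_derivative_def algebra_simps)

text \<open>If \<open>w\<close> and \<open>w'\<close> differ, the great circle leaving
  \<open>\<omega>\<close> in the direction \<open>w - w'\<close>, tangent because both vectors are,
  separates them: the two derivatives along it would differ by the norm of \<open>w - w'\<close>.
  This makes the description in \<open>sphere_grad\<close> unambiguous.\<close>

lemma sphere_gradient_unique: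
  fixes w w' :: r3
  assumes \<omega>: "\<omega> \<in> S2" and w: "w \<bullet> \<omega> = 0" "(h has_derivative (\<lambda>\<xi>. w \<bullet> \<xi>)) (at \<omega> within S2)"
    and w': "w' \<bullet> \<omega> = 0" "(h has_derivative (\<lambda>\<xi>. w' \<bullet> \<xi>)) (at \<omega> within S2)"
  shows "w = w'"
proof (rule ccontr)
  assume ne: "w \<noteq> w'"
  define e where "e = (1 / norm (w - w')) *\<^sub>R (w - w')"
  have e: "norm e = 1" "e \<bullet> \<omega> = 0"
    using ne w w' by (auto simp: e_def inner_diff_left)
  define c where "c = (\<lambda>t. cos t *\<^sub>R \<omega> + sin t *\<^sub>R e)"
  have c0: "c 0 = \<omega>" by (simp add: c_def)
  have cd: "(c has_vector_derivative e) (at 0)"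
    using great_circle_derivative[of \<omega> e 0 UNIV] by (simp add: c_def)
  have cS: "\<And>s. c s \<in> S2"
    using great_circle_in_sphere[of \<omega> e] \<omega> e by (simp add: c_def)
  have "((\<lambda>t. h (c t)) has_real_derivative (w \<bullet> e)) (at 0)"
    by (rule has_derivative_along_sphere_curve) (use w cd cS c0 in auto)
  moreover have "((\<lambda>t. h (c t)) has_real_derivative (w' \<bullet> e)) (at 0)"
    by (rule has_derivative_along_sphere_curve) (use w' cd cS c0 in auto)
  ultimately have "w \<bullet> e = w' \<bullet> e" by (rule DERIV_unique)
  then have "(w - w') \<bullet> (w - w') = 0"
    using ne by (simp add: e_def inner_diff_left)
  then show False using ne by simp
qed

lemma sphere_grad_eq:
  assumes "\<omega> \<in> S2" "w \<bullet> \<omega> = 0" "(h has_derivative (\<lambda>\<xi>. w \<bullet> \<xi>)) (at \<omega> within S2)"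
  shows "sphere_grad h \<omega> = w"
  unfolding sphere_grad_def using assms by (blast intro!: the_equality sphere_gradient_unique)

text \<open>On the sphere \<open>(\<xi> - \<omega>) \<bullet> \<omega> = - |\<xi> - \<omega>|\<^sup>2 / 2\<close>, so the normal part of a derivative is invisible.\<close>

lemma has_derivative_normal_part:
  assumes "\<omega> \<in> S2"
  shows "((\<lambda>\<xi>. \<xi> \<bullet> \<omega>) has_derivative (\<lambda>\<xi>. 0)) (at \<omega> within S2)"
proof -
  have "((\<lambda>\<xi>. 1 - (\<xi> - \<omega>) \<bullet> (\<xi> - \<omega>) / 2) has_derivative (\<lambda>\<xi>. 0)) (at \<omega> within S2)"
    by (auto intro!: derivative_eq_intros)
  then show ?thesis
  proof (rule has_derivative_transform[rotated 2])
    fix x assume "x \<in> S2"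
    then have "x \<bullet> x = 1" "\<omega> \<bullet> \<omega> = 1" using assms by (auto simp: dot_square_norm)
    then show "x \<bullet> \<omega> = 1 - (x - \<omega>) \<bullet> (x - \<omega>) / 2"
      by (simp add: inner_diff_left inner_diff_right inner_commute field_simps)
  qed (use assms in auto)
qed

text \<open>Existence of the gradient: the vector representing any derivative within the sphere is
  projected onto the tangent plane. The part removed is a multiple of \<open>\<omega>\<close>, and
  pairing with \<open>\<omega>\<close> has derivative zero within the sphere.\<close>

lemma
  assumes "\<omega> \<in> S2" "h differentiable (at \<omega> within S2)"
  shows sphere_grad_tangent: "sphere_grad h \<omega> \<bullet> \<omega> = 0"
    and sphere_grad_has_derivative:
      "(h has_derivative (\<lambda>\<xi>. sphere_grad h \<omega> \<bullet> \<xi>)) (at \<omega> within S2)"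
proof -
  obtain L where L: "(h has_derivative L) (at \<omega> within S2)"
    using assms by (auto simp: differentiable_def)
  then interpret bounded_linear L by (rule has_derivative_bounded_linear)
  define l where "l = adjoint L 1"
  have l: "L \<xi> = l \<bullet> \<xi>" for \<xi>
    using adjoint_works[OF linear_axioms, of \<xi> 1] by (simp add: l_def inner_commute)
  define w where "w = l - (l \<bullet> \<omega>) *\<^sub>R \<omega>"
  have n: "\<omega> \<bullet> \<omega> = 1" using assms by (simp add: dot_square_norm)
  have w0: "w \<bullet> \<omega> = 0" by (simp add: w_def inner_diff_left n)
  have "((\<lambda>\<xi>. h \<xi> - (l \<bullet> \<omega>) * (\<xi> \<bullet> \<omega>) + (l \<bullet> \<omega>) * (\<xi> \<bullet> \<omega>)) has_derivative
      (\<lambda>\<xi>. w \<bullet> \<xi> + 0)) (at \<omega> within S2)"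
  proof (rule has_derivative_add)
    show "((\<lambda>\<xi>. h \<xi> - (l \<bullet> \<omega>) * (\<xi> \<bullet> \<omega>)) has_derivative (\<lambda>\<xi>. w \<bullet> \<xi>)) (at \<omega> within S2)"
      by (auto intro!: derivative_eq_intros L simp: w_def l inner_diff_left inner_commute[of \<omega>])
    show "((\<lambda>\<xi>. (l \<bullet> \<omega>) * (\<xi> \<bullet> \<omega>)) has_derivative (\<lambda>\<xi>. 0)) (at \<omega> within S2)"
      using has_derivative_mult_right[OF has_derivative_normal_part[OF assms(1)], of "l \<bullet> \<omega>"] by simp
  qed
  then have wd: "(h has_derivative (\<lambda>\<xi>. w \<bullet> \<xi>)) (at \<omega> within S2)" by simp
  have "sphere_grad h \<omega> = w" by (rule sphere_grad_eq[OF assms(1) w0 wd])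
  with w0 wd show "sphere_grad h \<omega> \<bullet> \<omega> = 0"
    "(h has_derivative (\<lambda>\<xi>. sphere_grad h \<omega> \<bullet> \<xi>)) (at \<omega> within S2)" by auto
qed

lemma has_derivative_cong_within:
  assumes "x \<in> S" "\<And>\<xi>. \<xi> \<in> S \<Longrightarrow> f \<xi> = g \<xi>"
  shows "(f has_derivative L) (at x within S) = (g has_derivative L) (at x within S)"
  using assms by (metis has_derivative_transform)

lemma sphere_grad_cong:
  assumes "\<omega> \<in> S2" "\<And>\<xi>. \<xi> \<in> S2 \<Longrightarrow> f \<xi> = g \<xi>"
  shows "sphere_grad f \<omega> = sphere_grad g \<omega>"
proof -
  have "(f has_derivative L) (at \<omega> within S2) = (g has_derivative L) (at \<omega> within S2)" for L
    using assms by (intro has_derivative_cong_within) auto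
  then show ?thesis by (simp add: sphere_grad_def)
qed

lemma sphere_grad_lin:
  assumes "\<omega> \<in> S2" "f differentiable (at \<omega> within S2)" "g differentiable (at \<omega> within S2)"
  shows "sphere_grad (\<lambda>\<xi>. a * f \<xi> + b * g \<xi>) \<omega> = a *\<^sub>R sphere_grad f \<omega> + b *\<^sub>R sphere_grad g \<omega>"
  using assms
  by (intro sphere_grad_eq)
    (auto simp: inner_add_left sphere_grad_tangent
      intro!: derivative_eq_intros sphere_grad_has_derivative)

section \<open>Linear structure and norms of the spaces C^k(S)\<close>

lemma Ck_sphere_cong:
  assumes "\<And>\<xi>. \<xi> \<in> S2 \<Longrightarrow> f \<xi> = g \<xi>"
  shows "Ck_sphere k f \<longleftrightarrow> Ck_sphere k g"
  using assms
proof (induction k arbitrary: f g)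
  case 0
  then show ?case by (auto intro!: continuous_on_cong)
next
  case (Suc k)
  have "f differentiable_on S2 \<longleftrightarrow> g differentiable_on S2"
    unfolding differentiable_on_def differentiable_def
    using Suc.prems has_derivative_cong_within[of _ S2 f g] by blast
  moreover have "Ck_sphere k (\<lambda>\<omega>. sphere_grad f \<omega> $ i) \<longleftrightarrow> Ck_sphere k (\<lambda>\<omega>. sphere_grad g \<omega> $ i)" for i
    using sphere_grad_cong Suc.prems by (intro Suc.IH) metis
  ultimately show ?case by simp
qed

lemma sup_norm_cong: "(\<And>z. z \<in> A \<Longrightarrow> f z = g z) \<Longrightarrow> sup_norm A f = sup_norm A g"
  by (simp add: sup_norm_def)

lemma Ck_sphere_norm_cong:
  assumes "\<And>\<xi>. \<xi> \<in> S2 \<Longrightarrow> f \<xi> = g \<xi>"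
  shows "Ck_sphere_norm k f = Ck_sphere_norm k g"
  using assms
proof (induction k arbitrary: f g)
  case 0
  then show ?case by (auto intro!: sup_norm_cong)
next
  case (Suc k)
  have "Ck_sphere_norm k (\<lambda>\<omega>. sphere_grad f \<omega> $ i) = Ck_sphere_norm k (\<lambda>\<omega>. sphere_grad g \<omega> $ i)" for i
    using sphere_grad_cong Suc.prems by (intro Suc.IH) metis
  moreover have "sup_norm S2 f = sup_norm S2 g" using Suc.prems by (rule sup_norm_cong)
  ultimately show ?case by simp
qed

lemma Ck_sphere_imp_continuous: "Ck_sphere k h \<Longrightarrow> continuous_on S2 h"
  by (cases k) (auto dest: differentiable_imp_continuous_on)

lemma Ck_sphere_mono_Suc: "Ck_sphere (Suc k) h \<Longrightarrow> Ck_sphere k h"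
  by (induction k arbitrary: h) (auto dest: differentiable_imp_continuous_on)

lemma Ck_sphere_lin:
  assumes "Ck_sphere k f" "Ck_sphere k g"
  shows "Ck_sphere k (\<lambda>\<omega>. a * f \<omega> + b * g \<omega>)"
  using assms
proof (induction k arbitrary: f g)
  case 0
  then show ?case by (auto intro!: continuous_intros)
next
  case (Suc k)
  have "(\<lambda>\<omega>. a * f \<omega> + b * g \<omega>) differentiable_on S2"
    using Suc.prems by (auto simp: differentiable_on_def intro!: derivative_intros)
  moreover have "Ck_sphere k (\<lambda>\<omega>. sphere_grad (\<lambda>\<omega>. a * f \<omega> + b * g \<omega>) \<omega> $ i)" for i
  proof (subst Ck_sphere_cong)
    show "Ck_sphere k (\<lambda>\<omega>. a * sphere_grad f \<omega> $ i + b * sphere_grad g \<omega> $ i)"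
      using Suc.prems by (intro Suc.IH) auto
  qed (use Suc.prems in \<open>auto simp: sphere_grad_lin differentiable_on_def\<close>)
  ultimately show ?case by simp
qed

lemma sup_norm_upper:
  "bdd_above ((\<lambda>z. \<bar>f z\<bar>) ` A) \<Longrightarrow> z \<in> A \<Longrightarrow> \<bar>f z\<bar> \<le> sup_norm A f"
  unfolding sup_norm_def by (rule cSUP_upper)

lemma sup_norm_least: "A \<noteq> {} \<Longrightarrow> (\<And>z. z \<in> A \<Longrightarrow> \<bar>f z\<bar> \<le> C) \<Longrightarrow> sup_norm A f \<le> C"
  unfolding sup_norm_def by (rule cSUP_least)

lemma bdd_above_abs_compact:
  "compact A \<Longrightarrow> continuous_on A f \<Longrightarrow> bdd_above ((\<lambda>z. \<bar>f z :: real\<bar>) ` A)"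
  by (intro bounded_imp_bdd_above compact_imp_bounded compact_continuous_image continuous_intros)

lemma sphere_nonempty: "(S2::r3 set) \<noteq> {}"
  using sphere_eq_empty[of "0::r3" 1] by simp

text \<open>\<open>sup_norm\<close> is a supremum of reals, meaningful only for bounded sets;
  continuity on the compact sphere supplies the boundedness.\<close>

lemma Ck_sphere_sup_norm_upper: "Ck_sphere k h \<Longrightarrow> \<omega> \<in> S2 \<Longrightarrow> \<bar>h \<omega>\<bar> \<le> sup_norm S2 h"
  by (intro sup_norm_upper bdd_above_abs_compact Ck_sphere_imp_continuous) auto

lemma Ck_sphere_sup_norm_nonneg: "Ck_sphere k h \<Longrightarrow> 0 \<le> sup_norm S2 h"
  using sphere_nonempty Ck_sphere_sup_norm_upper[of k h] abs_ge_zero order_trans by blast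

lemma Ck_sphere_norm_nonneg: "Ck_sphere k h \<Longrightarrow> 0 \<le> Ck_sphere_norm k h"
  by (induction k arbitrary: h)
    (auto simp del: Ck_sphere.simps(2) simp: Ck_sphere_sup_norm_nonneg[of 0] Ck_sphere_sup_norm_nonneg[of "Suc _"]
      Ck_sphere.simps(2)[THEN iffD1]
      intro!: add_nonneg_nonneg sum_nonneg)

text \<open>Triangle inequality and homogeneity in one statement. The gradient is linear only at
  points of the sphere, so the recursion passes through the congruence of the norms.\<close>

lemma Ck_sphere_norm_lin:
  assumes "Ck_sphere k f" "Ck_sphere k g"
  shows "Ck_sphere_norm k (\<lambda>\<omega>. a * f \<omega> + b * g \<omega>) \<le> \<bar>a\<bar> * Ck_sphere_norm k f + \<bar>b\<bar> * Ck_sphere_norm k g"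
  using assms
proof (induction k arbitrary: f g)
  have *: "sup_norm S2 (\<lambda>\<omega>. a * f \<omega> + b * g \<omega>) \<le> \<bar>a\<bar> * sup_norm S2 f + \<bar>b\<bar> * sup_norm S2 g"
    if "Ck_sphere k f" "Ck_sphere k g" for k f g
  proof (rule sup_norm_least[OF sphere_nonempty])
    fix z :: r3 assume z: "z \<in> S2"
    have "\<bar>a * f z + b * g z\<bar> \<le> \<bar>a\<bar> * \<bar>f z\<bar> + \<bar>b\<bar> * \<bar>g z\<bar>"
      by (metis abs_mult abs_triangle_ineq)
    also have "\<dots> \<le> \<bar>a\<bar> * sup_norm S2 f + \<bar>b\<bar> * sup_norm S2 g"
      using z that by (intro add_mono mult_left_mono Ck_sphere_sup_norm_upper) auto
    finally show "\<bar>a * f z + b * g z\<bar> \<le> \<bar>a\<bar> * sup_norm S2 f + \<bar>b\<bar> * sup_norm S2 g" .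
  qed
  {
    case 0
    then show ?case using *[of 0] by simp
  next
    case (Suc k)
    have "Ck_sphere_norm k (\<lambda>\<omega>. sphere_grad (\<lambda>\<omega>. a * f \<omega> + b * g \<omega>) \<omega> $ i)
      \<le> \<bar>a\<bar> * Ck_sphere_norm k (\<lambda>\<omega>. sphere_grad f \<omega> $ i) + \<bar>b\<bar> * Ck_sphere_norm k (\<lambda>\<omega>. sphere_grad g \<omega> $ i)" for i
    proof (subst Ck_sphere_norm_cong)
      show "Ck_sphere_norm k (\<lambda>\<omega>. a * sphere_grad f \<omega> $ i + b * sphere_grad g \<omega> $ i)
        \<le> \<bar>a\<bar> * Ck_sphere_norm k (\<lambda>\<omega>. sphere_grad f \<omega> $ i) + \<bar>b\<bar> * Ck_sphere_norm k (\<lambda>\<omega>. sphere_grad g \<omega> $ i)"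
        using Suc.prems by (intro Suc.IH) auto
    qed (use Suc.prems in \<open>auto simp: sphere_grad_lin differentiable_on_def\<close>)
    then have "(\<Sum>i\<in>UNIV. Ck_sphere_norm k (\<lambda>\<omega>. sphere_grad (\<lambda>\<omega>. a * f \<omega> + b * g \<omega>) \<omega> $ i))
      \<le> (\<Sum>i\<in>UNIV. \<bar>a\<bar> * Ck_sphere_norm k (\<lambda>\<omega>. sphere_grad f \<omega> $ i)
          + \<bar>b\<bar> * Ck_sphere_norm k (\<lambda>\<omega>. sphere_grad g \<omega> $ i))"
      by (intro sum_mono)
    with *[OF Suc.prems] show ?case
      by (simp add: sum.distrib sum_distrib_left[symmetric] distrib_left)
  }
qed

text \<open>The head of the list is the derivative taken last. Ambient components of tangential
  gradients do not commute in general, so the order of the list matters.\<close>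

primrec sgD :: "3 list \<Rightarrow> (r3 \<Rightarrow> real) \<Rightarrow> r3 \<Rightarrow> real" where
  "sgD [] h = h"
| "sgD (i # is) h = (\<lambda>\<omega>. sphere_grad (sgD is h) \<omega> $ i)"

text \<open>\<open>Ck_sphere\<close> and its norm recurse on the innermost derivative,
  \<open>sgD\<close> on the outermost. This equation lets inductions on the order of smoothness
  split lists at the end.\<close>

lemma sgD_snoc: "sgD (is @ [i]) h = sgD is (\<lambda>\<omega>. sphere_grad h \<omega> $ i)"
  by (induction "is") auto

lemma Ck_sphere_sgD:
  "Ck_sphere k h \<Longrightarrow> length is \<le> k \<Longrightarrow> Ck_sphere (k - length is) (sgD is h)"
proof (induction k arbitrary: h "is")
  case 0 then show ?case by simp
next
  case (Suc k)
  then show ?case by (cases "is" rule: rev_cases) (auto simp: sgD_snoc)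
qed

lemma sgD_differentiable:
  "Ck_sphere k h \<Longrightarrow> length is < k \<Longrightarrow> \<omega> \<in> S2 \<Longrightarrow> sgD is h differentiable (at \<omega> within S2)"
  using Ck_sphere_sgD[of k h "is"] by (cases "k - length is") (auto simp: differentiable_on_def)

text \<open>The norm is a sum of nonnegative terms, and unfolding its recursion produces the sup
  norm of each iterated derivative up to order \<open>k\<close> as one of them.\<close>

lemma sgD_abs_le:
  "Ck_sphere k h \<Longrightarrow> length is \<le> k \<Longrightarrow> \<omega> \<in> S2 \<Longrightarrow> \<bar>sgD is h \<omega>\<bar> \<le> Ck_sphere_norm k h"
proof (induction k arbitrary: h "is")
  case 0 then show ?case using Ck_sphere_sup_norm_upper[of 0 h] by simp
next
  case (Suc k)
  have nn: "0 \<le> Ck_sphere_norm k (\<lambda>\<omega>. sphere_grad h \<omega> $ i)" for i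
    using Suc.prems by (intro Ck_sphere_norm_nonneg) auto
  show ?case
  proof (cases "is" rule: rev_cases)
    case Nil
    then show ?thesis
      using Ck_sphere_sup_norm_upper[OF Suc.prems(1,3)] sum_nonneg[of "UNIV::3 set", OF nn] by (simp add: add_increasing2)
  next
    case (snoc js j)
    have "\<bar>sgD is h \<omega>\<bar> \<le> Ck_sphere_norm k (\<lambda>\<omega>. sphere_grad h \<omega> $ j)"
      using Suc.prems by (simp add: snoc sgD_snoc Suc.IH)
    also have "\<dots> \<le> (\<Sum>i\<in>UNIV. Ck_sphere_norm k (\<lambda>\<omega>. sphere_grad h \<omega> $ i))"
      using nn by (intro member_le_sum) auto
    finally show ?thesis
      using Ck_sphere_sup_norm_nonneg[OF Suc.prems(1)] by simp
  qed
qed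

lemma sgD_lin:
  assumes "Ck_sphere k f" "Ck_sphere k g"
  shows "length is \<le> k \<Longrightarrow> \<omega> \<in> S2 \<Longrightarrow>
    sgD is (\<lambda>\<xi>. a * f \<xi> + b * g \<xi>) \<omega> = a * sgD is f \<omega> + b * sgD is g \<omega>"
proof (induction "is" arbitrary: \<omega>)
  case (Cons i "is")
  have "sphere_grad (sgD is (\<lambda>\<xi>. a * f \<xi> + b * g \<xi>)) \<omega>
    = sphere_grad (\<lambda>\<xi>. a * sgD is f \<xi> + b * sgD is g \<xi>) \<omega>"
    using Cons by (intro sphere_grad_cong) auto
  also have "\<dots> = a *\<^sub>R sphere_grad (sgD is f) \<omega> + b *\<^sub>R sphere_grad (sgD is g) \<omega>"
    using Cons.prems assms by (intro sphere_grad_lin sgD_differentiable[of k]) auto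
  finally show ?case by simp
qed simp


text \<open>Continuity into a space with a sup norm gives joint continuity: near
  \<open>(x, z)\<close> a change of the parameter moves the value by an amount that is small
  uniformly in the second variable, and the slice at the fixed \<open>x\<close> is
  continuous.\<close>

lemma continuous_on_Times_uniform:
  fixes l :: "'a::metric_space \<Rightarrow> 'b::metric_space \<Rightarrow> real"
  assumes c: "\<And>x. x \<in> K \<Longrightarrow> continuous_on S (l x)"
    and b: "\<And>x y z. x \<in> K \<Longrightarrow> y \<in> K \<Longrightarrow> z \<in> S \<Longrightarrow> \<bar>l y z - l x z\<bar> \<le> d x y"
    and d: "\<And>x. x \<in> K \<Longrightarrow> (d x \<longlongrightarrow> 0) (at x within K)"
  shows "continuous_on (K \<times> S) (\<lambda>(x, z). l x z)"
  unfolding continuous_on_def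
proof
  fix p assume "p \<in> K \<times> S"
  then obtain x z where p: "p = (x, z)" and xz: "x \<in> K" "z \<in> S" by auto
  let ?F = "at (x, z) within K \<times> S"
  have "eventually (\<lambda>p. \<bar>l (fst p) (snd p) - l x (snd p)\<bar> < e) ?F" if "0 < e" for e :: real
  proof -
    have "eventually (\<lambda>y. d x y < e) (at x within K)"
      using d[OF xz(1)] that by (rule order_tendstoD)
    then obtain \<delta> where \<delta>: "\<delta> > 0" "\<And>y. y \<in> K \<Longrightarrow> y \<noteq> x \<Longrightarrow> dist y x < \<delta> \<Longrightarrow> d x y < e"
      by (auto simp: eventually_at)
    have "\<bar>l y w - l x w\<bar> < e" if "y \<in> K" "w \<in> S" "dist y x < \<delta>" for y w
      using \<delta>(2)[of y] that b[OF xz(1), of y w] \<open>0 < e\<close> by (cases "y = x") auto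
    moreover have "dist y x \<le> dist (y, w) (x, z)" for y w
      using dist_fst_le[of "(y,w)" "(x,z)"] by simp
    ultimately show ?thesis
      unfolding eventually_at using \<delta>(1) by (intro exI[of _ \<delta>]) (force dest: le_less_trans)
  qed
  then have 1: "((\<lambda>p. l (fst p) (snd p) - l x (snd p)) \<longlongrightarrow> 0) ?F"
    by (intro tendstoI) (simp add: dist_real_def)
  have "continuous_on (K \<times> S) (\<lambda>p. l x (snd p))"
    by (intro continuous_on_compose2[OF c[OF xz(1)]] continuous_intros) auto
  then have 2: "((\<lambda>p. l x (snd p)) \<longlongrightarrow> l x z) ?F"
    using xz by (force simp: continuous_on_def)
  from tendsto_add[OF 1 2] show "((\<lambda>(x, z). l x z) \<longlongrightarrow> (case p of (x, z) \<Rightarrow> l x z)) (at p within K \<times> S)"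
    by (simp add: case_prod_unfold p)
qed

section \<open>One-sided derivatives on a closed interval\<close>

lemma deriv_in_eq:
  assumes "(f has_real_derivative D) (at t within {a..b})" "a < b" "t \<in> {a..b}"
  shows "deriv_in a b f t = D"
proof -
  have "at t within {a..b} \<noteq> bot"
    using assms trivial_limit_within[of t "{a..b}"] islimpt_Icc[of a b t] by auto
  then show ?thesis
    unfolding deriv_in_def using assms(1)
    by (intro vector_derivative_within) (auto simp: has_real_derivative_iff_has_vector_derivative)
qed

lemma deriv_in_derivative:
  assumes "f differentiable (at t within {a..b})" "a < b" "t \<in> {a..b}"
  shows "(f has_real_derivative deriv_in a b f t) (at t within {a..b})"
proof -
  obtain D where "(f has_real_derivative D) (at t within {a..b})"
    using assms(1) by (auto simp: real_differentiable_def)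
  with deriv_in_eq[OF this assms(2,3)] show ?thesis by simp
qed

lemma deriv_in_cong:
  assumes "t \<in> {a..b}" "\<And>s. s \<in> {a..b} \<Longrightarrow> f s = g s"
  shows "deriv_in a b f t = deriv_in a b g t"
proof -
  have "(f has_vector_derivative D) (at t within {a..b}) = (g has_vector_derivative D) (at t within {a..b})" for D
    using assms by (metis has_vector_derivative_transform)
  then show ?thesis by (simp add: deriv_in_def vector_derivative_def)
qed

section \<open>Curves in \<open>C\<^sup>k(S)\<close>\<close>

lemma Ck_sphere_diff:
  "Ck_sphere k f \<Longrightarrow> Ck_sphere k g \<Longrightarrow> Ck_sphere k (\<lambda>\<omega>. f \<omega> - g \<omega>)"
  using Ck_sphere_lin[of k f g 1 "-1"] by simp

lemma sgD_diff:
  "Ck_sphere k f \<Longrightarrow> Ck_sphere k g \<Longrightarrow> length is \<le> k \<Longrightarrow> \<omega> \<in> S2 \<Longrightarrow>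
    sgD is (\<lambda>\<omega>. f \<omega> - g \<omega>) \<omega> = sgD is f \<omega> - sgD is g \<omega>"
  using sgD_lin[of k f g "is" \<omega> 1 "-1"] by simp

lemma Ck_sphere_norm_triangle:
  assumes "Ck_sphere k f" "Ck_sphere k g"
  shows "\<bar>Ck_sphere_norm k f - Ck_sphere_norm k g\<bar> \<le> Ck_sphere_norm k (\<lambda>\<omega>. f \<omega> - g \<omega>)"
proof -
  have "Ck_sphere_norm k f \<le> Ck_sphere_norm k (\<lambda>\<omega>. f \<omega> - g \<omega>) + Ck_sphere_norm k g"
    using Ck_sphere_norm_lin[OF Ck_sphere_diff[OF assms] assms(2), of 1 1] by simp
  moreover have "Ck_sphere_norm k g \<le> Ck_sphere_norm k (\<lambda>\<omega>. f \<omega> - g \<omega>) + Ck_sphere_norm k f"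
    using Ck_sphere_norm_lin[OF Ck_sphere_diff[OF assms] assms(1), of "-1" 1] by simp
  ultimately show ?thesis by linarith
qed

abbreviation (input) curve :: "real \<Rightarrow> real \<Rightarrow> nat \<Rightarrow> nat \<Rightarrow> (real \<Rightarrow> r3 \<Rightarrow> real) \<Rightarrow> bool" where
  "curve a b k \<equiv> Ck_interval_into a b (Ck_sphere k) (Ck_sphere_norm k)"

abbreviation (input) curve_norm :: "real \<Rightarrow> real \<Rightarrow> nat \<Rightarrow> nat \<Rightarrow> (real \<Rightarrow> r3 \<Rightarrow> real) \<Rightarrow> real" where
  "curve_norm a b k \<equiv> Ck_interval_norm a b (Ck_sphere_norm k)"

lemma curve_C0: "curve a b k n u \<Longrightarrow> C0_into {a..b} (Ck_sphere k) (Ck_sphere_norm k) u"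
  by (cases n) auto

lemma curve_iterate:
  "curve a b k n u \<Longrightarrow> j \<le> n \<Longrightarrow> curve a b k (n - j) ((deriv_param a b ^^ j) u)"
proof (induction j)
  case (Suc j)
  then obtain m where "n - j = Suc m" by (metis Suc_diff_Suc Suc_le_lessD)
  with Suc show ?case by (auto simp: diff_Suc)
qed simp

lemma C0_into_sphere_continuous:
  fixes u :: "'a::metric_space \<Rightarrow> r3 \<Rightarrow> real"
  assumes "C0_into K (Ck_sphere k) (Ck_sphere_norm k) u" "length is \<le> k"
  shows "continuous_on (K \<times> S2) (\<lambda>(t, \<omega>). sgD is (u t) \<omega>)"
proof (rule continuous_on_Times_uniform)
  have u: "\<And>t. t \<in> K \<Longrightarrow> Ck_sphere k (u t)" using assms(1) by (simp add: C0_into_def)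
  show "continuous_on S2 (sgD is (u t))" if "t \<in> K" for t
    using Ck_sphere_sgD[OF u[OF that] assms(2)] by (rule Ck_sphere_imp_continuous)
  show "((\<lambda>y. Ck_sphere_norm k (\<lambda>z. u y z - u x z)) \<longlongrightarrow> 0) (at x within K)" if "x \<in> K" for x
    using assms(1) that by (simp add: C0_into_def)
  show "\<bar>sgD is (u y) z - sgD is (u x) z\<bar> \<le> Ck_sphere_norm k (\<lambda>z. u y z - u x z)"
    if "x \<in> K" "y \<in> K" "z \<in> S2" for x y z
    using sgD_abs_le[OF Ck_sphere_diff[OF u u] assms(2) that(3)] that
    by (simp add: sgD_diff[OF u u assms(2)])
qed

lemma C0_into_sphere_norm_continuous:
  assumes "C0_into K (Ck_sphere k) (Ck_sphere_norm k) u"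
  shows "continuous_on K (\<lambda>t. Ck_sphere_norm k (u t))"
  unfolding continuous_on_def
proof
  fix t assume t: "t \<in> K"
  have u: "\<And>t. t \<in> K \<Longrightarrow> Ck_sphere k (u t)" using assms(1) by (simp add: C0_into_def)
  have "((\<lambda>s. Ck_sphere_norm k (\<lambda>z. u s z - u t z)) \<longlongrightarrow> 0) (at t within K)"
    using assms t by (simp add: C0_into_def)
  then have "((\<lambda>s. Ck_sphere_norm k (u s) - Ck_sphere_norm k (u t)) \<longlongrightarrow> 0) (at t within K)"
  proof (rule Lim_null_comparison[rotated])
    show "\<forall>\<^sub>F s in at t within K. norm (Ck_sphere_norm k (u s) - Ck_sphere_norm k (u t))
        \<le> Ck_sphere_norm k (\<lambda>z. u s z - u t z)"
      using Ck_sphere_norm_triangle[OF u u[OF t]] by (auto simp: eventually_at_filter)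
  qed
  then show "((\<lambda>t. Ck_sphere_norm k (u t)) \<longlongrightarrow> Ck_sphere_norm k (u t)) (at t within K)"
    by (rule Lim_null[THEN iffD2])
qed

text \<open>The norm of C^k(S) dominates every iterated tangential derivative pointwise and
  \<open>sgD\<close> is linear, so convergence of the difference quotients in norm passes to each
  \<open>sgD\<close>. Energy and tangential derivatives therefore commute.\<close>

lemma curve_derivative:
  assumes "curve a b k (Suc n) u" "length is \<le> k" "t \<in> {a..b}" "\<omega> \<in> S2"
  shows "((\<lambda>s. sgD is (u s) \<omega>) has_real_derivative sgD is (deriv_param a b u t) \<omega>) (at t within {a..b})"
proof -
  have u: "\<And>t. t \<in> {a..b} \<Longrightarrow> Ck_sphere k (u t)" "\<And>t. t \<in> {a..b} \<Longrightarrow> Ck_sphere k (deriv_param a b u t)"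
    using curve_C0[OF assms(1)] curve_C0[of a b k n "deriv_param a b u"] assms(1) by (auto simp: C0_into_def)
  let ?q = "\<lambda>s z. (u s z - u t z) / (s - t) - deriv_param a b u t z"
  have q: "?q s = (\<lambda>z. (1 / (s - t)) * (u s z - u t z) + (-1) * deriv_param a b u t z)" for s
    by auto
  have qC: "Ck_sphere k (?q s)" if "s \<in> {a..b}" for s
    unfolding q using u that assms by (intro Ck_sphere_lin Ck_sphere_diff) auto
  have qD: "sgD is (?q s) \<omega> = (sgD is (u s) \<omega> - sgD is (u t) \<omega>) / (s - t) - sgD is (deriv_param a b u t) \<omega>"
    if "s \<in> {a..b}" for s
    unfolding q using u that assms
    by (subst sgD_lin[of k]) (auto intro!: Ck_sphere_diff simp: sgD_diff[of k])
  have "((\<lambda>s. Ck_sphere_norm k (?q s)) \<longlongrightarrow> 0) (at t within {a..b})"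
    using assms(1,3) by simp
  then have "((\<lambda>s. (sgD is (u s) \<omega> - sgD is (u t) \<omega>) / (s - t) - sgD is (deriv_param a b u t) \<omega>) \<longlongrightarrow> 0)
      (at t within {a..b})"
  proof (rule Lim_null_comparison[rotated])
    show "\<forall>\<^sub>F s in at t within {a..b}.
        norm ((sgD is (u s) \<omega> - sgD is (u t) \<omega>) / (s - t) - sgD is (deriv_param a b u t) \<omega>)
        \<le> Ck_sphere_norm k (?q s)"
      unfolding eventually_at_filter
    proof (intro always_eventually allI impI)
      fix s assume s: "s \<in> {a..b}"
      show "norm ((sgD is (u s) \<omega> - sgD is (u t) \<omega>) / (s - t) - sgD is (deriv_param a b u t) \<omega>)
        \<le> Ck_sphere_norm k (?q s)"
        using sgD_abs_le[OF qC[OF s] assms(2,4)] qD[OF s] by simp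
    qed
  qed
  then show ?thesis
    unfolding has_field_derivative_iff by (rule Lim_null[THEN iffD2])
qed

lemma deriv_param_sphere:
  assumes "curve a b k (Suc n) u" "a < b" "t \<in> {a..b}" "\<omega> \<in> S2"
  shows "((\<lambda>s. u s \<omega>) has_real_derivative deriv_param a b u t \<omega>) (at t within {a..b})"
  using curve_derivative[OF assms(1), of "[]" t \<omega>] assms by simp

lemma deriv_param_diff:
  assumes "curve a b k n u" "curve a b k n w" "a < b"
  shows "j \<le> n \<Longrightarrow> t \<in> {a..b} \<Longrightarrow> \<omega> \<in> S2 \<Longrightarrow> (deriv_param a b ^^ j) (\<lambda>t \<omega>. u t \<omega> - w t \<omega>) t \<omega>
    = (deriv_param a b ^^ j) u t \<omega> - (deriv_param a b ^^ j) w t \<omega>"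
proof (induction j arbitrary: t)
  case (Suc j)
  have c: "curve a b k (Suc (n - Suc j)) ((deriv_param a b ^^ j) u)" "curve a b k (Suc (n - Suc j)) ((deriv_param a b ^^ j) w)"
    using curve_iterate[OF assms(1), of j] curve_iterate[OF assms(2), of j] Suc.prems
    by (simp_all only: Suc_diff_Suc Suc_le_lessD)
  have "(deriv_param a b ^^ Suc j) (\<lambda>t \<omega>. u t \<omega> - w t \<omega>) t \<omega>
    = deriv_in a b (\<lambda>s. (deriv_param a b ^^ j) (\<lambda>t \<omega>. u t \<omega> - w t \<omega>) s \<omega>) t"
    by (simp add: deriv_param_def)
  also have "\<dots> = deriv_in a b (\<lambda>s. (deriv_param a b ^^ j) u s \<omega> - (deriv_param a b ^^ j) w s \<omega>) t"
    using Suc by (intro deriv_in_cong) auto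
  also have "\<dots> = deriv_param a b ((deriv_param a b ^^ j) u) t \<omega> - deriv_param a b ((deriv_param a b ^^ j) w) t \<omega>"
    using Suc.prems assms(3) deriv_param_sphere[OF c(1)] deriv_param_sphere[OF c(2)]
    by (intro deriv_in_eq derivative_intros) auto
  finally show ?case by simp
qed simp

lemma Ck_interval_norm_eq_sum:
  "Ck_interval_norm a b N n u = (\<Sum>j\<le>n. sup_norm {a..b} (\<lambda>t. N ((deriv_param a b ^^ j) u t)))"
proof (induction n arbitrary: u)
  case (Suc n)
  show ?case
    by (subst sum.atMost_Suc_shift) (simp add: Suc funpow_swap1)
qed simp

text \<open>The norm of a difference controls the difference of every mixed derivative. With two
  points of the closure of \<open>G\<close> in place of \<open>u\<close> and \<open>w\<close> this
  is the modulus of continuity of the jets in space.\<close>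

lemma curve_norm_bound:
  assumes "curve a b k n u" "curve a b k n w" "a < b"
    and "j \<le> n" "length is \<le> k" "t \<in> {a..b}" "\<omega> \<in> S2"
  shows "\<bar>sgD is ((deriv_param a b ^^ j) u t) \<omega> - sgD is ((deriv_param a b ^^ j) w t) \<omega>\<bar>
    \<le> curve_norm a b k n (\<lambda>t \<omega>. u t \<omega> - w t \<omega>)"
proof -
  let ?d = "\<lambda>j t \<omega>. (deriv_param a b ^^ j) u t \<omega> - (deriv_param a b ^^ j) w t \<omega>"
  have C: "C0_into {a..b} (Ck_sphere k) (Ck_sphere_norm k) ((deriv_param a b ^^ j) u)"
     "C0_into {a..b} (Ck_sphere k) (Ck_sphere_norm k) ((deriv_param a b ^^ j) w)" if "j \<le> n" for j
    using curve_C0[OF curve_iterate[OF _ that]] assms by auto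
  then have uw: "Ck_sphere k ((deriv_param a b ^^ j) u t)" "Ck_sphere k ((deriv_param a b ^^ j) w t)"
    if "j \<le> n" "t \<in> {a..b}" for j t
    using that by (auto simp: C0_into_def)
  have N: "Ck_sphere_norm k ((deriv_param a b ^^ j) (\<lambda>t \<omega>. u t \<omega> - w t \<omega>) t) = Ck_sphere_norm k (?d j t)"
    if "j \<le> n" "t \<in> {a..b}" for j t
    using deriv_param_diff[OF assms(1-3) that] by (intro Ck_sphere_norm_cong) auto
  \<comment> \<open>The real supremum over \<open>t\<close> needs a bound: the norm of the
    difference is at most the sum of the two norms, and that sum is continuous on the compact
    interval.\<close>
  have bdd: "bdd_above ((\<lambda>t. \<bar>Ck_sphere_norm k (?d j t)\<bar>) ` {a..b})" if "j \<le> n" for j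
  proof -
    have "bdd_above ((\<lambda>t. \<bar>Ck_sphere_norm k ((deriv_param a b ^^ j) u t) + Ck_sphere_norm k ((deriv_param a b ^^ j) w t)\<bar>) ` {a..b})"
      using C[OF that] by (intro bdd_above_abs_compact continuous_intros C0_into_sphere_norm_continuous) auto
    then obtain B where B: "\<And>t. t \<in> {a..b} \<Longrightarrow>
        \<bar>Ck_sphere_norm k ((deriv_param a b ^^ j) u t) + Ck_sphere_norm k ((deriv_param a b ^^ j) w t)\<bar> \<le> B"
      unfolding bdd_above_def by blast
    have "\<bar>Ck_sphere_norm k (?d j t)\<bar> \<le> B" if t: "t \<in> {a..b}" for t
      using B[OF t] Ck_sphere_norm_lin[OF uw[OF \<open>j \<le> n\<close> t], of 1 "-1"]
        Ck_sphere_norm_nonneg[OF Ck_sphere_diff[OF uw[OF \<open>j \<le> n\<close> t]]] by simp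
    then show ?thesis unfolding bdd_above_def by blast
  qed
  have snn: "0 \<le> sup_norm {a..b} (\<lambda>t. Ck_sphere_norm k (?d j t))" if "j \<le> n" for j
    using sup_norm_upper[OF bdd[OF that], of a] assms(3) by auto
  have "\<bar>sgD is ((deriv_param a b ^^ j) u t) \<omega> - sgD is ((deriv_param a b ^^ j) w t) \<omega>\<bar>
    = \<bar>sgD is (?d j t) \<omega>\<bar>"
    by (subst sgD_diff[OF uw]) (use assms in auto)
  also have "\<dots> \<le> Ck_sphere_norm k (?d j t)"
    by (intro sgD_abs_le Ck_sphere_diff uw) (use assms in auto)
  also have "\<dots> \<le> sup_norm {a..b} (\<lambda>t. Ck_sphere_norm k (?d j t))"
    using sup_norm_upper[OF bdd[OF assms(4)] assms(6)] by linarith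
  also have "\<dots> \<le> (\<Sum>j\<le>n. sup_norm {a..b} (\<lambda>t. Ck_sphere_norm k (?d j t)))"
    using assms(4) snn by (intro member_le_sum) auto
  also have "\<dots> = curve_norm a b k n (\<lambda>t \<omega>. u t \<omega> - w t \<omega>)"
    unfolding Ck_interval_norm_eq_sum using N by (intro sum.cong sup_norm_cong) auto
  finally show ?thesis .
qed

text \<open>All derivatives of an element of \<open>C\<^sup>1(closure G, C\<^sup>2(I, C\<^sup>3(S)))\<close>: \<open>j\<close> times in \<open>E\<close> and along
  the components \<open>is\<close> of the gradient on the sphere.\<close>

definition jet :: "real \<Rightarrow> real \<Rightarrow> (r3 \<Rightarrow> r3 \<Rightarrow> real \<Rightarrow> real) \<Rightarrow> nat \<Rightarrow> 3 list \<Rightarrow> r3 \<Rightarrow> r3 \<Rightarrow> real \<Rightarrow> real" where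
  "jet a b v j is x \<omega> E = sgD is ((deriv_param a b ^^ j) (\<lambda>E \<omega>. v x \<omega> E) E) \<omega>"

lemma jet_0_Nil [simp]: "jet a b v 0 [] x \<omega> E = v x \<omega> E"
  by (simp add: jet_def)

lemma jet_Suc_Nil: "jet a b v (Suc 0) [] x \<omega> = deriv_in a b (v x \<omega>)"
  by (simp add: jet_def deriv_param_def fun_eq_iff)

lemma C123_curve: "C123 G a b v \<Longrightarrow> x \<in> closure G \<Longrightarrow> curve a b 3 2 (\<lambda>E \<omega>. v x \<omega> E)"
  by (simp add: C123_def C1_closure_into_def C0_into_def)

text \<open>\<open>continuous_on_Times_uniform\<close> enters twice: with the energy as parameter
  inside \<open>C0_into_sphere_continuous\<close>, and here with the point in space as
  parameter.\<close>

lemma jet_continuous: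
  assumes "C123 G a b v" "a < b" "j \<le> 2" "length is \<le> 3"
  shows "continuous_on (closure G \<times> S2 \<times> {a..b}) (\<lambda>(x, \<omega>, E). jet a b v j is x \<omega> E)"
proof -
  note c = C123_curve[OF assms(1)]
  have "continuous_on (closure G \<times> (S2 \<times> {a..b})) (\<lambda>(x, z). case z of (\<omega>, E) \<Rightarrow> jet a b v j is x \<omega> E)"
  proof (rule continuous_on_Times_uniform)
    show "continuous_on (S2 \<times> {a..b}) (\<lambda>(\<omega>, E). jet a b v j is x \<omega> E)" if "x \<in> closure G" for x
      unfolding jet_def
      using C0_into_sphere_continuous[OF curve_C0[OF curve_iterate[OF c[OF that] assms(3)]] assms(4)]
      by (rule continuous_on_swap_args)
    show "((\<lambda>y. curve_norm a b 3 2 (\<lambda>E \<omega>. v y \<omega> E - v x \<omega> E)) \<longlongrightarrow> 0) (at x within closure G)" if "x \<in> closure G" for x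
      using assms(1) that by (simp add: C123_def C1_closure_into_def C0_into_def)
    show "\<bar>(case z of (\<omega>, E) \<Rightarrow> jet a b v j is y \<omega> E) - (case z of (\<omega>, E) \<Rightarrow> jet a b v j is x \<omega> E)\<bar>
      \<le> curve_norm a b 3 2 (\<lambda>E \<omega>. v y \<omega> E - v x \<omega> E)"
      if "x \<in> closure G" "y \<in> closure G" "z \<in> S2 \<times> {a..b}" for x y z
      using curve_norm_bound[OF c[OF that(2)] c[OF that(1)] assms(2-4)] that(3)
      by (auto simp: jet_def)
  qed
  then show ?thesis by (simp add: case_prod_beta)
qed

lemma jet_derivative:
  assumes "C123 G a b v" "x \<in> closure G" "j < 2" "length is \<le> 3" "E \<in> {a..b}" "\<omega> \<in> S2"
  shows "((\<lambda>E. jet a b v j is x \<omega> E) has_real_derivative jet a b v (Suc j) is x \<omega> E) (at E within {a..b})"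
proof -
  have "curve a b 3 (Suc (1 - j)) ((deriv_param a b ^^ j) (\<lambda>E \<omega>. v x \<omega> E))"
    using curve_iterate[OF C123_curve[OF assms(1,2)], of j] assms(3) by (simp add: numeral_2_eq_2 Suc_diff_le)
  from curve_derivative[OF this assms(4-6)] show ?thesis
    by (simp add: jet_def)
qed

lemma jet_Ck_sphere:
  assumes "C123 G a b v" "x \<in> closure G" "j \<le> 2" "length is \<le> 3" "E \<in> {a..b}"
  shows "Ck_sphere (3 - length is) (\<lambda>\<omega>. jet a b v j is x \<omega> E)"
proof -
  have "Ck_sphere 3 ((deriv_param a b ^^ j) (\<lambda>E \<omega>. v x \<omega> E) E)"
    using curve_C0[OF curve_iterate[OF C123_curve[OF assms(1,2)] assms(3)]] assms(5) by (simp add: C0_into_def)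
  from Ck_sphere_sgD[OF this assms(4)] show ?thesis by (simp add: jet_def[abs_def])
qed

lemma jet_sphere_grad: "sphere_grad (\<lambda>\<omega>. jet a b v j is x \<omega> E) \<omega> $ i = jet a b v j (i # is) x \<omega> E"
  by (simp add: jet_def)


section \<open>Hadamard finite parts\<close>

text \<open>The majorant of all quotients (f - L) / (x - t) below. The antiderivative - 2 sqrt (x -
  t) is continuous up to the end point, so the interior form of the fundamental theorem applies to
  the unbounded integrand.\<close>

lemma integrable_inverse_sqrt:
  fixes a x :: real
  assumes "a < x"
  shows "has_bochner_integral lborel (\<lambda>t. indicator {a..<x} t *\<^sub>R (1 / sqrt (x - t))) (2 * sqrt (x - a))"
proof -
  have "((\<lambda>t. 1 / sqrt (x - t)) has_integral (- 2 * sqrt (x - x) - - 2 * sqrt (x - a))) {a..x}"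
  proof (rule fundamental_theorem_of_calculus_interior)
    show "continuous_on {a..x} (\<lambda>t. - 2 * sqrt (x - t))" by (intro continuous_intros)
    show "((\<lambda>t. - 2 * sqrt (x - t)) has_vector_derivative 1 / sqrt (x - t)) (at t)" if "t \<in> {a<..<x}" for t
      using that unfolding has_real_derivative_iff_has_vector_derivative[symmetric]
      by (auto intro!: derivative_eq_intros simp: field_simps)
  qed (use assms in auto)
  then have "((\<lambda>t. 1 / sqrt (x - t)) has_integral 2 * sqrt (x - a)) {a..<x}"
    by (subst has_integral_spike_set_eq[of _ "{a..x}"])
       (auto intro: negligible_subset[of "{x}"])
  then have "((\<lambda>t. indicator {a..<x} t *\<^sub>R (1 / sqrt (x - t))) has_integral 2 * sqrt (x - a)) UNIV"
    by (subst (asm) has_integral_restrict_UNIV[symmetric])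
      (erule has_integral_eq[rotated], auto)
  then have "(\<integral>\<^sup>+t. indicator {a..<x} t *\<^sub>R (1 / sqrt (x - t)) \<partial>lborel) = 2 * sqrt (x - a)"
    by (intro nn_integral_has_integral_lborel) (auto split: split_indicator)
  then show ?thesis
    using assms by (intro has_bochner_integral_nn_integral) (auto split: split_indicator)
qed

lemma Lim_at_left_Hoelder:
  fixes f :: "real \<Rightarrow> real"
  assumes "a < x" "\<And>t. t \<in> {a<..<x} \<Longrightarrow> \<bar>f t - L\<bar> \<le> C * sqrt (x - t)"
  shows "(f \<longlongrightarrow> L) (at_left x)"
proof -
  have "((\<lambda>t. C * sqrt (x - t)) \<longlongrightarrow> C * sqrt (x - x)) (at_left x)"
    by (intro tendsto_intros)
  then have "((\<lambda>t. f t - L) \<longlongrightarrow> 0) (at_left x)"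
  proof (intro Lim_null_comparison[of "\<lambda>t. f t - L" "\<lambda>t. C * sqrt (x - t)"])
    show "\<forall>\<^sub>F t in at_left x. norm (f t - L) \<le> C * sqrt (x - t)"
      using eventually_at_left_real[OF assms(1)] by eventually_elim (use assms(2) in auto)
  qed simp
  then show ?thesis by (rule Lim_null[THEN iffD2])
qed

lemma at_left_shift: "filterlim (\<lambda>\<epsilon>::real. x - \<epsilon>) (at_left x) (at_right 0)"
  unfolding filterlim_at
  by (auto intro!: tendsto_eq_intros simp: eventually_at_filter)

text \<open>The rate is required at the right end point only. With exponent 1/2 the quotient (f - L)
  / (x - t) is dominated by C / sqrt (x - t), so that the finite part becomes an ordinary integral
  plus a logarithm.\<close>

locale half_Hoelder =
  fixes a x :: real and f :: "real \<Rightarrow> real" and L C :: real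
  assumes ax: "a < x" and meas: "set_borel_measurable borel {a..<x} f"
    and hoelder: "\<And>t. t \<in> {a..<x} \<Longrightarrow> \<bar>f t - L\<bar> \<le> C * sqrt (x - t)"
begin

lemma limit: "(f \<longlongrightarrow> L) (at_left x)"
  using ax hoelder by (intro Lim_at_left_Hoelder[where C=C]) auto

lemma C_nonneg: "0 \<le> C"
proof -
  have "0 \<le> C * sqrt (x - a)"
    using hoelder[of a] ax abs_ge_zero order_trans by (metis atLeastLessThan_iff order_refl)
  then show ?thesis using ax by (simp add: zero_le_mult_iff)
qed

lemma quotient_bound: "t \<in> {a..<x} \<Longrightarrow> \<bar>(f t - L) / (x - t)\<bar> \<le> C * (1 / sqrt (x - t))"
proof -
  assume t: "t \<in> {a..<x}"
  have "\<bar>(f t - L) / (x - t)\<bar> = \<bar>f t - L\<bar> / (x - t)" using t by (simp add: abs_divide)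
  also have "\<dots> \<le> C * sqrt (x - t) / (x - t)" using t by (intro divide_right_mono hoelder) auto
  also have "\<dots> = C * (1 / sqrt (x - t))" using t
    by (simp add: divide_simps flip: power2_eq_square)
  finally show ?thesis .
qed

lemma quotient_integrable: "set_integrable lborel {a..<x} (\<lambda>t. (f t - L) / (x - t))"
  unfolding set_integrable_def
proof (rule Bochner_Integration.integrable_bound)
  show "integrable lborel (\<lambda>t. C * (indicator {a..<x} t *\<^sub>R (1 / sqrt (x - t))))"
    using integrable_inverse_sqrt[OF ax] by (intro integrable_mult_right) (auto simp: has_bochner_integral_iff)
  have "(\<lambda>t. (indicator {a..<x} t *\<^sub>R f t - indicator {a..<x} t * L) / (x - t)) \<in> borel_measurable borel"
    using meas unfolding set_borel_measurable_def by measurable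
  also have "(\<lambda>t. (indicator {a..<x} t *\<^sub>R f t - indicator {a..<x} t * L) / (x - t))
    = (\<lambda>t. indicator {a..<x} t *\<^sub>R ((f t - L) / (x - t)))"
    by (auto simp: fun_eq_iff indicator_def)
  finally show "(\<lambda>t. indicator {a..<x} t *\<^sub>R ((f t - L) / (x - t))) \<in> borel_measurable lborel"
    by simp
  show "AE t in lborel. norm (indicator {a..<x} t *\<^sub>R ((f t - L) / (x - t)))
      \<le> norm (C * (indicator {a..<x} t *\<^sub>R (1 / sqrt (x - t))))"
    using quotient_bound C_nonneg by (intro always_eventually) (auto simp: indicator_def abs_mult)
qed

lemma quotient_integral_bound:
  "\<bar>LINT t:{a..<x}|lborel. (f t - L) / (x - t)\<bar> \<le> C * (2 * sqrt (x - a))"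
proof -
  have "\<bar>LINT t|lborel. indicator {a..<x} t *\<^sub>R ((f t - L) / (x - t))\<bar>
    \<le> (LINT t|lborel. C * (indicator {a..<x} t *\<^sub>R (1 / sqrt (x - t))))"
  proof (rule integral_abs_bound_integral)
    show "integrable lborel (\<lambda>t. C * (indicator {a..<x} t *\<^sub>R (1 / sqrt (x - t))))"
      using integrable_inverse_sqrt[OF ax] by (intro integrable_mult_right) (auto simp: has_bochner_integral_iff)
    show "\<bar>indicator {a..<x} t *\<^sub>R ((f t - L) / (x - t))\<bar> \<le> C * (indicator {a..<x} t *\<^sub>R (1 / sqrt (x - t)))" for t
      using quotient_bound[of t] by (cases "t \<in> {a..<x}") auto
  qed (rule quotient_integrable[unfolded set_integrable_def])
  also have "\<dots> = C * (2 * sqrt (x - a))"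
    using integrable_inverse_sqrt[OF ax] by (subst integral_mult_right_zero) (auto simp: has_bochner_integral_iff)
  finally show ?thesis by (simp add: set_lebesgue_integral_def)
qed

text \<open>The constant \<open>L\<close> is split off: its contribution over [a, x - eps] is L (ln
  (x - a) - ln eps), and the counterterm removes the divergent part.\<close>

lemma pf_limit:
  "((\<lambda>\<epsilon>. (LINT t:{a..x-\<epsilon>}|lborel. f t / (x - t)) + L * ln \<epsilon>) \<longlongrightarrow>
    (LINT t:{a..<x}|lborel. (f t - L) / (x - t)) + L * ln (x - a)) (at_right 0)"
proof -
  have "((\<lambda>b. LINT t:{a..b}|lborel. (f t - L) / (x - t)) \<longlongrightarrow> (LINT t:{a..<x}|lborel. (f t - L) / (x - t))) (at_left x)"
    by (intro tendsto_set_lebesgue_integral_at_left ax quotient_integrable) auto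
  from filterlim_compose[OF this at_left_shift]
  have "((\<lambda>\<epsilon>. (LINT t:{a..x-\<epsilon>}|lborel. (f t - L) / (x - t)) + L * ln (x - a)) \<longlongrightarrow>
    (LINT t:{a..<x}|lborel. (f t - L) / (x - t)) + L * ln (x - a)) (at_right 0)"
    by (intro tendsto_intros)
  then show ?thesis
  proof (rule Lim_transform_eventually)
    show "\<forall>\<^sub>F \<epsilon> in at_right 0. (LINT t:{a..x-\<epsilon>}|lborel. (f t - L) / (x - t)) + L * ln (x - a)
      = (LINT t:{a..x-\<epsilon>}|lborel. f t / (x - t)) + L * ln \<epsilon>"
      using eventually_at_right_real[OF diff_gt_0_iff_gt[THEN iffD2, OF ax]]
    proof eventually_elim
      case (elim \<epsilon>)
      then have \<epsilon>: "0 < \<epsilon>" "\<epsilon> < x - a" by auto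
      have i1: "set_integrable lborel {a..x-\<epsilon>} (\<lambda>t. (f t - L) / (x - t))"
        using \<epsilon> by (intro set_integrable_subset[OF quotient_integrable]) auto
      have c2: "continuous_on {a..x-\<epsilon>} (\<lambda>t. L / (x - t))"
        using \<epsilon> by (intro continuous_intros) auto
      have i2: "set_integrable lborel {a..x-\<epsilon>} (\<lambda>t. L / (x - t))"
        by (rule borel_integrable_atLeastAtMost'[OF c2])
      have "(LINT t:{a..x-\<epsilon>}|lborel. L / (x - t)) = - L * ln (x - (x - \<epsilon>)) - - L * ln (x - a)"
        unfolding set_lebesgue_integral_def using \<epsilon>
        by (intro integral_FTC_atLeastAtMost c2)
          (auto intro!: derivative_eq_intros simp: has_real_derivative_iff_has_vector_derivative[symmetric])
      moreover have "(LINT t:{a..x-\<epsilon>}|lborel. (f t - L) / (x - t) + L / (x - t))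
        = (LINT t:{a..x-\<epsilon>}|lborel. (f t - L) / (x - t)) + (LINT t:{a..x-\<epsilon>}|lborel. L / (x - t))"
        using i1 i2 by (rule set_integral_add)
      moreover have "(f t - L) / (x - t) + L / (x - t) = f t / (x - t)" for t
        by (simp flip: add_divide_distrib)
      ultimately show ?case by simp
    qed
  qed
qed

lemma pf_left1_eq:
  "pf_left1 a x f = (LINT t:{a..<x}|lborel. (f t - L) / (x - t)) + L * ln (x - a)"
  using pf_limit tendsto_Lim[OF _ limit] by (simp add: pf_left1_def tendsto_Lim)

text \<open>Meant for varying \<open>x\<close>: with \<open>C\<close> and \<open>L\<close> bounded
  uniformly, only the logarithm of the length of the interval can become large when the interval
  shrinks.\<close>

lemma pf_left1_bound: "\<bar>pf_left1 a x f\<bar> \<le> 2 * C * sqrt (x - a) + \<bar>L\<bar> * \<bar>ln (x - a)\<bar>"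
  using quotient_integral_bound abs_triangle_ineq[of "LINT t:{a..<x}|lborel. (f t - L) / (x - t)" "L * ln (x - a)"]
  unfolding pf_left1_eq abs_mult by linarith

end

lemma half_Hoelder_add:
  assumes "half_Hoelder a x f L C" "half_Hoelder a x g M D"
  shows "half_Hoelder a x (\<lambda>t. f t + g t) (L + M) (C + D)"
proof -
  interpret f: half_Hoelder a x f L C by fact
  interpret g: half_Hoelder a x g M D by fact
  show ?thesis
  proof
    show "set_borel_measurable borel {a..<x} (\<lambda>t. f t + g t)"
      using f.meas g.meas unfolding set_borel_measurable_def by (simp add: distrib_left)
    show "\<bar>f t + g t - (L + M)\<bar> \<le> (C + D) * sqrt (x - t)" if "t \<in> {a..<x}" for t
      using f.hoelder[OF that] g.hoelder[OF that] by (simp add: distrib_right)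
  qed (rule f.ax)
qed

lemma pf_left1_add:
  assumes "half_Hoelder a x f L C" "half_Hoelder a x g M D"
  shows "pf_left1 a x (\<lambda>t. f t + g t) = pf_left1 a x f + pf_left1 a x g"
proof -
  interpret f: half_Hoelder a x f L C by fact
  interpret g: half_Hoelder a x g M D by fact
  interpret fg: half_Hoelder a x "\<lambda>t. f t + g t" "L + M" "C + D" using assms by (rule half_Hoelder_add)
  have "(LINT t:{a..<x}|lborel. (f t - L) / (x - t) + (g t - M) / (x - t))
    = (LINT t:{a..<x}|lborel. (f t - L) / (x - t)) + (LINT t:{a..<x}|lborel. (g t - M) / (x - t))"
    by (intro set_integral_add f.quotient_integrable g.quotient_integrable)
  moreover have "(f t - L) / (x - t) + (g t - M) / (x - t) = (f t + g t - (L + M)) / (x - t)" for t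
    by (simp add: add_divide_distrib diff_divide_distrib)
  ultimately show ?thesis
    by (simp add: f.pf_left1_eq g.pf_left1_eq fg.pf_left1_eq algebra_simps)
qed

text \<open>On [a, x - eps] the function F / (x - t) has derivative F' / (x - t) + F / (x - t)^2.
  Its boundary value F (x - eps) / eps minus the counterterm F x / eps is minus a difference
  quotient and tends to - L. The boundary value at \<open>a\<close> vanishes with
  \<open>F a\<close>, and the logarithmic counterterms of the two finite parts match.\<close>

lemma pf_left2_by_parts:
  assumes h: "half_Hoelder a x F' L C" and F'c: "continuous_on {a..<x} F'"
    and Fc: "continuous_on {a..x} F"
    and F: "\<And>t. t \<in> {a..<x} \<Longrightarrow> (F has_real_derivative F' t) (at t within {a..<x})"
    and F0: "F a = 0"
  shows "pf_left2 a x F = - L - pf_left1 a x F'"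
proof -
  interpret half_Hoelder a x F' L C by fact
  have dF: "(F has_real_derivative F' t) (at t)" if "t \<in> {a<..<x}" for t
  proof -
    have "at t within {a..<x} = at t" using that by (intro at_within_interior) auto
    then show ?thesis using F[of t] that by auto
  qed
  have Flim: "(F \<longlongrightarrow> F x) (at_left x)"
    using Fc ax by (auto simp: continuous_on_def at_within_Icc_at_left[symmetric])
  \<comment> \<open>\<open>pf_left2\<close> reads the one-sided derivative as the limit of
    \<open>deriv F\<close>, which is a two-sided derivative and identified with \<open>F'\<close> at
    interior points.\<close>
  have dlim: "(deriv F \<longlongrightarrow> L) (at_left x)"
    using limit
  proof (rule Lim_transform_eventually)
    show "\<forall>\<^sub>F t in at_left x. F' t = deriv F t"
      using eventually_at_left_real[OF ax] by eventually_elim (rule DERIV_imp_deriv[OF dF, symmetric])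
  qed
  \<comment> \<open>By the mean value theorem the difference quotient is a value \<open>F' z\<close>
    with \<open>z\<close> closer to \<open>x\<close> than \<open>t\<close> is, so it inherits the
    rate of \<open>F'\<close>.\<close>
  have slope: "\<bar>(F x - F t) / (x - t) - L\<bar> \<le> C * sqrt (x - t)" if t: "t \<in> {a<..<x}" for t
  proof -
    have "\<exists>z. t < z \<and> z < x \<and> F x - F t = (x - t) * F' z"
    proof (rule mvt[of t x F "\<lambda>z h. h * F' z", simplified], goal_cases)
      case (3 z)
      then show ?case
        using dF[of z] t by (simp add: has_field_derivative_def mult.commute[of _ "F' z"])
    qed (use t Fc in \<open>auto intro: continuous_on_subset\<close>)
    then obtain z where z: "t < z" "z < x" "F x - F t = (x - t) * F' z" by blast
    have "\<bar>F' z - L\<bar> \<le> C * sqrt (x - z)" using z t by (intro hoelder) auto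
    also have "\<dots> \<le> C * sqrt (x - t)" using z by (intro mult_left_mono C_nonneg) auto
    finally show ?thesis using z t by simp
  qed
  have "((\<lambda>t. (F x - F t) / (x - t)) \<longlongrightarrow> L) (at_left x)"
    using ax slope by (rule Lim_at_left_Hoelder)
  from filterlim_compose[OF this at_left_shift]
  have sl: "((\<lambda>\<epsilon>. (F x - F (x - \<epsilon>)) / \<epsilon>) \<longlongrightarrow> L) (at_right 0)" by simp
  have "((\<lambda>\<epsilon>. - ((F x - F (x - \<epsilon>)) / \<epsilon>) - ((LINT t:{a..x-\<epsilon>}|lborel. F' t / (x - t)) + L * ln \<epsilon>))
      \<longlongrightarrow> - L - pf_left1 a x F') (at_right 0)"
    unfolding pf_left1_eq by (intro tendsto_diff tendsto_minus tendsto_const sl pf_limit)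
  then have "((\<lambda>\<epsilon>. (LINT t:{a..x-\<epsilon>}|lborel. F t / (t - x)\<^sup>2) - L * ln \<epsilon> - 1 / \<epsilon> * F x)
      \<longlongrightarrow> - L - pf_left1 a x F') (at_right 0)"
  proof (rule Lim_transform_eventually)
    show "\<forall>\<^sub>F \<epsilon> in at_right 0. - ((F x - F (x - \<epsilon>)) / \<epsilon>) - ((LINT t:{a..x-\<epsilon>}|lborel. F' t / (x - t)) + L * ln \<epsilon>)
      = (LINT t:{a..x-\<epsilon>}|lborel. F t / (t - x)\<^sup>2) - L * ln \<epsilon> - 1 / \<epsilon> * F x"
      using eventually_at_right_real[OF diff_gt_0_iff_gt[THEN iffD2, OF ax]]
    proof eventually_elim
      case (elim \<epsilon>)
      then have \<epsilon>: "0 < \<epsilon>" "\<epsilon> < x - a" by auto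
      have sub: "{a..x-\<epsilon>} \<subseteq> {a..<x}" "{a..x-\<epsilon>} \<subseteq> {a..x}" using \<epsilon> by auto
      have c1: "continuous_on {a..x-\<epsilon>} (\<lambda>t. F' t / (x - t))"
        using sub by (intro continuous_intros continuous_on_subset[OF F'c]) auto
      have c2: "continuous_on {a..x-\<epsilon>} (\<lambda>t. F t / (t - x)\<^sup>2)"
        using sub by (intro continuous_intros continuous_on_subset[OF Fc]) auto
      have "(LINT t:{a..x-\<epsilon>}|lborel. F' t / (x - t) + F t / (t - x)\<^sup>2)
        = F (x - \<epsilon>) / (x - (x - \<epsilon>)) - F a / (x - a)"
        unfolding set_lebesgue_integral_def
      proof (intro integral_FTC_atLeastAtMost continuous_on_add c1 c2)
        fix t assume t: "a \<le> t" "t \<le> x - \<epsilon>"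
        then have "(F has_real_derivative F' t) (at t within {a..x-\<epsilon>})"
          using sub by (intro DERIV_subset[OF F]) auto
        moreover have "x - t \<noteq> 0" using t \<epsilon> by auto
        ultimately have "((\<lambda>t. F t / (x - t)) has_real_derivative F' t / (x - t) + F t / (t - x)\<^sup>2) (at t within {a..x-\<epsilon>})"
          by (auto intro!: derivative_eq_intros simp: divide_simps power2_eq_square) (simp add: algebra_simps)
        then show "((\<lambda>t. F t / (x - t)) has_vector_derivative F' t / (x - t) + F t / (t - x)\<^sup>2) (at t within {a..x-\<epsilon>})"
          by (simp add: has_real_derivative_iff_has_vector_derivative)
      qed (use \<epsilon> in auto)
      moreover have "(LINT t:{a..x-\<epsilon>}|lborel. F' t / (x - t) + F t / (t - x)\<^sup>2)
        = (LINT t:{a..x-\<epsilon>}|lborel. F' t / (x - t)) + (LINT t:{a..x-\<epsilon>}|lborel. F t / (t - x)\<^sup>2)"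
        by (intro set_integral_add borel_integrable_atLeastAtMost' c1 c2)
      ultimately show ?case using F0 \<epsilon> by (simp add: diff_divide_distrib)
    qed
  qed
  then show ?thesis
    using tendsto_Lim[OF _ Flim] tendsto_Lim[OF _ dlim] by (simp add: pf_left2_def tendsto_Lim)
qed


section \<open>Functions on the energy square\<close>

lemma Ck_square_continuous: "Ck_square a b k w \<Longrightarrow> continuous_on ({a..b} \<times> {a..b}) w"
  by (cases k) auto

lemma partial1_cong:
  assumes "\<And>z. z \<in> {a..b} \<times> {a..b} \<Longrightarrow> u z = w z" "z \<in> {a..b} \<times> {a..b}"
  shows "partial1 a b u z = partial1 a b w z"
  using assms by (auto simp: partial1_def intro!: deriv_in_cong)

lemma partial2_cong:
  assumes "\<And>z. z \<in> {a..b} \<times> {a..b} \<Longrightarrow> u z = w z" "z \<in> {a..b} \<times> {a..b}"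
  shows "partial2 a b u z = partial2 a b w z"
  using assms by (auto simp: partial2_def intro!: deriv_in_cong)

lemma Ck_square_cong:
  assumes "\<And>z. z \<in> {a..b} \<times> {a..b} \<Longrightarrow> u z = w z"
  shows "Ck_square a b k u \<longleftrightarrow> Ck_square a b k w"
  using assms
proof (induction k arbitrary: u w)
  case 0
  then show ?case by (auto intro!: continuous_on_cong)
next
  case (Suc k)
  have d: "f differentiable (at t within {a..b}) \<longleftrightarrow> g differentiable (at t within {a..b})"
    if "t \<in> {a..b}" "\<And>s. s \<in> {a..b} \<Longrightarrow> f s = g s" for f g :: "real \<Rightarrow> real" and t
    unfolding differentiable_def using that by (metis has_derivative_transform)
  have "continuous_on ({a..b} \<times> {a..b}) u = continuous_on ({a..b} \<times> {a..b}) w"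
    using Suc.prems by (auto intro!: continuous_on_cong)
  moreover have "(\<lambda>t'. u (t', s)) differentiable (at t within {a..b}) \<longleftrightarrow> (\<lambda>t'. w (t', s)) differentiable (at t within {a..b})"
    "(\<lambda>s'. u (t, s')) differentiable (at s within {a..b}) \<longleftrightarrow> (\<lambda>s'. w (t, s')) differentiable (at s within {a..b})"
    if "t \<in> {a..b}" "s \<in> {a..b}" for t s
    using that Suc.prems by (auto intro!: d)
  moreover have "Ck_square a b k (partial1 a b u) \<longleftrightarrow> Ck_square a b k (partial1 a b w)"
    using Suc.prems by (intro Suc.IH partial1_cong)
  moreover have "Ck_square a b k (partial2 a b u) \<longleftrightarrow> Ck_square a b k (partial2 a b w)"
    using Suc.prems by (intro Suc.IH partial2_cong)
  ultimately show ?case by simp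
qed

lemma partial_diff:
  assumes "Ck_square a b (Suc k) u" "Ck_square a b (Suc k) w" "a < b" "z \<in> {a..b} \<times> {a..b}"
  shows "partial1 a b (\<lambda>z. u z - w z) z = partial1 a b u z - partial1 a b w z"
    and "partial2 a b (\<lambda>z. u z - w z) z = partial2 a b u z - partial2 a b w z"
  using assms unfolding partial1_def partial2_def
  by (auto intro!: deriv_in_eq derivative_intros deriv_in_derivative)

lemma Ck_square_diff:
  assumes "Ck_square a b k u" "Ck_square a b k w" "a < b"
  shows "Ck_square a b k (\<lambda>z. u z - w z)"
  using assms(1,2)
proof (induction k arbitrary: u w)
  case 0
  then show ?case by (auto intro!: continuous_intros)
next
  case (Suc k)
  have "Ck_square a b k (partial1 a b (\<lambda>z. u z - w z))"
    by (subst Ck_square_cong[OF partial_diff(1)[OF Suc.prems assms(3)]]) (use Suc in auto)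
  moreover have "Ck_square a b k (partial2 a b (\<lambda>z. u z - w z))"
    by (subst Ck_square_cong[OF partial_diff(2)[OF Suc.prems assms(3)]]) (use Suc in auto)
  ultimately show ?case
    using Suc.prems by (auto intro!: continuous_intros derivative_intros)
qed

lemma Ck_square_sup_norm:
  assumes "Ck_square a b k w" "z \<in> {a..b} \<times> {a..b}"
  shows "\<bar>w z\<bar> \<le> sup_norm ({a..b} \<times> {a..b}) w"
  using assms by (intro sup_norm_upper bdd_above_abs_compact compact_Times Ck_square_continuous) auto

lemma Ck_square_norm_nonneg:
  assumes "a < b"
  shows "Ck_square a b k w \<Longrightarrow> 0 \<le> sup_norm ({a..b} \<times> {a..b}) w \<and> 0 \<le> Ck_square_norm a b k w"
proof (induction k arbitrary: w)
  case 0
  then show ?case using Ck_square_sup_norm[OF 0, of "(a, a)"] assms by auto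
next
  case (Suc k)
  have "0 \<le> sup_norm ({a..b} \<times> {a..b}) w"
    using Ck_square_sup_norm[OF Suc.prems, of "(a, a)"] assms by auto
  moreover have "0 \<le> Ck_square_norm a b k (partial1 a b w)" "0 \<le> Ck_square_norm a b k (partial2 a b w)"
    using Suc by auto
  ultimately show ?case by simp
qed

lemma Ck_square_partial2: "Ck_square a b k w \<Longrightarrow> j \<le> k \<Longrightarrow> Ck_square a b (k - j) ((partial2 a b ^^ j) w)"
proof (induction j)
  case (Suc j)
  then obtain m where "k - j = Suc m" by (metis Suc_diff_Suc Suc_le_lessD)
  with Suc show ?case by (auto simp: diff_Suc)
qed simp

lemma partial2_abs_le:
  assumes "a < b" "z \<in> {a..b} \<times> {a..b}"
  shows "Ck_square a b k w \<Longrightarrow> j \<le> k \<Longrightarrow> \<bar>(partial2 a b ^^ j) w z\<bar> \<le> Ck_square_norm a b k w"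
proof (induction k arbitrary: w j)
  case 0
  then show ?case using Ck_square_sup_norm[OF 0(1) assms(2)] by simp
next
  case (Suc k)
  have nn: "0 \<le> Ck_square_norm a b k (partial1 a b w)" "0 \<le> Ck_square_norm a b k (partial2 a b w)"
    "0 \<le> sup_norm ({a..b} \<times> {a..b}) w"
    using Ck_square_norm_nonneg[OF assms(1)] Suc.prems(1) Ck_square.simps(2) by blast+
  show ?case
  proof (cases j)
    case 0
    then show ?thesis using Ck_square_sup_norm[OF Suc.prems(1) assms(2)] nn by simp
  next
    case (Suc i)
    have "\<bar>(partial2 a b ^^ i) (partial2 a b w) z\<bar> \<le> Ck_square_norm a b k (partial2 a b w)"
      using Suc Suc.prems by (intro Suc.IH) auto
    then show ?thesis using nn Suc by (simp add: funpow_swap1)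
  qed
qed

lemma partial2_funpow_diff:
  assumes "Ck_square a b k u" "Ck_square a b k w" "a < b"
  shows "j \<le> k \<Longrightarrow> z \<in> {a..b} \<times> {a..b} \<Longrightarrow>
    (partial2 a b ^^ j) (\<lambda>z. u z - w z) z = (partial2 a b ^^ j) u z - (partial2 a b ^^ j) w z"
proof (induction j arbitrary: z)
  case (Suc j)
  have c: "Ck_square a b (Suc (k - Suc j)) ((partial2 a b ^^ j) u)" "Ck_square a b (Suc (k - Suc j)) ((partial2 a b ^^ j) w)"
    using Ck_square_partial2[OF assms(1), of j] Ck_square_partial2[OF assms(2), of j] Suc.prems
    by (simp_all only: Suc_diff_Suc Suc_le_lessD)
  have "(partial2 a b ^^ Suc j) (\<lambda>z. u z - w z) z
    = partial2 a b (\<lambda>z. (partial2 a b ^^ j) u z - (partial2 a b ^^ j) w z) z"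
    unfolding funpow.simps o_apply using Suc by (intro partial2_cong) auto
  then show ?case by (simp add: partial_diff(2)[OF c assms(3) Suc.prems(2)])
qed simp

text \<open>Derivatives are taken in the second energy argument, which is the integration variable
  of the finite parts.\<close>

definition sjet :: "real \<Rightarrow> real \<Rightarrow> (r3 \<Rightarrow> real \<Rightarrow> real \<Rightarrow> real) \<Rightarrow> nat \<Rightarrow> r3 \<Rightarrow> real \<Rightarrow> real \<Rightarrow> real" where
  "sjet a b h j x E' E = (partial2 a b ^^ j) (\<lambda>(E', E). h x E' E) (E', E)"

lemma sjet_0 [simp]: "sjet a b h 0 x E' E = h x E' E"
  by (simp add: sjet_def)

lemma sjet_1: "sjet a b h (Suc 0) x E' = deriv_in a b (h x E')"
  by (simp add: sjet_def partial2_def fun_eq_iff)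

lemma C0k_Ck_square: "C0k G a b k h \<Longrightarrow> x \<in> closure G \<Longrightarrow> Ck_square a b k (\<lambda>(E', E). h x E' E)"
  by (simp add: C0k_def C0_into_def)

lemma sjet_continuous:
  assumes "C0k G a b k h" "a < b" "j \<le> k"
  shows "continuous_on (closure G \<times> {a..b} \<times> {a..b}) (\<lambda>(x, E', E). sjet a b h j x E' E)"
proof -
  note c = C0k_Ck_square[OF assms(1)]
  let ?h = "\<lambda>x (E', E). h x E' E"
  have "continuous_on (closure G \<times> ({a..b} \<times> {a..b})) (\<lambda>(x, z). (partial2 a b ^^ j) (?h x) z)"
  proof (rule continuous_on_Times_uniform)
    show "continuous_on ({a..b} \<times> {a..b}) ((partial2 a b ^^ j) (?h x))" if "x \<in> closure G" for x
      using Ck_square_partial2[OF c[OF that] assms(3)] by (rule Ck_square_continuous)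
    show "((\<lambda>y. Ck_square_norm a b k (\<lambda>z. ?h y z - ?h x z)) \<longlongrightarrow> 0) (at x within closure G)" if "x \<in> closure G" for x
      using assms(1) that by (simp add: C0k_def C0_into_def)
    show "\<bar>(partial2 a b ^^ j) (?h y) z - (partial2 a b ^^ j) (?h x) z\<bar> \<le> Ck_square_norm a b k (\<lambda>z. ?h y z - ?h x z)"
      if "x \<in> closure G" "y \<in> closure G" "z \<in> {a..b} \<times> {a..b}" for x y z
      using partial2_abs_le[OF assms(2) that(3) Ck_square_diff[OF c[OF that(2)] c[OF that(1)] assms(2)] assms(3)]
        partial2_funpow_diff[OF c[OF that(2)] c[OF that(1)] assms(2,3) that(3)] by simp
  qed
  then show ?thesis by (simp add: sjet_def case_prod_unfold)
qed

lemma sjet_derivative: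
  assumes "C0k G a b k h" "a < b" "x \<in> closure G" "j < k" "E' \<in> {a..b}" "E \<in> {a..b}"
  shows "((\<lambda>E. sjet a b h j x E' E) has_real_derivative sjet a b h (Suc j) x E' E) (at E within {a..b})"
proof -
  have "Ck_square a b (Suc (k - Suc j)) ((partial2 a b ^^ j) (\<lambda>(E', E). h x E' E))"
    using Ck_square_partial2[OF C0k_Ck_square[OF assms(1,3)], of j] assms(4) by (simp only: Suc_diff_Suc)
  then have "(\<lambda>E. sjet a b h j x E' E) differentiable (at E within {a..b})"
    using assms(5,6) by (simp add: sjet_def)
  from deriv_in_derivative[OF this assms(2,6)] show ?thesis
    by (simp add: sjet_def partial2_def)
qed


section \<open>Integration by parts on the sphere\<close>

text \<open>Parseval's identity. Orthonormality says that the matrix with rows \<open>a\<close>,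
  \<open>b\<close>, \<open>c\<close> has its transpose as right inverse; for a square matrix it is
  then a left inverse too, which is completeness of the basis.\<close>

lemma orthonormal_inner:
  fixes a b c x y :: r3
  assumes "norm a = 1" "norm b = 1" "norm c = 1" "a \<bullet> b = 0" "a \<bullet> c = 0" "b \<bullet> c = 0"
  shows "x \<bullet> y = (x \<bullet> a) * (y \<bullet> a) + (x \<bullet> b) * (y \<bullet> b) + (x \<bullet> c) * (y \<bullet> c)"
proof -
  define Q :: "real^3^3" where "Q = vector [a, b, c]"
  have rows: "Q $ 1 = a" "Q $ 2 = b" "Q $ 3 = c" by (simp_all add: Q_def)
  have "(Q ** transpose Q) $ i $ j = mat 1 $ i $ j" for i j
  proof -
    have "(Q ** transpose Q) $ i $ j = Q $ i \<bullet> Q $ j"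
      by (simp add: matrix_matrix_mult_def transpose_def inner_vec_def)
    also have "\<dots> = mat 1 $ i $ j"
      using assms exhaust_3[of i] exhaust_3[of j] by (auto simp: rows mat_def dot_square_norm inner_commute)
    finally show ?thesis .
  qed
  then have "Q ** transpose Q = mat 1" by (simp add: vec_eq_iff)
  then have "transpose Q ** Q = mat 1" by (simp add: matrix_left_right_inverse)
  then have "x \<bullet> y = x \<bullet> (transpose Q *v (Q *v y))" by (simp add: matrix_vector_mul_assoc)
  also have "\<dots> = (Q *v x) \<bullet> (Q *v y)"
    by (simp only: inner_commute[of x] transpose_matrix_vector dot_lmul_matrix) (rule inner_commute)
  also have "\<dots> = (x \<bullet> a) * (y \<bullet> a) + (x \<bullet> b) * (y \<bullet> b) + (x \<bullet> c) * (y \<bullet> c)"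
    by (simp add: inner_vec_def[of "Q *v x"] sum_3 matrix_vector_mul_component rows inner_commute)
  finally show ?thesis .
qed

section \<open>Spherical coordinates and the surface measure\<close>

definition sph :: "real \<Rightarrow> real \<Rightarrow> r3" where
  "sph \<theta> \<phi> = vector [sin \<theta> * cos \<phi>, sin \<theta> * sin \<phi>, cos \<theta>]"

definition e_th :: "real \<Rightarrow> real \<Rightarrow> r3" where
  "e_th \<theta> \<phi> = vector [cos \<theta> * cos \<phi>, cos \<theta> * sin \<phi>, - sin \<theta>]"

definition e_ph :: "real \<Rightarrow> r3" where
  "e_ph \<phi> = vector [- sin \<phi>, cos \<phi>, 0]"

lemma vector3_eq:
  "(vector [p, q, r] :: r3) = p *\<^sub>R axis 1 1 + q *\<^sub>R axis 2 1 + r *\<^sub>R axis 3 1"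
  by (simp add: vec_eq_iff forall_3 axis_def)

lemma inner_vector3: "(vector [p, q, r] :: r3) \<bullet> vector [p', q', r'] = p * p' + q * q' + r * r'"
  by (simp add: inner_vec_def sum_3)

lemma continuous_on_vec_componentwise:
  fixes f :: "'a::t2_space \<Rightarrow> real^'n"
  shows "continuous_on A f \<longleftrightarrow> (\<forall>i. continuous_on A (\<lambda>x. f x $ i))"
  by (subst continuous_on_componentwise) (auto simp: Basis_vec_def inner_axis)

lemma continuous_on_vector3 [continuous_intros]:
  assumes "continuous_on A f" "continuous_on A g" "continuous_on A h"
  shows "continuous_on A (\<lambda>x. vector [f x, g x, h x] :: r3)"
  unfolding vector3_eq using assms by (intro continuous_intros)

lemma sph_frame:
  "norm (sph \<theta> \<phi>) = 1" "norm (e_th \<theta> \<phi>) = 1" "norm (e_ph \<phi>) = 1"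
  "e_th \<theta> \<phi> \<bullet> e_ph \<phi> = 0" "e_th \<theta> \<phi> \<bullet> sph \<theta> \<phi> = 0" "e_ph \<phi> \<bullet> sph \<theta> \<phi> = 0"
proof -
  have *: "(s * c)\<^sup>2 + (s * d)\<^sup>2 + t = s\<^sup>2 * (c\<^sup>2 + d\<^sup>2) + t" for s c d t :: real
    by (simp add: power_mult_distrib algebra_simps)
  show "norm (sph \<theta> \<phi>) = 1" "norm (e_th \<theta> \<phi>) = 1" "norm (e_ph \<phi>) = 1"
    unfolding norm_eq_1 sph_def e_th_def e_ph_def inner_vector3 power2_eq_square[symmetric] * by simp_all
  have **: "c * p * (s * p) + c * q * (s * q) + t = c * s * (p\<^sup>2 + q\<^sup>2) + t" for c s p q t :: real
    by (simp add: power2_eq_square algebra_simps)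
  show "e_th \<theta> \<phi> \<bullet> e_ph \<phi> = 0" "e_th \<theta> \<phi> \<bullet> sph \<theta> \<phi> = 0" "e_ph \<phi> \<bullet> sph \<theta> \<phi> = 0"
    unfolding norm_eq_1 sph_def e_th_def e_ph_def inner_vector3 ** by simp_all
qed

lemma sph_derivatives:
  "((\<lambda>\<theta>. sph \<theta> \<phi>) has_vector_derivative e_th \<theta> \<phi>) (at \<theta> within T)"
  "((\<lambda>\<phi>. sph \<theta> \<phi>) has_vector_derivative sin \<theta> *\<^sub>R e_ph \<phi>) (at \<phi> within T)"
  "((\<lambda>\<theta>. e_th \<theta> \<phi>) has_vector_derivative - sph \<theta> \<phi>) (at \<theta> within T)"
  "((\<lambda>\<phi>. e_ph \<phi>) has_vector_derivative - (sin \<theta> *\<^sub>R sph \<theta> \<phi> + cos \<theta> *\<^sub>R e_th \<theta> \<phi>)) (at \<phi> within T)"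
proof -
  have *: "((\<lambda>t. vector [f t, g t, h t] :: r3) has_vector_derivative vector [f', g', h']) (at t within T)"
    if "(f has_real_derivative f') (at t within T)" "(g has_real_derivative g') (at t within T)"
       "(h has_real_derivative h') (at t within T)" for f g h f' g' h' t
    unfolding vector3_eq using that
    by (intro has_vector_derivative_add has_vector_derivative_scaleR[where g'=0, simplified]) auto
  have 1: "- (sin \<theta> *\<^sub>R sph \<theta> \<phi> + cos \<theta> *\<^sub>R e_th \<theta> \<phi>) = vector [- cos \<phi>, - sin \<phi>, 0]"
  proof -
    have "sin \<theta> * (sin \<theta> * c) + cos \<theta> * (cos \<theta> * c) = c" for c
      using sin_cos_squared_add3[of \<theta>] by (metis distrib_right mult.assoc mult_1 add.commute)
    then have "- (sin \<theta> * (sin \<theta> * c)) - cos \<theta> * (cos \<theta> * c) = - c" for c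
      by (metis minus_add_distrib uminus_add_conv_diff add.commute)
    then show ?thesis by (simp add: vec_eq_iff forall_3 sph_def e_th_def)
  qed
  have 2: "- sph \<theta> \<phi> = vector [- sin \<theta> * cos \<phi>, - sin \<theta> * sin \<phi>, - cos \<theta>]"
    by (simp add: vec_eq_iff forall_3 sph_def)
  have 3: "sin \<theta> *\<^sub>R e_ph \<phi> = vector [- sin \<theta> * sin \<phi>, sin \<theta> * cos \<phi>, 0]"
    by (simp add: vec_eq_iff forall_3 e_ph_def)
  show "((\<lambda>\<theta>. sph \<theta> \<phi>) has_vector_derivative e_th \<theta> \<phi>) (at \<theta> within T)"
    unfolding sph_def e_th_def by (rule *) (auto intro!: derivative_eq_intros)
  show "((\<lambda>\<phi>. sph \<theta> \<phi>) has_vector_derivative sin \<theta> *\<^sub>R e_ph \<phi>) (at \<phi> within T)"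
    unfolding sph_def 3 by (rule *) (auto intro!: derivative_eq_intros)
  show "((\<lambda>\<theta>. e_th \<theta> \<phi>) has_vector_derivative - sph \<theta> \<phi>) (at \<theta> within T)"
    unfolding e_th_def 2 by (rule *) (auto intro!: derivative_eq_intros)
  show "((\<lambda>\<phi>. e_ph \<phi>) has_vector_derivative - (sin \<theta> *\<^sub>R sph \<theta> \<phi> + cos \<theta> *\<^sub>R e_th \<theta> \<phi>)) (at \<phi> within T)"
    unfolding e_ph_def 1 by (rule *) (auto intro!: derivative_eq_intros)
qed

lemma sph_in_S2: "sph \<theta> \<phi> \<in> S2" by (simp add: sph_frame)

lemma continuous_on_sph [continuous_intros]:
  fixes A :: "'a::t2_space set"
  assumes "continuous_on A f" "continuous_on A g"
  shows "continuous_on A (\<lambda>x. sph (f x) (g x))" "continuous_on A (\<lambda>x. e_th (f x) (g x))"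
    "continuous_on A (\<lambda>x. e_ph (g x))"
  unfolding sph_def e_th_def e_ph_def using assms by (auto intro!: continuous_intros)

lemma space_sphere_measure [simp]: "space mS = S2"
  by (simp add: sphere_measure_def space_restrict_space)

lemma sets_sphere_measure [measurable_cong]: "sets mS = sets (restrict_space borel S2)"
  by (simp add: sphere_measure_def)

text \<open>\<open>sphere_measure\<close> is the image of a density on the coordinate rectangle. The
  integral thus becomes a Henstock-Kurzweil integral over a compact rectangle, where the fundamental
  theorem and iterated integration of continuous functions are at hand.\<close>

lemma
  fixes f :: "r3 \<Rightarrow> real"
  assumes f: "continuous_on S2 f"
  shows sphere_integrable: "integrable mS f"
    and sphere_integral: "integral\<^sup>L mS f
      = integral (cbox (0, 0) (pi, 2 * pi)) (\<lambda>p. sin (fst p) * f (sph (fst p) (snd p)))"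
proof -
  let ?B = "cbox (0, 0) (pi, 2 * pi) :: (real \<times> real) set"
  let ?s = "\<lambda>p. sph (fst p) (snd p)"
  let ?d = "\<lambda>p. indicator ?B p * sin (fst p) :: real"
  have m1: "?s \<in> measurable borel (restrict_space borel S2)"
    by (intro measurable_restrict_space2 borel_measurable_continuous_onI continuous_intros) (auto simp: sph_frame)
  have m2: "f \<in> borel_measurable (restrict_space borel S2)"
    using f by (rule borel_measurable_continuous_on_restrict)
  have fs: "(\<lambda>p. f (?s p)) \<in> borel_measurable borel"
    using m1 m2 by (rule measurable_compose)
  have d: "(\<lambda>(\<theta>, \<phi>). ennreal (sin \<theta>) * indicator ({0..pi} \<times> {0..2*pi}) (\<theta>, \<phi>)) = (\<lambda>p. ennreal (?d p))"
    by (auto simp: fun_eq_iff indicator_def cbox_Pair_eq)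
  have mS: "mS = distr (density lborel (\<lambda>p. ennreal (?d p))) (restrict_space borel S2) ?s"
    unfolding sphere_measure_def d by (simp add: sph_def case_prod_unfold)
  have dm: "?d \<in> borel_measurable borel"
    by (intro borel_measurable_times borel_measurable_indicator borel_measurable_continuous_onI continuous_intros) auto
  have d0: "0 \<le> ?d p" for p
    by (auto simp: indicator_def cbox_Pair_eq intro: sin_ge_zero)
  have c: "continuous_on ?B (\<lambda>p. sin (fst p) * f (?s p))"
    by (intro continuous_intros continuous_on_compose2[OF f]) (auto simp: sph_frame)
  have i: "set_integrable lborel ?B (\<lambda>p. sin (fst p) * f (?s p))"
    unfolding set_integrable_def by (intro borel_integrable_compact c) auto
  have eq: "?d p *\<^sub>R f (?s p) = indicator ?B p *\<^sub>R (sin (fst p) * f (?s p))" for p by simp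
  show "integrable mS f"
    using i m1 m2 dm fs d0 unfolding mS set_integrable_def
    by (subst integrable_distr_eq) (auto simp: integrable_density mult.assoc)
  have "integral\<^sup>L mS f = (LINT p|lborel. ?d p *\<^sub>R f (?s p))"
    unfolding mS using m1 m2 dm fs d0
    by (subst integral_distr) (auto intro!: trans[OF integral_density] simp: mult.assoc)
  also have "\<dots> = integral ?B (\<lambda>p. sin (fst p) * f (?s p))"
    unfolding eq using set_borel_integral_eq_integral(2)[OF i] by (simp add: set_lebesgue_integral_def)
  finally show "integral\<^sup>L mS f = integral ?B (\<lambda>p. sin (fst p) * f (?s p))" .
qed

lemma finite_measure_sphere: "finite_measure mS"
proof
  have "integrable mS (\<lambda>_. 1 :: real)" by (intro sphere_integrable continuous_intros)
  then show "emeasure mS (space mS) \<noteq> \<infinity>"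
    by (auto simp: integrable_iff_bounded)
qed

text \<open>The tangential part of a constant vector \<open>u\<close> has divergence - 2 times the
  inner product of \<open>\<omega>\<close> and \<open>u\<close>. The integrand is therefore the
  divergence of \<open>f\<close> times this tangential part, and the sphere has no boundary.\<close>

lemma sphere_divergence:
  assumes f: "Ck_sphere 1 f"
  shows "(LINT \<omega>|mS. sphere_grad f \<omega> \<bullet> u - 2 * (f \<omega> * (\<omega> \<bullet> u))) = 0"
proof -
  let ?B = "cbox (0, 0) (pi, 2 * pi) :: (real \<times> real) set"
  let ?s = "\<lambda>p. sph (fst p) (snd p)"
  have fd: "f differentiable (at \<omega> within S2)" if "\<omega> \<in> S2" for \<omega>
    using f that by (auto simp: differentiable_on_def)
  have fc: "continuous_on S2 f" using f by (rule Ck_sphere_imp_continuous)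
  have gc: "continuous_on S2 (sphere_grad f)"
    using f by (simp add: continuous_on_vec_componentwise)
  \<comment> \<open>\<open>A\<close> and \<open>B\<close> are the components of the field in
    spherical coordinates, multiplied by the area density \<open>sin \<theta>\<close>. This cancels
    the factor 1 / sin \<theta> of the \<phi> component, so both are regular at the poles.\<close>
  define A where "A = (\<lambda>\<theta> \<phi>. sin \<theta> * (e_th \<theta> \<phi> \<bullet> u) * f (sph \<theta> \<phi>))"
  define B where "B = (\<lambda>\<theta> \<phi>. (e_ph \<phi> \<bullet> u) * f (sph \<theta> \<phi>))"
  define A' where "A' = (\<lambda>(\<theta>, \<phi>). (cos \<theta> * (e_th \<theta> \<phi> \<bullet> u) - sin \<theta> * (sph \<theta> \<phi> \<bullet> u)) * f (sph \<theta> \<phi>)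
    + sin \<theta> * (e_th \<theta> \<phi> \<bullet> u) * (sphere_grad f (sph \<theta> \<phi>) \<bullet> e_th \<theta> \<phi>))"
  define B' where "B' = (\<lambda>(\<theta>, \<phi>). - (sin \<theta> * (sph \<theta> \<phi> \<bullet> u) + cos \<theta> * (e_th \<theta> \<phi> \<bullet> u)) * f (sph \<theta> \<phi>)
    + (e_ph \<phi> \<bullet> u) * (sin \<theta> * (sphere_grad f (sph \<theta> \<phi>) \<bullet> e_ph \<phi>)))"
  have inner_d: "((\<lambda>t. g t \<bullet> u) has_real_derivative (g' \<bullet> u)) F" if "(g has_vector_derivative g') F"
    for g :: "real \<Rightarrow> r3" and g' F
    using bounded_linear.has_vector_derivative[OF bounded_linear_inner_left that]
    by (simp add: has_real_derivative_iff_has_vector_derivative)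
  have f_d: "((\<lambda>t. f (c t)) has_real_derivative (sphere_grad f (c t) \<bullet> c')) (at t within T)"
    if "(c has_vector_derivative c') (at t within T)" "\<And>t. c t \<in> S2" for c c' t T
    by (rule has_derivative_along_sphere_curve[OF sphere_grad_has_derivative that(1)]) (use that fd in auto)
  have dA: "((\<lambda>\<theta>. A \<theta> \<phi>) has_real_derivative A' (\<theta>, \<phi>)) (at \<theta> within T)" for \<theta> \<phi> T
    unfolding A_def
    by (rule DERIV_cong[OF DERIV_mult[OF DERIV_mult[OF has_field_derivative_at_within[OF DERIV_sin]
          inner_d[OF sph_derivatives(3)]] f_d[OF sph_derivatives(1) sph_in_S2]]])
      (simp add: A'_def algebra_simps)
  have dB: "((\<lambda>\<phi>. B \<theta> \<phi>) has_real_derivative B' (\<theta>, \<phi>)) (at \<phi> within T)" for \<theta> \<phi> T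
    unfolding B_def
    by (rule DERIV_cong[OF DERIV_mult[OF inner_d[OF sph_derivatives(4)] f_d[OF sph_derivatives(2) sph_in_S2]]])
      (simp add: B'_def inner_diff_left inner_add_left algebra_simps)
  have cA: "continuous_on X A'" and cB: "continuous_on X B'" for X
    unfolding A'_def B'_def case_prod_unfold
    by (intro continuous_intros continuous_on_compose2[OF fc] continuous_on_compose2[OF gc]; auto simp: sph_frame)+
  have "integral ?B B' = integral {0..pi} (\<lambda>\<theta>. integral {0..2*pi} (\<lambda>\<phi>. B' (\<theta>, \<phi>)))"
    using integral_prod_continuous[OF cB] by simp
  also have "\<dots> = integral {0..pi} (\<lambda>\<theta>. B \<theta> (2*pi) - B \<theta> 0)"
    by (intro integral_cong integral_unique fundamental_theorem_of_calculus)
      (auto simp: has_real_derivative_iff_has_vector_derivative[symmetric] dB)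
  \<comment> \<open>Periodicity in \<phi>.\<close>
  also have "\<dots> = 0" by (simp add: B_def e_ph_def sph_def)
  finally have iB: "integral ?B B' = 0" .
  have "integral ?B A' = integral {0..pi} (\<lambda>\<theta>. integral {0..2*pi} (\<lambda>\<phi>. A' (\<theta>, \<phi>)))"
    using integral_prod_continuous[OF cA] by simp
  also have "\<dots> = integral {0..2*pi} (\<lambda>\<phi>. integral {0..pi} (\<lambda>\<theta>. A' (\<theta>, \<phi>)))"
    using integral_swap_continuous[where f="\<lambda>\<theta> \<phi>. A' (\<theta>, \<phi>)" and a=0 and b=pi and c=0 and d="2*pi"] cA by simp
  also have "\<dots> = integral {0..2*pi} (\<lambda>\<phi>. A pi \<phi> - A 0 \<phi>)"
    by (intro integral_cong integral_unique fundamental_theorem_of_calculus)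
      (auto simp: has_real_derivative_iff_has_vector_derivative[symmetric] dA)
  \<comment> \<open>The factor \<open>sin \<theta>\<close> of \<open>A\<close> vanishes at both
    poles.\<close>
  also have "\<dots> = 0" by (simp add: A_def)
  finally have iA: "integral ?B A' = 0" .
  have sum: "sin \<theta> * (sphere_grad f (sph \<theta> \<phi>) \<bullet> u - 2 * (f (sph \<theta> \<phi>) * (sph \<theta> \<phi> \<bullet> u)))
    = A' (\<theta>, \<phi>) + B' (\<theta>, \<phi>)" for \<theta> \<phi>
  proof -
    have "sphere_grad f (sph \<theta> \<phi>) \<bullet> u = (sphere_grad f (sph \<theta> \<phi>) \<bullet> e_th \<theta> \<phi>) * (u \<bullet> e_th \<theta> \<phi>)
      + (sphere_grad f (sph \<theta> \<phi>) \<bullet> e_ph \<phi>) * (u \<bullet> e_ph \<phi>)"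
      using orthonormal_inner[OF sph_frame(2)[of \<theta> \<phi>] sph_frame(3)[of \<phi>] sph_frame(1)[of \<theta> \<phi>]
        sph_frame(4) sph_frame(5) sph_frame(6), of "sphere_grad f (sph \<theta> \<phi>)" u]
      by (simp add: sphere_grad_tangent fd sph_frame)
    then show ?thesis
      by (simp add: A'_def B'_def inner_commute[of u] algebra_simps)
  qed
  have "(LINT \<omega>|mS. sphere_grad f \<omega> \<bullet> u - 2 * (f \<omega> * (\<omega> \<bullet> u)))
    = integral ?B (\<lambda>p. A' p + B' p)"
    by (subst sphere_integral) (auto intro!: continuous_intros fc gc integral_cong simp: sum)
  also have "\<dots> = 0"
    using iA iB cA cB by (simp add: integral_add integrable_continuous)
  finally show ?thesis .
qed

text \<open>The Laplace-Beltrami operator of the sphere, written as the sum of the squares of the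
  ambient components of the tangential gradient.\<close>

definition lap :: "(r3 \<Rightarrow> real) \<Rightarrow> r3 \<Rightarrow> real" where
  "lap h \<omega> = (\<Sum>i\<in>UNIV. sgD [i, i] h \<omega>)"

lemma sphere_grad_mult:
  assumes "\<omega> \<in> S2" "f differentiable (at \<omega> within S2)" "g differentiable (at \<omega> within S2)"
  shows "sphere_grad (\<lambda>\<xi>. f \<xi> * g \<xi>) \<omega> = f \<omega> *\<^sub>R sphere_grad g \<omega> + g \<omega> *\<^sub>R sphere_grad f \<omega>"
proof (rule sphere_grad_eq[OF assms(1)])
  show "(f \<omega> *\<^sub>R sphere_grad g \<omega> + g \<omega> *\<^sub>R sphere_grad f \<omega>) \<bullet> \<omega> = 0"
    using assms by (simp add: inner_add_left sphere_grad_tangent)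
  show "((\<lambda>\<xi>. f \<xi> * g \<xi>) has_derivative (\<bullet>) (f \<omega> *\<^sub>R sphere_grad g \<omega> + g \<omega> *\<^sub>R sphere_grad f \<omega>)) (at \<omega> within S2)"
    using assms by (auto intro!: derivative_eq_intros sphere_grad_has_derivative simp: inner_add_left)
qed

text \<open>The divergence formula for \<open>f\<close> times the i-th component of the gradient of
  \<open>h\<close>, with \<open>u\<close> the i-th axis, summed over i. The curvature terms add up
  to a multiple of \<open>f\<close> times the normal component of the gradient of \<open>h\<close>,
  which is zero.\<close>

theorem sphere_Green:
  assumes f: "Ck_sphere 1 f" and h: "Ck_sphere 2 h"
  shows "(LINT \<omega>|mS. f \<omega> * lap h \<omega>) = - (LINT \<omega>|mS. sphere_grad f \<omega> \<bullet> sphere_grad h \<omega>)"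
proof -
  define X where "X = (\<lambda>i \<omega>. f \<omega> * sphere_grad h \<omega> $ i)"
  have p: "Ck_sphere 1 (\<lambda>\<omega>. sphere_grad h \<omega> $ i)" for i
    using h by (simp add: numeral_2_eq_2)
  have fd: "f differentiable (at \<omega> within S2)" "(\<lambda>\<omega>. sphere_grad h \<omega> $ i) differentiable (at \<omega> within S2)"
     "h differentiable (at \<omega> within S2)"
    if "\<omega> \<in> S2" for \<omega> i
    using f p[of i] h that by (auto simp: differentiable_on_def numeral_2_eq_2)
  have cc: "continuous_on S2 f" "continuous_on S2 (\<lambda>\<omega>. sphere_grad f \<omega> $ j)"
     "continuous_on S2 (\<lambda>\<omega>. sphere_grad h \<omega> $ i)" "continuous_on S2 (\<lambda>\<omega>. sphere_grad (\<lambda>\<omega>. sphere_grad h \<omega> $ i) \<omega> $ j)" for i j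
    using Ck_sphere_imp_continuous[OF f] Ck_sphere_imp_continuous[OF p] f p by auto
  have gX: "sphere_grad (X i) \<omega> = f \<omega> *\<^sub>R sphere_grad (\<lambda>\<omega>. sphere_grad h \<omega> $ i) \<omega> + sphere_grad h \<omega> $ i *\<^sub>R sphere_grad f \<omega>"
    if "\<omega> \<in> S2" for \<omega> i
    unfolding X_def using that fd by (intro sphere_grad_mult) auto
  have X: "Ck_sphere 1 (X i)" for i
  proof -
    have "X i differentiable_on S2"
      unfolding differentiable_on_def X_def using fd by (auto intro!: derivative_intros)
    moreover have "continuous_on S2 (\<lambda>\<omega>. sphere_grad (X i) \<omega> $ j)" for j
      by (subst continuous_on_cong[OF refl, where g="\<lambda>\<omega>. f \<omega> * sphere_grad (\<lambda>\<omega>. sphere_grad h \<omega> $ i) \<omega> $ j + sphere_grad h \<omega> $ i * sphere_grad f \<omega> $ j"])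
         (auto simp: gX intro!: continuous_intros cc)
    ultimately show ?thesis by simp
  qed
  have int: "integrable mS (\<lambda>\<omega>. sphere_grad (X i) \<omega> \<bullet> axis i 1 - 2 * (X i \<omega> * (\<omega> \<bullet> axis i 1)))" for i
    using X[of i] Ck_sphere_imp_continuous[OF X[of i]]
    by (intro sphere_integrable) (auto simp: inner_axis continuous_on_vec_componentwise intro!: continuous_intros)
  have "0 = (\<Sum>i\<in>UNIV. LINT \<omega>|mS. sphere_grad (X i) \<omega> \<bullet> axis i 1 - 2 * (X i \<omega> * (\<omega> \<bullet> axis i 1)))"
    using sphere_divergence[OF X] by simp
  also have "\<dots> = (LINT \<omega>|mS. (\<Sum>i\<in>UNIV. sphere_grad (X i) \<omega> \<bullet> axis i 1 - 2 * (X i \<omega> * (\<omega> \<bullet> axis i 1))))"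
    using int by (simp add: Bochner_Integration.integral_sum)
  also have "\<dots> = (LINT \<omega>|mS. f \<omega> * lap h \<omega> + sphere_grad f \<omega> \<bullet> sphere_grad h \<omega>)"
  proof (rule Bochner_Integration.integral_cong[OF refl])
    fix \<omega> assume "\<omega> \<in> space mS"
    then have \<omega>: "\<omega> \<in> S2" by simp
    have "(\<Sum>i\<in>UNIV. X i \<omega> * \<omega> $ i) = f \<omega> * (sphere_grad h \<omega> \<bullet> \<omega>)"
      by (simp add: X_def inner_vec_def sum_distrib_left mult.assoc)
    also have "\<dots> = 0" using sphere_grad_tangent[OF \<omega> fd(3)[OF \<omega>]] by simp
    finally have 0: "(\<Sum>i\<in>UNIV. X i \<omega> * \<omega> $ i) = 0" .
    have "(\<Sum>i\<in>UNIV. sphere_grad (X i) \<omega> \<bullet> axis i 1 - 2 * (X i \<omega> * (\<omega> \<bullet> axis i 1)))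
      = (\<Sum>i\<in>UNIV. f \<omega> * sgD [i,i] h \<omega> + sphere_grad f \<omega> $ i * sphere_grad h \<omega> $ i) - 2 * (\<Sum>i\<in>UNIV. X i \<omega> * \<omega> $ i)"
      using gX[OF \<omega>] by (simp add: inner_axis sum_subtractf sum_distrib_left mult.commute)
    also have "\<dots> = f \<omega> * lap h \<omega> + sphere_grad f \<omega> \<bullet> sphere_grad h \<omega>"
      by (simp add: 0 lap_def sum.distrib sum_distrib_left inner_vec_def)
    finally show "(\<Sum>i\<in>UNIV. sphere_grad (X i) \<omega> \<bullet> axis i 1 - 2 * (X i \<omega> * (\<omega> \<bullet> axis i 1)))
      = f \<omega> * lap h \<omega> + sphere_grad f \<omega> \<bullet> sphere_grad h \<omega>" .
  qed
  also have "\<dots> = (LINT \<omega>|mS. f \<omega> * lap h \<omega>) + (LINT \<omega>|mS. sphere_grad f \<omega> \<bullet> sphere_grad h \<omega>)"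
    unfolding lap_def inner_vec_def
    by (intro Bochner_Integration.integral_add sphere_integrable) (auto intro!: continuous_intros cc)
  finally show ?thesis by simp
qed


section \<open>Expansion along great circles\<close>

lemma sphere_component_le: "norm (\<xi>::r3) = 1 \<Longrightarrow> \<bar>\<xi> $ i\<bar> \<le> 1"
  using component_le_norm_cart[of \<xi> i] by simp

text \<open>Bounds are given for single components; the factor 3 is the number of components and
  propagates into the constants below.\<close>

lemma abs_inner_le_sum:
  fixes w \<xi> :: r3
  assumes "norm \<xi> = 1" "\<And>i. \<bar>w $ i\<bar> \<le> M"
  shows "\<bar>w \<bullet> \<xi>\<bar> \<le> 3 * M"
proof -
  have "\<bar>w \<bullet> \<xi>\<bar> \<le> (\<Sum>i\<in>UNIV. \<bar>w $ i * \<xi> $ i\<bar>)"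
    unfolding inner_vec_def inner_real_def by (rule sum_abs)
  also have "\<dots> \<le> (\<Sum>i\<in>(UNIV::3 set). M * 1)"
    unfolding abs_mult
    by (intro sum_mono mult_mono assms(2) sphere_component_le[OF assms(1)] order_trans[OF abs_ge_zero assms(2)] abs_ge_zero)
  also have "\<dots> = 3 * M" by simp
  finally show ?thesis .
qed

text \<open>Mean value theorem along the unit speed great circle from \<open>\<omega>\<close> in the
  direction \<open>e\<close>.\<close>

lemma circle_first_order:
  assumes u: "Ck_sphere 1 u" and M: "\<And>i \<xi>. \<xi> \<in> S2 \<Longrightarrow> \<bar>sphere_grad u \<xi> $ i\<bar> \<le> M"
    and \<omega>: "norm \<omega> = 1" "norm e = 1" "e \<bullet> \<omega> = 0" and \<theta>: "0 \<le> \<theta>"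
  shows "\<bar>u (cos \<theta> *\<^sub>R \<omega> + sin \<theta> *\<^sub>R e) - u \<omega>\<bar> \<le> 3 * M * \<theta>"
proof (cases "\<theta> = 0")
  case False
  define c where "c = (\<lambda>t. cos t *\<^sub>R \<omega> + sin t *\<^sub>R e)"
  define c' where "c' = (\<lambda>t. - sin t *\<^sub>R \<omega> + cos t *\<^sub>R e)"
  have cS: "c t \<in> S2" for t using great_circle_in_sphere[OF \<omega>] by (simp add: c_def)
  have c'n: "norm (c' t) = 1" for t
    using great_circle_in_sphere[OF \<omega>(2,1), of "-t"] \<omega>(3) by (simp add: c'_def inner_commute add.commute)
  have d: "((\<lambda>t. u (c t)) has_real_derivative (sphere_grad u (c t) \<bullet> c' t)) (at t)" for t
    using cS u unfolding c'_def
    by (intro has_derivative_along_sphere_curve[where c=c] sphere_grad_has_derivative)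
      (auto simp: c_def[abs_def] differentiable_on_def intro!: great_circle_derivative[simplified])
  obtain t where "0 < t" "t < \<theta>" "u (c \<theta>) - u (c 0) = (\<theta> - 0) * (sphere_grad u (c t) \<bullet> c' t)"
    using MVT2[of 0 \<theta> "\<lambda>t. u (c t)"] d False \<theta> by force
  then have "\<bar>u (c \<theta>) - u (c 0)\<bar> = \<theta> * \<bar>sphere_grad u (c t) \<bullet> c' t\<bar>"
    using \<theta> by (simp add: abs_mult)
  also have "\<dots> \<le> \<theta> * (3 * M)"
    using \<theta> by (intro mult_left_mono abs_inner_le_sum c'n M cS) auto
  finally show ?thesis by (simp add: c_def mult.commute)
qed simp

text \<open>Taylor expansion at 0 of \<open>g0\<close>, the derivative of \<open>h\<close> along the
  unit speed great circle \<open>c\<close>. The linear term is the Hessian form at c'(0) = e alone: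
  the second derivative of \<open>c\<close> is - c, which is normal to the sphere, while the
  gradient is tangent.\<close>

lemma circle_second_order:
  assumes h: "Ck_sphere 3 h" and M: "\<And>is \<xi>. length is \<le> 3 \<Longrightarrow> \<xi> \<in> S2 \<Longrightarrow> \<bar>sgD is h \<xi>\<bar> \<le> M"
    and \<omega>: "norm \<omega> = 1" "norm e = 1" "e \<bullet> \<omega> = 0" and \<theta>: "0 \<le> \<theta>"
  shows "\<bar>sphere_grad h (cos \<theta> *\<^sub>R \<omega> + sin \<theta> *\<^sub>R e) \<bullet> (- sin \<theta> *\<^sub>R \<omega> + cos \<theta> *\<^sub>R e)
    - sphere_grad h \<omega> \<bullet> e - \<theta> * (\<Sum>i\<in>UNIV. \<Sum>j\<in>UNIV. sgD [j, i] h \<omega> * e $ j * e $ i)\<bar> \<le> 23 * M * \<theta>\<^sup>2"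
proof (cases "\<theta> = 0")
  case False
  define c where "c = (\<lambda>t. cos t *\<^sub>R \<omega> + sin t *\<^sub>R e)"
  define c' where "c' = (\<lambda>t. - sin t *\<^sub>R \<omega> + cos t *\<^sub>R e)"
  have cS: "c t \<in> S2" for t using great_circle_in_sphere[OF \<omega>] by (simp add: c_def)
  have c'n: "norm (c' t) = 1" for t
    using great_circle_in_sphere[OF \<omega>(2,1), of "-t"] \<omega>(3) by (simp add: c'_def inner_commute add.commute)
  have c1: "\<bar>c t $ i\<bar> \<le> 1" "\<bar>c' t $ i\<bar> \<le> 1" for t i
    using sphere_component_le[OF c'n] sphere_component_le cS by auto
  have M0: "0 \<le> M" using M[of "[]" \<omega>] \<omega> by force
  have cd: "(c has_vector_derivative c' t) (at t)" for t
    unfolding c_def c'_def by (rule great_circle_derivative)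
  have c'd: "(c' has_vector_derivative - c t) (at t)" for t
    unfolding c_def c'_def by (auto intro!: derivative_eq_intros simp: has_vector_derivative_def algebra_simps)
  have comp: "((\<lambda>t. f t $ i) has_real_derivative f' $ i) (at t)"
    if "(f has_vector_derivative f') (at t)" for f :: "real \<Rightarrow> r3" and f' t i
    using bounded_linear.has_vector_derivative[OF bounded_linear_vec_nth that]
    by (simp add: has_real_derivative_iff_has_vector_derivative)
  have dD: "sgD is h differentiable (at \<xi> within S2)" if "length is < 3" "\<xi> \<in> S2" for "is" \<xi>
    using sgD_differentiable[OF h that] .
  have d: "((\<lambda>t. sgD is h (c t)) has_real_derivative (\<Sum>j\<in>UNIV. sgD (j # is) h (c t) * c' t $ j)) (at t)"
    if "length is < 3" for "is" t
  proof -
    have "((\<lambda>t. sgD is h (c t)) has_real_derivative (sphere_grad (sgD is h) (c t) \<bullet> c' t)) (at t)"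
      using cS by (intro has_derivative_along_sphere_curve sphere_grad_has_derivative dD that cd)
    then show ?thesis by (simp add: inner_vec_def)
  qed
  have tangent: "(\<Sum>j\<in>UNIV. sgD (j # is) h (c t) * c t $ j) = 0" if "length is < 3" for "is" t
    using sphere_grad_tangent[OF cS dD[OF that cS]] by (simp add: inner_vec_def)
  define g0 where "g0 = (\<lambda>t. \<Sum>i\<in>UNIV. sgD [i] h (c t) * c' t $ i)"
  define g1 where "g1 = (\<lambda>t. \<Sum>i\<in>UNIV. \<Sum>j\<in>UNIV. sgD [j, i] h (c t) * c' t $ j * c' t $ i)"
  define g2 where "g2 = (\<lambda>t. \<Sum>i\<in>UNIV. \<Sum>j\<in>UNIV.
      (\<Sum>k\<in>UNIV. sgD [k, j, i] h (c t) * c' t $ k) * c' t $ j * c' t $ i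
      - sgD [j, i] h (c t) * c t $ j * c' t $ i - sgD [j, i] h (c t) * c' t $ j * c t $ i)"
  have g0d: "(g0 has_real_derivative g1 t) (at t)" for t
  proof -
    have "(g0 has_real_derivative
        (\<Sum>i\<in>UNIV. (\<Sum>j\<in>UNIV. sgD [j, i] h (c t) * c' t $ j) * c' t $ i + (- c t) $ i * sgD [i] h (c t))) (at t)"
      unfolding g0_def by (intro DERIV_sum DERIV_mult d comp c'd) simp
    moreover have "(\<Sum>i\<in>UNIV. (- c t) $ i * sgD [i] h (c t)) = 0"
      using tangent[of "[]" t] by (simp add: sum_negf mult.commute)
    ultimately show ?thesis
      by (simp only: g1_def sum.distrib sum_distrib_right add_0_right)
  qed
  have g1d: "(g1 has_real_derivative g2 t) (at t)" for t
  proof -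
    have "(g1 has_real_derivative (\<Sum>i\<in>UNIV. \<Sum>j\<in>UNIV.
        ((\<Sum>k\<in>UNIV. sgD [k, j, i] h (c t) * c' t $ k) * c' t $ j + (- c t) $ j * sgD [j, i] h (c t)) * c' t $ i
        + (- c t) $ i * (sgD [j, i] h (c t) * c' t $ j))) (at t)"
      unfolding g1_def by (intro DERIV_sum DERIV_mult d comp c'd) simp
    then show ?thesis by (rule DERIV_cong) (simp add: g2_def algebra_simps)
  qed
  have b3: "\<bar>p * q * r\<bar> \<le> m" if "\<bar>p\<bar> \<le> m" "\<bar>q\<bar> \<le> 1" "\<bar>r\<bar> \<le> 1" for p q r m :: real
  proof -
    have "\<bar>p * q * r\<bar> = \<bar>p\<bar> * (\<bar>q\<bar> * \<bar>r\<bar>)" by (simp add: abs_mult)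
    also have "\<dots> \<le> m * (1 * 1)" using that by (intro mult_mono) auto
    finally show ?thesis by simp
  qed
  have b2: "\<bar>\<Sum>k\<in>UNIV. sgD [k, j, i] h (c t) * c' t $ k\<bar> \<le> 3 * M" for i j t
    using abs_inner_le_sum[OF c'n, of "sphere_grad (sgD [j, i] h) (c t)" M t] M[of "[_, j, i]" "c t"] cS[of t]
    by (simp add: inner_vec_def)
  \<comment> \<open>Nine index pairs, each contributing at most 3 M from the third derivatives and M
    from either of the two terms produced by differentiating \<open>c'\<close>.\<close>
  have g2b: "\<bar>g2 t\<bar> \<le> 45 * M" for t
  proof -
    have "\<bar>g2 t\<bar> \<le> (\<Sum>i\<in>(UNIV::3 set). \<Sum>j\<in>(UNIV::3 set). 3 * M + M + M)"
      unfolding g2_def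
    proof (intro order_trans[OF sum_abs] sum_mono)
      fix i j
      have "\<bar>(\<Sum>k\<in>UNIV. sgD [k, j, i] h (c t) * c' t $ k) * c' t $ j * c' t $ i\<bar> \<le> 3 * M"
        by (intro b3 b2 c1)
      moreover have "\<bar>sgD [j, i] h (c t) * c t $ j * c' t $ i\<bar> \<le> M" "\<bar>sgD [j, i] h (c t) * c' t $ j * c t $ i\<bar> \<le> M"
        using M[of "[j, i]" "c t"] cS[of t] by (auto intro!: b3 c1)
      ultimately show "\<bar>(\<Sum>k\<in>UNIV. sgD [k, j, i] h (c t) * c' t $ k) * c' t $ j * c' t $ i
        - sgD [j, i] h (c t) * c t $ j * c' t $ i - sgD [j, i] h (c t) * c' t $ j * c t $ i\<bar> \<le> 3 * M + M + M"
        by linarith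
    qed
    then show ?thesis by simp
  qed
  let ?G = "\<lambda>m::nat. if m = 0 then g0 else if m = 1 then g1 else g2"
  have "\<exists>t>0. t < \<theta> \<and> g0 \<theta> = (\<Sum>m<2. ?G m 0 / fact m * \<theta> ^ m) + ?G 2 t / fact 2 * \<theta> ^ 2"
    using False \<theta> g0d g1d by (intro Maclaurin) auto
  then obtain t where "g0 \<theta> - g0 0 - \<theta> * g1 0 = g2 t / 2 * \<theta>\<^sup>2"
    by (auto simp: numeral_2_eq_2 mult.commute)
  \<comment> \<open>Half of 45, rounded up.\<close>
  moreover have "\<bar>g2 t / 2 * \<theta>\<^sup>2\<bar> \<le> 23 * M * \<theta>\<^sup>2"
    unfolding abs_mult using g2b[of t] M0 by (intro mult_mono) auto
  moreover have "g0 \<theta> = sphere_grad h (c \<theta>) \<bullet> c' \<theta>" for \<theta>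
    by (simp add: g0_def inner_vec_def)
  ultimately show ?thesis
    by (simp add: c_def c'_def g1_def)
qed simp

section \<open>Averages over circles\<close>

definition perp_frame :: "r3 \<Rightarrow> r3 \<Rightarrow> r3 \<Rightarrow> bool" where
  "perp_frame \<omega> a b \<longleftrightarrow> norm \<omega> = 1 \<and> norm a = 1 \<and> norm b = 1 \<and> a \<bullet> b = 0 \<and> a \<bullet> \<omega> = 0 \<and> b \<bullet> \<omega> = 0"

lemma perp_frame_direction:
  assumes "perp_frame \<omega> a b"
  shows "norm (cos s *\<^sub>R a + sin s *\<^sub>R b) = 1" "(cos s *\<^sub>R a + sin s *\<^sub>R b) \<bullet> \<omega> = 0"
  using assms great_circle_in_sphere[of a b s]
  by (auto simp: perp_frame_def inner_add_left inner_commute[of b a])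

text \<open>The integrand takes the direction and not the angle, so that averages with respect to
  different frames of the same tangent plane can be compared.\<close>

definition circle_int :: "(r3 \<Rightarrow> real) \<Rightarrow> r3 \<Rightarrow> r3 \<Rightarrow> real" where
  "circle_int \<Phi> a b = (LINT s:{0..2*pi}|lborel. \<Phi> (cos s *\<^sub>R a + sin s *\<^sub>R b))"

lemma circle_int_eq_integral:
  assumes "continuous_on {0..2*pi} (\<lambda>s. \<Phi> (cos s *\<^sub>R a + sin s *\<^sub>R b))"
  shows "circle_int \<Phi> a b = integral {0..2*pi} (\<lambda>s. \<Phi> (cos s *\<^sub>R a + sin s *\<^sub>R b))"
  unfolding circle_int_def by (rule set_borel_integral_eq_integral borel_integrable_atLeastAtMost' assms)+

lemma circle_int_close:
  assumes "continuous_on {0..2*pi} (\<lambda>s. \<Phi> (cos s *\<^sub>R a + sin s *\<^sub>R b))"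
    and "((\<lambda>s. L (cos s *\<^sub>R a + sin s *\<^sub>R b)) has_integral I) {0..2*pi}"
    and "\<And>s. \<bar>\<Phi> (cos s *\<^sub>R a + sin s *\<^sub>R b) - L (cos s *\<^sub>R a + sin s *\<^sub>R b)\<bar> \<le> K"
  shows "\<bar>circle_int \<Phi> a b - I\<bar> \<le> 2 * pi * K"
proof -
  have "((\<lambda>s. \<Phi> (cos s *\<^sub>R a + sin s *\<^sub>R b)) has_integral circle_int \<Phi> a b) {0..2*pi}"
    unfolding circle_int_eq_integral[OF assms(1)]
    by (intro integrable_integral integrable_continuous_interval assms)
  from has_integral_diff[OF this assms(2)]
  have "norm (circle_int \<Phi> a b - I) \<le> K * Henstock_Kurzweil_Integration.content (cbox 0 (2*pi))"
    using assms(3) order_trans[OF abs_ge_zero assms(3)]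
    by (intro has_integral_bound) auto
  then show ?thesis by (simp add: mult.commute)
qed

lemma integral_trig_squares:
  "((\<lambda>s. (cos s * p + sin s * q) * (cos s * p' + sin s * q')) has_integral pi * (p * p' + q * q')) {0..2*pi}"
proof -
  define P where "P = (\<lambda>s. (s + sin s * cos s) / 2 * (p * p') + (sin s)\<^sup>2 / 2 * (p * q' + q * p') + (s - sin s * cos s) / 2 * (q * q'))"
  have "(P has_real_derivative (cos s * p + sin s * q) * (cos s * p' + sin s * q')) (at s within T)" for s T
  proof -
    have 1: "sin s * sin s = 1 - cos s * cos s"
      using sin_cos_squared_add3[of s] by linarith
    have "(1 + (cos s * cos s - sin s * sin s)) / 2 = cos s * cos s"
      "(1 - (cos s * cos s - sin s * sin s)) / 2 = sin s * sin s"
      unfolding 1 by (simp_all add: field_simps)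
    moreover have "(P has_real_derivative (1 + (cos s * cos s - sin s * sin s)) / 2 * (p * p') + sin s * cos s * (p * q' + q * p')
      + (1 - (cos s * cos s - sin s * sin s)) / 2 * (q * q')) (at s within T)"
      unfolding P_def by (auto intro!: derivative_eq_intros simp: field_simps power2_eq_square)
    ultimately have "(P has_real_derivative (cos s * cos s) * (p * p') + sin s * cos s * (p * q' + q * p')
      + (sin s * sin s) * (q * q')) (at s within T)" by (simp only:)
    then show ?thesis by (rule DERIV_cong) (simp add: algebra_simps)
  qed
  then have "((\<lambda>s. (cos s * p + sin s * q) * (cos s * p' + sin s * q')) has_integral P (2*pi) - P 0) {0..2*pi}"
    by (intro fundamental_theorem_of_calculus) (auto simp: has_real_derivative_iff_has_vector_derivative[symmetric])
  moreover have "P (2*pi) - P 0 = pi * (p * p' + q * q')"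
    by (simp add: P_def algebra_simps)
  ultimately show ?thesis by simp
qed

lemma integral_trig_linear: "((\<lambda>s. cos s * p + sin s * q) has_integral 0) {0..2*pi::real}"
proof -
  have "((\<lambda>s. cos s * p + sin s * q) has_integral (sin (2*pi) * p - cos (2*pi) * q) - (sin 0 * p - cos 0 * q)) {0..2*pi}"
    by (intro fundamental_theorem_of_calculus)
      (auto simp: has_real_derivative_iff_has_vector_derivative[symmetric] intro!: derivative_eq_intros)
  then show ?thesis by simp
qed

text \<open>The integral of e_j e_i over the circle is pi times the entry delta_ij - \<omega>_j
  \<omega>_i of the projection onto the tangent plane. The normal part is annihilated because the
  outer gradient is tangent, which leaves the trace.\<close>

lemma circle_hessian_mean:
  assumes h: "Ck_sphere 2 h" and fr: "perp_frame \<omega> a b"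
  shows "((\<lambda>s. \<Sum>i\<in>UNIV. \<Sum>j\<in>UNIV. sgD [j, i] h \<omega> * (cos s *\<^sub>R a + sin s *\<^sub>R b) $ j * (cos s *\<^sub>R a + sin s *\<^sub>R b) $ i)
    has_integral pi * lap h \<omega>) {0..2*pi}"
proof -
  let ?I = "\<Sum>i\<in>UNIV. \<Sum>j\<in>UNIV. sgD [j, i] h \<omega> * (pi * (a $ j * a $ i + b $ j * b $ i))"
  have "((\<lambda>s. \<Sum>i\<in>UNIV. \<Sum>j\<in>UNIV. sgD [j, i] h \<omega> * ((cos s * a $ j + sin s * b $ j) * (cos s * a $ i + sin s * b $ i)))
    has_integral ?I) {0..2*pi}"
    by (intro has_integral_sum has_integral_mult_right integral_trig_squares) auto
  moreover have "?I = pi * lap h \<omega>"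
  proof -
    have delta: "a $ j * a $ i + b $ j * b $ i = (if i = j then 1 else 0) - \<omega> $ j * \<omega> $ i" for i j
      using orthonormal_inner[of a b \<omega> "axis j 1" "axis i 1"] fr
      by (simp add: perp_frame_def inner_axis inner_axis' inner_commute[of b a]) (auto simp: axis_def)
    have t: "(\<Sum>j\<in>UNIV. sgD [j, i] h \<omega> * \<omega> $ j) = 0" for i
    proof -
      have "\<omega> \<in> S2" using fr by (simp add: perp_frame_def)
      from sphere_grad_tangent[OF this sgD_differentiable[OF h _ this, of "[i]"]]
      show ?thesis by (simp add: inner_vec_def)
    qed
    have "?I = (\<Sum>i\<in>UNIV. \<Sum>j\<in>UNIV. pi * (sgD [j, i] h \<omega> * (if i = j then 1 else 0)))
      - (\<Sum>i\<in>UNIV. \<Sum>j\<in>UNIV. pi * \<omega> $ i * (sgD [j, i] h \<omega> * \<omega> $ j))"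
      unfolding delta sum_subtractf[symmetric] by (intro sum.cong refl) (simp add: algebra_simps)
    also have "(\<Sum>i\<in>UNIV. \<Sum>j\<in>UNIV. pi * \<omega> $ i * (sgD [j, i] h \<omega> * \<omega> $ j)) = 0"
      by (simp only: sum_distrib_left[symmetric] t) simp
    also have "(\<Sum>i\<in>UNIV. \<Sum>j\<in>UNIV. pi * (sgD [j, i] h \<omega> * (if i = j then 1 else 0))) = pi * lap h \<omega>"
      by (simp add: lap_def sum_distrib_left if_distrib cong: if_cong)
    finally show ?thesis by simp
  qed
  ultimately show ?thesis by (simp add: mult.assoc)
qed

text \<open>Turns remainders in the angle into powers of its sine. Because \<theta> \<le> pi / 2 <
  2, the Taylor remainder \<theta>^3 / 6 is at most 2 \<theta> / 3 and also at most \<theta>^2 /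
  3.\<close>

lemma angle_le_sin:
  fixes \<theta> :: real
  assumes "0 \<le> \<theta>" "\<theta> \<le> pi / 2"
  shows "\<theta> \<le> 3 * sin \<theta>" "\<bar>\<theta> - sin \<theta>\<bar> \<le> \<theta>\<^sup>2"
proof -
  have "\<bar>sin \<theta> - \<theta>\<bar> \<le> \<theta> ^ 3 / 6"
    using Maclaurin_sin_bound[of \<theta> 3] assms
    by (simp add: numeral_3_eq_3 sin_coeff_def fact_numeral field_simps)
  moreover have "\<theta> ^ 3 \<le> 2\<^sup>2 * \<theta>" "\<theta> ^ 3 \<le> 2 * \<theta>\<^sup>2"
  proof -
    have "\<theta> \<le> 2" using assms pi_half_less_two by linarith
    then have "\<theta> * \<theta>\<^sup>2 \<le> 2 * \<theta>\<^sup>2" "\<theta>\<^sup>2 * \<theta> \<le> 2\<^sup>2 * \<theta>"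
      using assms by (auto intro!: mult_right_mono) (use power_mono[of \<theta> 2 2] in simp)
    then show "\<theta> ^ 3 \<le> 2\<^sup>2 * \<theta>" "\<theta> ^ 3 \<le> 2 * \<theta>\<^sup>2"
      by (simp_all add: power3_eq_cube power2_eq_square algebra_simps)
  qed
  ultimately show "\<theta> \<le> 3 * sin \<theta>" "\<bar>\<theta> - sin \<theta>\<bar> \<le> \<theta>\<^sup>2"
    using zero_le_power2[of \<theta>] assms(1) unfolding abs_le_iff power2_eq_square[of 2] by linarith+
qed

text \<open>Over the full circle the zeroth order term of the expansion integrates to zero and the
  Hessian form to pi times the Laplacian. The main term carries the factor n = sin \<theta> instead
  of \<theta> because \<open>n\<close> is what the velocity divides by later.\<close>

lemma circle_gradient_mean:
  assumes h: "Ck_sphere 3 h" and M: "\<And>is \<xi>. length is \<le> 3 \<Longrightarrow> \<xi> \<in> S2 \<Longrightarrow> \<bar>sgD is h \<xi>\<bar> \<le> M"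
    and fr: "perp_frame \<omega> a b" and m: "0 \<le> m" "m \<le> 1" and n: "n = sqrt (1 - m\<^sup>2)"
  shows "\<bar>circle_int (\<lambda>e. sphere_grad h (m *\<^sub>R \<omega> + n *\<^sub>R e) \<bullet> (- n *\<^sub>R \<omega> + m *\<^sub>R e)) a b - n * (pi * lap h \<omega>)\<bar>
    \<le> 2 * pi * (288 * M * n\<^sup>2)"
proof -
  define \<theta> where "\<theta> = arccos m"
  have mt: "cos \<theta> = m" using m by (simp add: \<theta>_def)
  have t0: "0 \<le> \<theta>" "\<theta> \<le> pi / 2"
    using m arccos_lbound[of m] arccos_le_pi2[of m] by (auto simp: \<theta>_def)
  have nt: "sin \<theta> = n"
    using m by (simp add: n \<theta>_def sin_arccos)
  note angle = angle_le_sin[OF t0]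
  define e where "e = (\<lambda>s. cos s *\<^sub>R a + sin s *\<^sub>R b)"
  define H where "H = (\<lambda>e::r3. \<Sum>i\<in>UNIV. \<Sum>j\<in>UNIV. sgD [j, i] h \<omega> * e $ j * e $ i)"
  have \<omega>: "norm \<omega> = 1" "norm (e s) = 1" "e s \<bullet> \<omega> = 0" for s
    using fr perp_frame_direction[OF fr] by (auto simp: perp_frame_def e_def)
  have M0: "0 \<le> M" using M[of "[]" \<omega>] \<omega> by force
  have gc: "continuous_on S2 (sphere_grad h)"
    unfolding continuous_on_vec_componentwise
    using h Ck_sphere_imp_continuous[of 2] by (auto simp del: Ck_sphere.simps simp: numeral_3_eq_3 numeral_2_eq_2 Ck_sphere.simps(2)[of "Suc (Suc 0)" h])
  have int: "((\<lambda>s. sphere_grad h \<omega> \<bullet> e s + n * H (e s)) has_integral 0 + n * (pi * lap h \<omega>)) {0..2*pi}"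
  proof (intro has_integral_add has_integral_mult_right)
    show "((\<lambda>s. sphere_grad h \<omega> \<bullet> e s) has_integral 0) {0..2*pi}"
      using integral_trig_linear[of "sphere_grad h \<omega> \<bullet> a" "sphere_grad h \<omega> \<bullet> b"]
      by (simp add: e_def inner_add_right)
    have h2: "Ck_sphere 2 h" using h Ck_sphere_mono_Suc[of 2 h] by (simp add: numeral_3_eq_3 numeral_2_eq_2)
    show "((\<lambda>s. H (e s)) has_integral pi * lap h \<omega>) {0..2*pi}"
      unfolding H_def e_def by (rule circle_hessian_mean[OF h2 fr])
  qed
  have Hb: "\<bar>H (e s)\<bar> \<le> 9 * M" for s
  proof -
    have "\<bar>H (e s)\<bar> \<le> (\<Sum>i\<in>(UNIV::3 set). \<Sum>j\<in>(UNIV::3 set). M)"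
      unfolding H_def
    proof (intro order_trans[OF sum_abs] sum_mono)
      fix i j
      have "\<bar>sgD [j, i] h \<omega> * e s $ j * e s $ i\<bar> = \<bar>sgD [j, i] h \<omega>\<bar> * (\<bar>e s $ j\<bar> * \<bar>e s $ i\<bar>)"
        by (simp add: abs_mult)
      also have "\<dots> \<le> M * (1 * 1)"
        using M[of "[j, i]" \<omega>] \<omega> sphere_component_le[OF \<omega>(2)] M0 by (intro mult_mono) auto
      finally show "\<bar>sgD [j, i] h \<omega> * e s $ j * e s $ i\<bar> \<le> M" by simp
    qed
    then show ?thesis by simp
  qed
  have "\<bar>circle_int (\<lambda>e. sphere_grad h (m *\<^sub>R \<omega> + n *\<^sub>R e) \<bullet> (- n *\<^sub>R \<omega> + m *\<^sub>R e)) a b - (0 + n * (pi * lap h \<omega>))\<bar>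
    \<le> 2 * pi * (23 * M * \<theta>\<^sup>2 + 9 * M * \<theta>\<^sup>2)"
  proof (rule circle_int_close[where L="\<lambda>e. sphere_grad h \<omega> \<bullet> e + n * H e"])
    show "continuous_on {0..2*pi} (\<lambda>s. sphere_grad h (m *\<^sub>R \<omega> + n *\<^sub>R (cos s *\<^sub>R a + sin s *\<^sub>R b))
        \<bullet> (- n *\<^sub>R \<omega> + m *\<^sub>R (cos s *\<^sub>R a + sin s *\<^sub>R b)))"
      using great_circle_in_sphere[OF \<omega>, of \<theta>]
      by (intro continuous_intros continuous_on_compose2[OF gc]) (auto simp: mt nt e_def)
    show "((\<lambda>s. sphere_grad h \<omega> \<bullet> (cos s *\<^sub>R a + sin s *\<^sub>R b) + n * H (cos s *\<^sub>R a + sin s *\<^sub>R b)) has_integral 0 + n * (pi * lap h \<omega>)) {0..2*pi}"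
      using int by (simp add: e_def)
    fix s
    have 1: "\<bar>sphere_grad h (m *\<^sub>R \<omega> + n *\<^sub>R e s) \<bullet> (- n *\<^sub>R \<omega> + m *\<^sub>R e s) - sphere_grad h \<omega> \<bullet> e s - \<theta> * H (e s)\<bar> \<le> 23 * M * \<theta>\<^sup>2"
      using circle_second_order[OF h M \<omega> t0(1), of s] by (simp add: mt nt H_def)
    have "\<bar>(\<theta> - n) * H (e s)\<bar> \<le> \<theta>\<^sup>2 * (9 * M)"
      unfolding abs_mult using angle(2) Hb[of s] by (intro mult_mono) (auto simp: nt)
    then have 2: "\<bar>\<theta> * H (e s) - n * H (e s)\<bar> \<le> 9 * M * \<theta>\<^sup>2" by (simp add: algebra_simps)
    from 1 2 show "\<bar>sphere_grad h (m *\<^sub>R \<omega> + n *\<^sub>R (cos s *\<^sub>R a + sin s *\<^sub>R b)) \<bullet> (- n *\<^sub>R \<omega> + m *\<^sub>R (cos s *\<^sub>R a + sin s *\<^sub>R b)) -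
         (sphere_grad h \<omega> \<bullet> (cos s *\<^sub>R a + sin s *\<^sub>R b) + n * H (cos s *\<^sub>R a + sin s *\<^sub>R b))\<bar> \<le> 23 * M * \<theta>\<^sup>2 + 9 * M * \<theta>\<^sup>2"
      unfolding e_def by linarith
  qed
  \<comment> \<open>288 = 9 (23 + 9): the Taylor remainder gives 23, replacing \<theta> by
    \<open>n\<close> in front of the Hessian form gives 9, and \<theta>^2 \<le> 9 n^2.\<close>
  also have "\<dots> \<le> 2 * pi * (288 * M * n\<^sup>2)"
  proof -
    have "\<theta>\<^sup>2 \<le> (3 * n)\<^sup>2" using angle(1) t0 by (intro power_mono) (auto simp: nt)
    then have "M * \<theta>\<^sup>2 \<le> M * (9 * n\<^sup>2)" using M0 by (intro mult_left_mono) (auto simp: power_mult_distrib)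
    then show ?thesis by simp
  qed
  finally show ?thesis by simp
qed

text \<open>Each great circle contributes 3 M \<theta>, and \<theta> \<le> 3 sin \<theta> = 3
  n.\<close>

lemma circle_mean_first_order:
  assumes u: "Ck_sphere 1 u" and M: "\<And>i \<xi>. \<xi> \<in> S2 \<Longrightarrow> \<bar>sphere_grad u \<xi> $ i\<bar> \<le> M"
    and fr: "perp_frame \<omega> a b" and m: "0 \<le> m" "m \<le> 1" and n: "n = sqrt (1 - m\<^sup>2)"
  shows "\<bar>circle_int (\<lambda>e. u (m *\<^sub>R \<omega> + n *\<^sub>R e)) a b - 2 * pi * u \<omega>\<bar> \<le> 2 * pi * (9 * M * n)"
proof -
  define \<theta> where "\<theta> = arccos m"
  have mt: "cos \<theta> = m" using m by (simp add: \<theta>_def)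
  have t0: "0 \<le> \<theta>" "\<theta> \<le> pi / 2"
    using m arccos_lbound[of m] arccos_le_pi2[of m] by (auto simp: \<theta>_def)
  have nt: "sin \<theta> = n"
    using m by (simp add: n \<theta>_def sin_arccos)
  define e where "e = (\<lambda>s. cos s *\<^sub>R a + sin s *\<^sub>R b)"
  have \<omega>: "norm \<omega> = 1" "norm (e s) = 1" "e s \<bullet> \<omega> = 0" for s
    using fr perp_frame_direction[OF fr] by (auto simp: perp_frame_def e_def)
  have M0: "0 \<le> M" using M[of \<omega>] \<omega> by force
  show ?thesis
  proof (rule circle_int_close[where L="\<lambda>e. u \<omega>"])
    show "continuous_on {0..2*pi} (\<lambda>s. u (m *\<^sub>R \<omega> + n *\<^sub>R (cos s *\<^sub>R a + sin s *\<^sub>R b)))"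
      using great_circle_in_sphere[OF \<omega>, of \<theta>]
      by (intro continuous_intros continuous_on_compose2[OF Ck_sphere_imp_continuous[OF u]]) (auto simp: mt nt e_def)
    show "((\<lambda>s. u \<omega>) has_integral 2 * pi * u \<omega>) {0..2*pi}"
      using has_integral_const_real[of "u \<omega>" 0 "2*pi"] by simp
    fix s
    have "\<bar>u (m *\<^sub>R \<omega> + n *\<^sub>R e s) - u \<omega>\<bar> \<le> 3 * M * \<theta>"
      using circle_first_order[OF u M \<omega> t0(1)] by (simp add: mt nt)
    also have "\<dots> \<le> 3 * M * (3 * n)"
      using angle_le_sin(1)[OF t0] M0 by (intro mult_left_mono) (auto simp: nt)
    finally show "\<bar>u (m *\<^sub>R \<omega> + n *\<^sub>R (cos s *\<^sub>R a + sin s *\<^sub>R b)) - u \<omega>\<bar> \<le> 9 * M * n"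
      by (simp add: e_def)
  qed
qed


text \<open>Two orthonormal bases of the same plane differ by a rotation through
  \<open>\<phi>\<close>, possibly combined with a reflection; no orientation is fixed, hence the
  sign \<open>\<epsilon>\<close>.\<close>

lemma perp_frame_change:
  assumes "perp_frame \<omega> a b" "perp_frame \<omega> a' b'"
  shows "\<exists>\<phi> \<epsilon>. (\<epsilon> = 1 \<or> \<epsilon> = -1) \<and>
    (\<forall>s. cos s *\<^sub>R a' + sin s *\<^sub>R b' = cos (\<phi> + \<epsilon> * s) *\<^sub>R a + sin (\<phi> + \<epsilon> * s) *\<^sub>R b)"
proof -
  have expand: "x = (x \<bullet> a) *\<^sub>R a + (x \<bullet> b) *\<^sub>R b" if "x \<bullet> \<omega> = 0" for x
  proof (rule vector_eq_rdot[THEN iffD1], rule allI)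
    fix z
    show "x \<bullet> z = ((x \<bullet> a) *\<^sub>R a + (x \<bullet> b) *\<^sub>R b) \<bullet> z"
      using orthonormal_inner[of a b \<omega> x z] assms(1) that
      by (simp add: perp_frame_def inner_add_left inner_commute)
        (simp add: inner_add_right inner_commute)
  qed
  have inn: "x \<bullet> y = (x \<bullet> a) * (y \<bullet> a) + (x \<bullet> b) * (y \<bullet> b)" if "x \<bullet> \<omega> = 0" for x y
    using orthonormal_inner[of a b \<omega> x y] assms(1) that by (simp add: perp_frame_def)
  define p q r t where "p = a' \<bullet> a" and "q = a' \<bullet> b" and "r = b' \<bullet> a" and "t = b' \<bullet> b"
  have pq: "p\<^sup>2 + q\<^sup>2 = 1" and rt: "r\<^sup>2 + t\<^sup>2 = 1" and o: "p * r + q * t = 0"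
    using inn[of a' a'] inn[of b' b'] inn[of a' b'] assms(2)
    by (auto simp: perp_frame_def p_def q_def r_def t_def power2_eq_square dot_square_norm)
  obtain \<phi> where \<phi>: "p = cos \<phi>" "q = sin \<phi>" using sincos_total_2pi[OF pq] by metis
  \<comment> \<open>The determinant of the change of basis; by Lagrange's identity its square is
    1.\<close>
  define \<epsilon> where "\<epsilon> = p * t - q * r"
  have "\<epsilon>\<^sup>2 = (p\<^sup>2 + q\<^sup>2) * (r\<^sup>2 + t\<^sup>2) - (p * r + q * t)\<^sup>2"
    by (simp add: \<epsilon>_def power2_eq_square algebra_simps)
  then have e1: "\<epsilon> = 1 \<or> \<epsilon> = -1" by (simp add: pq rt o power2_eq_1_iff)
  have r: "r = - \<epsilon> * q" and t: "t = \<epsilon> * p"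
  proof -
    have "r = r * (p\<^sup>2 + q\<^sup>2) - p * (p * r + q * t)" by (simp add: pq o)
    then show "r = - \<epsilon> * q" by (simp add: \<epsilon>_def power2_eq_square algebra_simps)
    have "t = t * (p\<^sup>2 + q\<^sup>2) - q * (p * r + q * t)" by (simp add: pq o)
    then show "t = \<epsilon> * p" by (simp add: \<epsilon>_def power2_eq_square algebra_simps)
  qed
  have a': "a' = p *\<^sub>R a + q *\<^sub>R b" and b': "b' = r *\<^sub>R a + t *\<^sub>R b"
    using expand[of a'] expand[of b'] assms(2) by (auto simp: perp_frame_def p_def q_def r_def t_def)
  have trig: "cos (\<epsilon> * s) = cos s" "sin (\<epsilon> * s) = \<epsilon> * sin s" for s using e1 by auto
  show ?thesis
  proof (intro exI conjI allI)
    show "\<epsilon> = 1 \<or> \<epsilon> = -1" by (rule e1)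
    fix s
    show "cos s *\<^sub>R a' + sin s *\<^sub>R b' = cos (\<phi> + \<epsilon> * s) *\<^sub>R a + sin (\<phi> + \<epsilon> * s) *\<^sub>R b"
      unfolding a' b' cos_add sin_add trig r t \<phi> by (simp add: algebra_simps)
  qed
qed

text \<open>The integral over a period is independent of its starting point, since its derivative g
  (x + 2 pi) - g x vanishes. An affine substitution then covers both the shift and the
  reflection.\<close>

lemma periodic_integral:
  fixes g :: "real \<Rightarrow> real"
  assumes c: "continuous_on UNIV g" and p: "\<And>s. g (s + 2 * pi) = g s" and e: "\<epsilon> = 1 \<or> \<epsilon> = -1"
  shows "integral {0..2*pi} (\<lambda>s. g (\<phi> + \<epsilon> * s)) = integral {0..2*pi} g"
proof -
  define I where "I = (\<lambda>x. integral {x..x + 2*pi} g)"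
  have gi: "g integrable_on {x..y}" for x y
    using c by (intro integrable_continuous_interval) (auto intro: continuous_on_subset)
  have "(I has_real_derivative 0) (at x)" for x
  proof -
    \<comment> \<open>A primitive based strictly to the left of \<open>x\<close>, so that points
      near \<open>x\<close> are interior and its derivative there is two-sided.\<close>
    define P where "P = (\<lambda>u. integral {x - 1..u} g)"
    have P: "(P has_real_derivative g u) (at u)" if "x - 1 < u" for u
    proof -
      have "(P has_real_derivative g u) (at u within {x - 1..u + 1})"
        unfolding P_def using that c by (intro integral_has_real_derivative) (auto intro: continuous_on_subset)
      then show ?thesis using that by (simp add: at_within_Icc_at)
    qed
    have "((\<lambda>u. P (u + 2*pi) - P u) has_real_derivative g (x + 2*pi) * 1 - g x) (at x)"
      by (rule DERIV_diff[OF DERIV_chain2[OF P] P]) (auto intro!: derivative_eq_intros simp: add_increasing2 less_le_trans[of "x - 1" x])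
    then have "((\<lambda>u. P (u + 2*pi) - P u) has_real_derivative 0) (at x)" by (simp add: p)
    moreover have "\<forall>\<^sub>F u in nhds x. P (u + 2*pi) - P u = I u"
    proof -
      have "\<forall>\<^sub>F u in nhds x. u \<in> {x - 1<..}" by (intro eventually_nhds_in_open) auto
      then show ?thesis
      proof eventually_elim
        case (elim u)
        have "integral {x-1..u} g + integral {u..u + 2*pi} g = integral {x-1..u + 2*pi} g"
          using elim by (intro Henstock_Kurzweil_Integration.integral_combine gi) auto
        then show ?case by (simp add: P_def I_def)
      qed
    qed
    ultimately show ?thesis by (subst (asm) DERIV_cong_ev) auto
  qed
  then have const: "I x = I 0" for x by (intro DERIV_const_ratio_const2[of 0 x] DERIV_isconst_all) auto
  have "((\<lambda>s. g (\<phi> + \<epsilon> * s)) has_integral I 0) {0..2*pi}"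
  proof (cases "\<epsilon> = 1")
    case True
    have "(g has_integral I 0) (cbox \<phi> (\<phi> + 2*pi))"
      using gi const[of \<phi>] by (simp add: I_def has_integral_integrable_integral)
    from has_integral_affinity[OF this, of 1 \<phi>] show ?thesis
      by (simp add: True add.commute image_affinity_atLeastAtMost image_add_atLeastAtMost')
  next
    case False
    then have \<epsilon>: "\<epsilon> = -1" using e by auto
    have "(g has_integral I 0) (cbox (\<phi> - 2*pi) \<phi>)"
      using gi const[of "\<phi> - 2*pi"] by (simp add: I_def has_integral_integrable_integral)
    from has_integral_affinity[OF this, of "-1" \<phi>] show ?thesis
      by (simp add: \<epsilon>)
  qed
  then show ?thesis by (simp add: integral_unique I_def)
qed

lemma circle_int_frame:
  assumes fr: "perp_frame \<omega> a b" "perp_frame \<omega> a' b'"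
    and c: "continuous_on {e. norm e = 1 \<and> e \<bullet> \<omega> = 0} \<Phi>"
  shows "circle_int \<Phi> a' b' = circle_int \<Phi> a b"
proof -
  obtain \<phi> \<epsilon> where e: "\<epsilon> = 1 \<or> \<epsilon> = -1"
    and eq: "\<And>s. cos s *\<^sub>R a' + sin s *\<^sub>R b' = cos (\<phi> + \<epsilon> * s) *\<^sub>R a + sin (\<phi> + \<epsilon> * s) *\<^sub>R b"
    using perp_frame_change[OF fr] by auto
  have cont: "continuous_on T (\<lambda>s. \<Phi> (cos s *\<^sub>R a + sin s *\<^sub>R b))" if "perp_frame \<omega> a b" for a b and T :: "real set"
  proof (rule continuous_on_compose2[OF c])
    show "continuous_on T (\<lambda>s. cos s *\<^sub>R a + sin s *\<^sub>R b)" by (intro continuous_intros)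
    show "(\<lambda>s. cos s *\<^sub>R a + sin s *\<^sub>R b) ` T \<subseteq> {e. norm e = 1 \<and> e \<bullet> \<omega> = 0}"
      using perp_frame_direction[OF that] by blast
  qed
  have "circle_int \<Phi> a' b' = integral {0..2*pi} (\<lambda>s. \<Phi> (cos s *\<^sub>R a' + sin s *\<^sub>R b'))"
    by (rule circle_int_eq_integral[OF cont[OF fr(2)]])
  also have "\<dots> = integral {0..2*pi} (\<lambda>s. \<Phi> (cos s *\<^sub>R a + sin s *\<^sub>R b))"
    using periodic_integral[of "\<lambda>s. \<Phi> (cos s *\<^sub>R a + sin s *\<^sub>R b)", OF cont[OF fr(1)] _ e, of \<phi>] by (simp add: eq)
  also have "\<dots> = circle_int \<Phi> a b"
    by (rule circle_int_eq_integral[OF cont[OF fr(1)], symmetric])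
  finally show ?thesis .
qed

text \<open>A Borel choice of frames; the denominator vanishes only at the south pole, where division by
  zero still produces a frame.\<close>

definition frame1 :: "r3 \<Rightarrow> r3" where
  "frame1 \<omega> = axis 1 1 - (\<omega> $ 1 / (1 + \<omega> $ 3)) *\<^sub>R (axis 3 1 + \<omega>)"

definition frame2 :: "r3 \<Rightarrow> r3" where
  "frame2 \<omega> = axis 2 1 - (\<omega> $ 2 / (1 + \<omega> $ 3)) *\<^sub>R (axis 3 1 + \<omega>)"

lemma frame_measurable [measurable]: "frame1 \<in> borel_measurable borel" "frame2 \<in> borel_measurable borel"
  unfolding frame1_def frame2_def by measurable

text \<open>The two vectors are the images of the first two axes under the reflection in the plane
  orthogonal to \<open>axis 3 1 + \<omega>\<close>, which sends the third axis to
  \<open>- \<omega>\<close>. At the south pole the quotient by zero is 0 and the axes themselves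
  remain.\<close>

lemma perp_frame_frame12:
  assumes "norm \<omega> = 1"
  shows "perp_frame \<omega> (frame1 \<omega>) (frame2 \<omega>)"
proof -
  obtain x y z where xyz: "\<omega> $ 1 = x" "\<omega> $ 2 = y" "\<omega> $ 3 = z" by blast
  have n: "x * x + y * y + z * z = 1"
    using assms by (simp add: norm_eq_1 inner_vec_def sum_3 xyz)
  have "x * x + y * y = 0" if "z = -1" using n that by simp
  then have z: "x = 0" "y = 0" if "z = -1"
    using that by (auto simp: sum_squares_eq_zero_iff)
  define d where "d = 1 / (1 + z)"
  have d: "d * (1 + z) = 1" if "z \<noteq> -1"
    using that by (simp add: d_def add_eq_0_iff)
  have X: "x / (1 + z) = x * d" "y / (1 + z) = y * d" by (simp_all add: d_def)
  have f1: "frame1 \<omega> = vector [1 - x * d * x, - (x * d * y), - (x * d * (1 + z))]"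
    and f2: "frame2 \<omega> = vector [- (y * d * x), 1 - y * d * y, - (y * d * (1 + z))]"
    and \<omega>: "\<omega> = vector [x, y, z]"
    by (simp_all add: vec_eq_iff forall_3 frame1_def frame2_def xyz axis_def X)
  show ?thesis
  proof (cases "z = -1")
    case True
    then show ?thesis
      using z unfolding perp_frame_def norm_eq_1 f1 f2 unfolding \<omega> inner_vector3 by (simp add: d_def)
  next
    case False
    note d = d[OF False]
    have e1: "x * d * (1 + z) = x" "y * d * (1 + z) = y" using d by (simp_all add: mult.assoc)
    \<comment> \<open>On the sphere x^2 + y^2 = (1 + z) (1 - z). Multiplied by \<open>d\<close> and
      by d^2 this gives the two relations to which the inner products below reduce.\<close>
    have q: "d * (x * x + y * y) = 1 - z"
    proof -
      have "x * x + y * y = (1 + z) * (1 - z)" using n by (simp add: algebra_simps)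
      then have "d * (x * x + y * y) = (d * (1 + z)) * (1 - z)" by simp
      then show ?thesis by (simp add: d)
    qed
    have d2: "d * d * (x * x + y * y) = 2 * d - 1"
    proof -
      have "d * d * (x * x + y * y) = d * (1 - z)" using q by (simp add: mult.assoc)
      also have "\<dots> = 2 * d - d * (1 + z)" by (simp add: algebra_simps)
      finally show ?thesis by (simp add: d)
    qed
    have "(1 - x * d * x) * (1 - x * d * x) + x * d * y * (x * d * y) + x * x
      = 1 - 2 * d * x * x + x * x * (d * d * (x * x + y * y)) + x * x"
      by (simp add: algebra_simps)
    then have a: "(1 - x * d * x) * (1 - x * d * x) + x * d * y * (x * d * y) + x * x = 1"
      unfolding d2 by (simp add: algebra_simps)
    have "(y * d * x) * (y * d * x) + (1 - y * d * y) * (1 - y * d * y) + y * y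
      = 1 - 2 * d * y * y + y * y * (d * d * (x * x + y * y)) + y * y"
      by (simp add: algebra_simps)
    then have b: "(y * d * x) * (y * d * x) + (1 - y * d * y) * (1 - y * d * y) + y * y = 1"
      unfolding d2 by (simp add: algebra_simps)
    have "- (1 - x * d * x) * (y * d * x) - (x * d * y) * (1 - y * d * y) + x * y
      = x * y * (d * d * (x * x + y * y)) - 2 * d * x * y + x * y"
      by (simp add: algebra_simps)
    then have ab: "- (1 - x * d * x) * (y * d * x) - (x * d * y) * (1 - y * d * y) + x * y = 0"
      unfolding d2 by (simp add: algebra_simps)
    have "(1 - x * d * x) * x - x * d * y * y - x * z = x * (1 - z - d * (x * x + y * y))"
      by (simp add: algebra_simps)
    then have aw: "(1 - x * d * x) * x - x * d * y * y - x * z = 0" by (simp add: q)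
    have "- (y * d * x) * x + (1 - y * d * y) * y - y * z = y * (1 - z - d * (x * x + y * y))"
      by (simp add: algebra_simps)
    then have bw: "- (y * d * x) * x + (1 - y * d * y) * y - y * z = 0" by (simp add: q)
    show ?thesis
      unfolding perp_frame_def norm_eq_1 f1 f2 unfolding \<omega> inner_vector3 e1
      using a b ab aw bw n
      by (intro conjI) (simp_all only: minus_mult_minus mult_minus_left mult_minus_right add_uminus_conv_diff)
  qed
qed

section \<open>The scattering curve\<close>

lemma mu_pos: "0 < E \<Longrightarrow> 0 < E' \<Longrightarrow> 0 < mu E' E"
  by (simp add: mu_def)

lemma mu_square: "0 < E \<Longrightarrow> 0 < E' \<Longrightarrow> (mu E' E)\<^sup>2 = E * (E' + 2) / (E' * (E + 2))"
  by (simp add: mu_def)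

text \<open>The exact factor E' - E is the source of the square root behaviour of \<open>nu\<close>
  at the diagonal.\<close>

lemma one_minus_mu_square:
  assumes "0 < E" "0 < E'"
  shows "1 - (mu E' E)\<^sup>2 = 2 * (E' - E) / (E' * (E + 2))"
  unfolding mu_square[OF assms] using assms by (simp add: divide_simps) (simp add: algebra_simps)

text \<open>The sine of the scattering angle whose cosine is \<open>mu\<close>.\<close>

definition nu :: "real \<Rightarrow> real \<Rightarrow> real" where
  "nu E' E = sqrt (1 - (mu E' E)\<^sup>2)"

definition muE :: "real \<Rightarrow> real \<Rightarrow> real" where
  "muE E' E = (E' + 2) / (E' * (E + 2)\<^sup>2 * mu E' E)"

text \<open>The energy derivative of \<open>nu\<close>, from mu^2 + nu^2 = 1; it blows up at the
  diagonal like 1 / nu.\<close>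

definition nuE :: "real \<Rightarrow> real \<Rightarrow> real" where
  "nuE E' E = - (mu E' E * muE E' E / nu E' E)"

lemma mu_le_1:
  assumes "0 < E" "E \<le> E'"
  shows "mu E' E \<le> 1"
proof -
  have "0 \<le> 1 - (mu E' E)\<^sup>2" using assms by (subst one_minus_mu_square) auto
  then show ?thesis using mu_pos[of E E'] assms by (simp add: abs_square_le_1)
qed

lemma nu_pos: "0 < E \<Longrightarrow> E < E' \<Longrightarrow> 0 < nu E' E"
  unfolding nu_def using one_minus_mu_square[of E E'] by simp

lemma nu_le_sqrt:
  assumes "0 < E0" "E0 \<le> E" "E \<le> E'"
  shows "nu E' E \<le> (1 / sqrt E0) * sqrt (E' - E)"
proof -
  have "2 * (E' - E) / (E' * (E + 2)) \<le> 2 * (E' - E) / (E0 * 2)"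
    using assms by (intro divide_left_mono mult_mono) auto
  also have "\<dots> = (E' - E) / E0" using assms(1) by (simp add: divide_simps)
  finally have "1 - (mu E' E)\<^sup>2 \<le> (E' - E) / E0"
    using assms by (subst one_minus_mu_square) auto
  then have "nu E' E \<le> sqrt ((E' - E) / E0)" by (simp add: nu_def)
  then show ?thesis by (simp add: real_sqrt_divide)
qed

lemma mu_derivative:
  assumes "0 < E" "0 < E'"
  shows "(mu E' has_real_derivative muE E' E) (at E within T)"
proof -
  let ?q = "\<lambda>E. E * (E' + 2) / (E' * (E + 2))"
  have "(?q has_real_derivative 2 * (E' + 2) / (E' * (E + 2)\<^sup>2)) (at E within T)"
    using assms by (auto intro!: derivative_eq_intros simp: divide_simps power2_eq_square) (simp add: algebra_simps)
  moreover have "0 < ?q E" using assms by simp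
  ultimately have "((\<lambda>E. sqrt (?q E)) has_real_derivative inverse (sqrt (?q E)) / 2 * (2 * (E' + 2) / (E' * (E + 2)\<^sup>2))) (at E within T)"
    by (intro DERIV_chain2[OF DERIV_real_sqrt])
  then show ?thesis
    unfolding mu_def[abs_def] muE_def by (rule DERIV_cong) (simp add: mu_def divide_simps)
qed

text \<open>Unlike \<open>nu\<close>, the function \<open>mu\<close> is differentiable across E =
  E', so the two-sided derivative exists on the diagonal.\<close>

lemma deriv_mu_diag: "0 < E \<Longrightarrow> deriv (mu E) E = muE E E"
  by (rule DERIV_imp_deriv, rule mu_derivative)

lemma nu_derivative:
  assumes "0 < E" "E < E'"
  shows "(nu E' has_real_derivative nuE E' E) (at E within T)"
proof -
  have p: "0 < 1 - (mu E' E)\<^sup>2" using assms by (subst one_minus_mu_square) auto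
  have "((\<lambda>E. 1 - (mu E' E)\<^sup>2) has_real_derivative - (2 * mu E' E * muE E' E)) (at E within T)"
    using assms by (auto intro!: derivative_eq_intros mu_derivative)
  with p have "((\<lambda>E. sqrt (1 - (mu E' E)\<^sup>2)) has_real_derivative inverse (sqrt (1 - (mu E' E)\<^sup>2)) / 2 * - (2 * mu E' E * muE E' E)) (at E within T)"
    by (intro DERIV_chain2[OF DERIV_real_sqrt])
  then show ?thesis
    unfolding nu_def[abs_def] nuE_def by (rule DERIV_cong) (simp add: nu_def divide_simps)
qed

definition cpt :: "real \<Rightarrow> real \<Rightarrow> r3 \<Rightarrow> r3 \<Rightarrow> r3" where
  "cpt E' E \<omega> e = mu E' E *\<^sub>R \<omega> + nu E' E *\<^sub>R e"

definition cvel :: "real \<Rightarrow> real \<Rightarrow> r3 \<Rightarrow> r3 \<Rightarrow> r3" where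
  "cvel E' E \<omega> e = muE E' E *\<^sub>R \<omega> + nuE E' E *\<^sub>R e"

lemma cpt_in_sphere:
  assumes "0 < E" "E \<le> E'" "norm \<omega> = 1" "norm e = 1" "e \<bullet> \<omega> = 0"
  shows "norm (cpt E' E \<omega> e) = 1"
proof -
  have m: "\<bar>mu E' E\<bar> \<le> 1" using mu_le_1[OF assms(1,2)] mu_pos[of E E'] assms by simp
  have "cos (arccos (mu E' E)) = mu E' E" "sin (arccos (mu E' E)) = nu E' E"
    using m by (auto simp: nu_def sin_arccos_abs)
  then show ?thesis
    using great_circle_in_sphere[OF assms(3-5), of "arccos (mu E' E)"] by (simp add: cpt_def)
qed

lemma cpt_derivative:
  assumes "0 < E" "E < E'"
  shows "((\<lambda>E. cpt E' E \<omega> e) has_vector_derivative cvel E' E \<omega> e) (at E within T)"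
  unfolding cpt_def cvel_def
  using mu_derivative[of E E' T] nu_derivative[OF assms, of T] assms
  by (intro has_vector_derivative_add has_vector_derivative_scaleR[where g'=0, simplified]) auto

text \<open>With \<open>mu = cos \<theta>\<close>, \<open>nu = sin \<theta>\<close> the velocity is \<open>\<theta>'(E) (- sin \<theta> \<omega> + cos \<theta> e)\<close>.\<close>

lemma cvel_eq:
  assumes "0 < E" "E < E'"
  shows "cvel E' E \<omega> e = - (muE E' E / nu E' E) *\<^sub>R (- nu E' E *\<^sub>R \<omega> + mu E' E *\<^sub>R e)"
  using nu_pos[OF assms] by (simp add: cvel_def nuE_def algebra_simps)

lemma gam_eq:
  fixes R :: "r3 \<Rightarrow> real^3^3"
  assumes "rotation_to R" "\<omega> \<in> S2"
  shows "gam R E' E \<omega> s = cpt E' E \<omega> (cos s *\<^sub>R (R \<omega> *v axis 1 1) + sin s *\<^sub>R (R \<omega> *v axis 2 1))"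
proof -
  have "R \<omega> *v axis 3 1 = \<omega>"
    using assms vector3_eq[of 0 0 1] by (auto simp: rotation_to_def)
  then show ?thesis
    by (simp add: gam_def cpt_def nu_def vector3_eq matrix_vector_right_distrib matrix_vector_mult_scaleR algebra_simps)
qed

lemma rotation_frame:
  fixes R :: "r3 \<Rightarrow> real^3^3"
  assumes "rotation_to R" "\<omega> \<in> S2"
  shows "perp_frame \<omega> (R \<omega> *v axis 1 1) (R \<omega> *v axis 2 1)"
proof -
  have "orthogonal_matrix (R \<omega>)" using assms by (auto simp: rotation_to_def rotation_matrix_def)
  then have "orthogonal_transformation ((*v) (R \<omega>))"
    by (simp add: orthogonal_transformation_matrix)
  then have i: "(R \<omega> *v x) \<bullet> (R \<omega> *v y) = x \<bullet> y" for x y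
    by (simp add: orthogonal_transformation_def)
  have "R \<omega> *v axis 3 1 = \<omega>"
    using assms vector3_eq[of 0 0 1] by (auto simp: rotation_to_def)
  then show ?thesis
    using i[of "axis 1 1" "axis 3 1"] i[of "axis 2 1" "axis 3 1"] assms(2)[simplified, folded norm_eq_1]
    by (simp add: perp_frame_def norm_eq_1 i inner_axis_axis)
qed


section \<open>The finite part integrals at a fixed point\<close>

lemma compact_bound:
  fixes f :: "'a::topological_space \<Rightarrow> real"
  assumes "compact K" "continuous_on K f"
  shows "\<exists>B. \<forall>z\<in>K. \<bar>f z\<bar> \<le> B"
  using bdd_above_abs_compact[OF assms] unfolding bdd_above_def by blast

text \<open>Deliberately asymmetric: the first factor is bounded at the running point, the second at
  the limit point.\<close>

lemma hoelder_mult: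
  fixes A B :: real
  assumes "\<bar>A - A0\<bar> \<le> c1 * r" "\<bar>B - B0\<bar> \<le> c2 * r" "\<bar>A\<bar> \<le> m1" "\<bar>B0\<bar> \<le> m2" "0 \<le> c2 * r"
  shows "\<bar>A * B - A0 * B0\<bar> \<le> (m1 * c2 + c1 * m2) * r"
proof -
  have "0 \<le> c1 * r" using assms(1) abs_ge_zero order_trans by blast
  have "A * B - A0 * B0 = A * (B - B0) + (A - A0) * B0" by (simp add: algebra_simps)
  then have "\<bar>A * B - A0 * B0\<bar> \<le> \<bar>A\<bar> * \<bar>B - B0\<bar> + \<bar>A - A0\<bar> * \<bar>B0\<bar>"
    by (metis abs_mult abs_triangle_ineq)
  also have "\<dots> \<le> m1 * (c2 * r) + (c1 * r) * m2"
    using assms \<open>0 \<le> c1 * r\<close> by (intro add_mono mult_mono) auto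
  finally show ?thesis by (simp add: algebra_simps)
qed

text \<open>The finite part sees the integrand only to the left of \<open>x\<close>, which permits
  the substitution of formulas valid below the diagonal only.\<close>

lemma half_Hoelder_cong:
  assumes "half_Hoelder a x g L C" "\<And>t. t \<in> {a..<x} \<Longrightarrow> f t = g t"
  shows "half_Hoelder a x f L C" "pf_left1 a x f = pf_left1 a x g"
proof -
  interpret g: half_Hoelder a x g L C by fact
  have "(\<lambda>t. indicator {a..<x} t *\<^sub>R f t) = (\<lambda>t. indicator {a..<x} t *\<^sub>R g t)"
    using assms(2) by (auto simp: indicator_def)
  then show f: "half_Hoelder a x f L C"
    using g.ax g.meas g.hoelder assms(2) by unfold_locales (auto simp: set_borel_measurable_def)
  interpret f: half_Hoelder a x f L C by (rule f)
  have "(LINT t:{a..<x}|lborel. (f t - L) / (x - t)) = (LINT t:{a..<x}|lborel. (g t - L) / (x - t))"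
    using assms(2) by (intro set_lebesgue_integral_cong) auto
  then show "pf_left1 a x f = pf_left1 a x g" by (simp add: f.pf_left1_eq g.pf_left1_eq)
qed

lemma half_Hoelder_continuous:
  assumes "a < x" "continuous_on {a..<x} f" "\<And>t. t \<in> {a..<x} \<Longrightarrow> \<bar>f t - L\<bar> \<le> C * sqrt (x - t)"
  shows "half_Hoelder a x f L C"
  using assms borel_measurable_continuous_on_indicator[of "{a..<x}" f]
  by unfold_locales (auto simp: set_borel_measurable_def)

lemma mu_continuous:
  assumes "0 < E0"
  shows "continuous_on ({E0..} \<times> {E0..}) (\<lambda>(E', E). mu E' E)"
  unfolding mu_def case_prod_unfold using assms by (intro continuous_intros) auto

lemma muE_continuous:
  assumes "0 < E0"
  shows "continuous_on ({E0..} \<times> {E0..}) (\<lambda>(E', E). muE E' E)"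
  unfolding muE_def case_prod_unfold using assms mu_pos
  by (intro continuous_intros mu_continuous[OF assms, unfolded case_prod_unfold])
    (auto simp: less_imp_neq[OF mu_pos, symmetric])

text \<open>The derivative of \<open>muE\<close> in its second argument is continuous on the compact
  energy square, where \<open>mu\<close> stays positive; the mean value inequality then gives one
  constant for all E'.\<close>

lemma muE_Lipschitz:
  assumes "0 < E0"
  shows "\<exists>C\<ge>0. \<forall>E'\<in>{E0..Em}. \<forall>E\<in>{E0..Em}. \<bar>muE E' E\<bar> \<le> C \<and> \<bar>muE E' E - muE E' E'\<bar> \<le> C * \<bar>E - E'\<bar>"
proof -
  let ?I = "{E0..Em} \<times> {E0..Em}"
  let ?d = "\<lambda>(E', E). - ((E' + 2) * (E' * (2 * (E + 2)) * mu E' E + E' * (E + 2)\<^sup>2 * muE E' E) / (E' * (E + 2)\<^sup>2 * mu E' E)\<^sup>2)"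
  have c: "continuous_on ?I (\<lambda>(E', E). mu E' E)" "continuous_on ?I (\<lambda>(E', E). muE E' E)"
    by (rule continuous_on_subset[OF mu_continuous[OF assms]] continuous_on_subset[OF muE_continuous[OF assms]]; auto)+
  have "continuous_on ?I ?d"
    unfolding case_prod_unfold using assms
    by (intro continuous_intros c[unfolded case_prod_unfold]) (auto simp: less_imp_neq[OF mu_pos, symmetric])
  then have "\<exists>B. \<forall>z\<in>?I. \<bar>?d z\<bar> \<le> B" by (intro compact_bound compact_Times compact_Icc)
  then obtain C1 where C1: "\<And>z. z \<in> ?I \<Longrightarrow> \<bar>?d z\<bar> \<le> C1" by blast
  have "\<exists>B. \<forall>z\<in>?I. \<bar>(\<lambda>(E', E). muE E' E) z\<bar> \<le> B" by (intro compact_bound compact_Times compact_Icc c)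
  then obtain C2 where C2: "\<And>z. z \<in> ?I \<Longrightarrow> \<bar>(\<lambda>(E', E). muE E' E) z\<bar> \<le> C2" by blast
  have der: "(muE E' has_real_derivative ?d (E', E)) (at E within {E0..Em})" if "E' \<in> {E0..Em}" "E \<in> {E0..Em}" for E' E
  proof -
    have "0 < E" "0 < E'" using that assms by auto
    note mu = mu_derivative[OF this] mu_pos[OF this]
    have d: "((\<lambda>E. E' * (E + 2)\<^sup>2 * mu E' E) has_real_derivative
        E' * (2 * (E + 2)) * mu E' E + E' * (E + 2)\<^sup>2 * muE E' E) (at E within {E0..Em})"
      by (auto intro!: derivative_eq_intros mu(1))
    have nz: "E' * (E + 2)\<^sup>2 * mu E' E \<noteq> 0" using mu(2) \<open>0 < E\<close> \<open>0 < E'\<close> by auto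
    have eq: "(\<lambda>E. (E' + 2) / (E' * (E + 2)\<^sup>2 * mu E' E)) = muE E'"
      by (simp add: muE_def fun_eq_iff)
    have "((\<lambda>E. (E' + 2) / (E' * (E + 2)\<^sup>2 * mu E' E)) has_real_derivative ?d (E', E)) (at E within {E0..Em})"
      by (rule DERIV_cong[OF DERIV_divide[OF DERIV_const d nz]])
        (simp add: power2_eq_square[of "E' * (E + 2)\<^sup>2 * mu E' E"])
    then show ?thesis unfolding eq .
  qed
  have L: "\<bar>muE E' E - muE E' E'\<bar> \<le> C1 * \<bar>E - E'\<bar>" if "E' \<in> {E0..Em}" "E \<in> {E0..Em}" for E' E
    using field_differentiable_bound[OF convex_real_interval(5)[of E0 Em], of "muE E'" "\<lambda>E. ?d (E', E)" C1 E E'] that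
      der[OF that(1)] C1 by auto
  show ?thesis
    using L C1 C2 by (intro exI[of _ "max 0 (max C1 C2)"]) (force intro: order_trans[OF L] mult_right_mono simp: le_max_iff_disj)
qed

section \<open>Uniform rates for the three summands of the energy derivative\<close>

locale scattering =
  fixes G :: "r3 set" and E0 Em :: real and v :: "r3 \<Rightarrow> r3 \<Rightarrow> real \<Rightarrow> real" and h :: "r3 \<Rightarrow> real \<Rightarrow> real \<Rightarrow> real"
  assumes E0: "0 < E0" and E0m: "E0 < Em" and bG: "bounded G"
    and v: "C123 G E0 Em v" and h: "C0k G E0 Em 2 h"
    and v0: "\<And>x \<omega>. x \<in> closure G \<Longrightarrow> \<omega> \<in> S2 \<Longrightarrow> v x \<omega> E0 = 0"
begin

abbreviation "K \<equiv> closure G"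
abbreviation "I \<equiv> {E0..Em}"
abbreviation "J \<equiv> jet E0 Em v"
abbreviation "H \<equiv> sjet E0 Em h"

lemma compact_K: "compact K" using bG by (simp add: compact_closure)

text \<open>Only finitely many jets occur, each continuous on a compact set, so a single constant
  serves for all of them.\<close>

lemma jets_bounded:
  "\<exists>B\<ge>0. (\<forall>j\<le>2. \<forall>is. length is \<le> 3 \<longrightarrow> (\<forall>x\<in>K. \<forall>\<omega>\<in>S2. \<forall>E\<in>I. \<bar>J j is x \<omega> E\<bar> \<le> B))
    \<and> (\<forall>j\<le>2. \<forall>x\<in>K. \<forall>E'\<in>I. \<forall>E\<in>I. \<bar>H j x E' E\<bar> \<le> B)"
proof -
  let ?P = "{..2::nat} \<times> {is::3 list. length is \<le> 3}"
  have fin: "finite ?P"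
    using finite_lists_length_le[of "UNIV::3 set" 3] by (intro finite_cartesian_product) auto
  have "\<exists>B. \<forall>z\<in>K \<times> S2 \<times> I. \<bar>case z of (x, \<omega>, E) \<Rightarrow> J j is x \<omega> E\<bar> \<le> B" if "(j, is) \<in> ?P" for j "is"
    using that by (intro compact_bound compact_Times compact_K jet_continuous[OF v E0m]) auto
  then obtain b where b: "\<And>j is z. (j, is) \<in> ?P \<Longrightarrow> z \<in> K \<times> S2 \<times> I \<Longrightarrow> \<bar>case z of (x, \<omega>, E) \<Rightarrow> J j is x \<omega> E\<bar> \<le> b j is"
    by metis
  have "\<exists>B. \<forall>z\<in>K \<times> I \<times> I. \<bar>case z of (x, E', E) \<Rightarrow> H j x E' E\<bar> \<le> B" if "j \<le> 2" for j
    using that by (intro compact_bound compact_Times compact_K sjet_continuous[OF h E0m]) auto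
  then obtain c where c: "\<And>j z. j \<le> 2 \<Longrightarrow> z \<in> K \<times> I \<times> I \<Longrightarrow> \<bar>case z of (x, E', E) \<Rightarrow> H j x E' E\<bar> \<le> c j"
    by metis
  define B where "B = (\<Sum>p\<in>?P. \<bar>b (fst p) (snd p)\<bar>) + (\<Sum>j\<le>2. \<bar>c j\<bar>)"
  have B1: "b j is \<le> B" if "(j, is) \<in> ?P" for j "is"
  proof -
    have "\<bar>b j is\<bar> \<le> (\<Sum>p\<in>?P. \<bar>b (fst p) (snd p)\<bar>)"
      using member_le_sum[OF that _ fin, of "\<lambda>p. \<bar>b (fst p) (snd p)\<bar>"] by simp
    moreover have "0 \<le> (\<Sum>j\<le>2. \<bar>c j\<bar>)" by (intro sum_nonneg) auto
    ultimately show ?thesis unfolding B_def by linarith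
  qed
  have B2: "c j \<le> B" if "j \<le> 2" for j
  proof -
    have "\<bar>c j\<bar> \<le> (\<Sum>j\<le>2. \<bar>c j\<bar>)" using that by (intro member_le_sum) auto
    moreover have "0 \<le> (\<Sum>p\<in>?P. \<bar>b (fst p) (snd p)\<bar>)" by (intro sum_nonneg) auto
    ultimately show ?thesis unfolding B_def by linarith
  qed
  have "0 \<le> B" unfolding B_def by (intro add_nonneg_nonneg sum_nonneg) auto
  moreover have "\<bar>J j is x \<omega> E\<bar> \<le> B" if "j \<le> 2" "length is \<le> 3" "x \<in> K" "\<omega> \<in> S2" "E \<in> I" for j "is" x \<omega> E
    using order_trans[OF b[of j "is" "(x, \<omega>, E)"] B1[of j "is"]] that by simp
  moreover have "\<bar>H j x E' E\<bar> \<le> B" if "j \<le> 2" "x \<in> K" "E' \<in> I" "E \<in> I" for j x E' E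
    using order_trans[OF c[of j "(x, E', E)"] B2[of j]] that by simp
  ultimately show ?thesis by blast
qed

text \<open>The energy occurs in the circle average of \<open>v\<close> twice, as an argument of
  \<open>v\<close> and through the moving circle: the first dependence is differentiated in
  \<open>V 1\<close>, the second in \<open>W\<close>.\<close>

definition V :: "nat \<Rightarrow> r3 \<Rightarrow> r3 \<Rightarrow> r3 \<Rightarrow> r3 \<Rightarrow> real \<Rightarrow> real \<Rightarrow> real" where
  "V j x \<omega> a b E' E = circle_int (\<lambda>e. J j [] x (cpt E' E \<omega> e) E) a b"

definition W :: "r3 \<Rightarrow> r3 \<Rightarrow> r3 \<Rightarrow> r3 \<Rightarrow> real \<Rightarrow> real \<Rightarrow> real" where
  "W x \<omega> a b E' E = circle_int (\<lambda>e. sphere_grad (\<lambda>\<xi>. v x \<xi> E) (cpt E' E \<omega> e) \<bullet> cvel E' E \<omega> e) a b"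

text \<open>The numbers refer to the six terms of the claimed identity. \<open>f1\<close>,
  \<open>f3\<close>, \<open>f5\<close> are the product rule summands of the energy derivative of
  \<open>h\<close> times \<open>V 0\<close> and produce the first, third and fifth term; their
  limits \<open>L1\<close>, \<open>L3\<close>, \<open>L5\<close> at the diagonal produce the term
  following each.\<close>

definition f1 where "f1 x \<omega> a b E' E = H 0 x E' E * V 1 x \<omega> a b E' E"
definition f3 where "f3 x \<omega> a b E' E = H 0 x E' E * W x \<omega> a b E' E"
definition f5 where "f5 x \<omega> a b E' E = H 1 x E' E * V 0 x \<omega> a b E' E"
definition L1 where "L1 x \<omega> E' = H 0 x E' E' * (2 * pi * J 1 [] x \<omega> E')"
definition L3 where "L3 x \<omega> E' = H 0 x E' E' * (- (muE E' E' * (pi * (\<Sum>i\<in>UNIV. J 0 [i, i] x \<omega> E'))))"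
definition L5 where "L5 x \<omega> E' = H 1 x E' E' * (2 * pi * J 0 [] x \<omega> E')"

lemma J_Lipschitz:
  assumes "0 \<le> B" "\<And>E. E \<in> I \<Longrightarrow> \<bar>J (Suc j) is x \<omega> E\<bar> \<le> B"
    and "j < 2" "length is \<le> 3" "x \<in> K" "\<omega> \<in> S2" "E \<in> I" "E' \<in> I"
  shows "\<bar>J j is x \<omega> E - J j is x \<omega> E'\<bar> \<le> B * \<bar>E - E'\<bar>"
  using field_differentiable_bound[OF convex_real_interval(5)[of E0 Em], of "J j is x \<omega>" "J (Suc j) is x \<omega>" B E E']
    jet_derivative[OF v] assms by auto

lemma H_Lipschitz:
  assumes "0 \<le> B" "\<And>E. E \<in> I \<Longrightarrow> \<bar>H (Suc j) x E' E\<bar> \<le> B"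
    and "j < 2" "x \<in> K" "E \<in> I" "E' \<in> I"
  shows "\<bar>H j x E' E - H j x E' E'\<bar> \<le> B * \<bar>E - E'\<bar>"
  using field_differentiable_bound[OF convex_real_interval(5)[of E0 Em], of "H j x E'" "H (Suc j) x E'" B E E']
    sjet_derivative[OF h E0m] assms by auto

lemma cpt_S2:
  assumes "perp_frame \<omega> a b" "E \<in> {E0..E'}"
  shows "cpt E' E \<omega> (cos s *\<^sub>R a + sin s *\<^sub>R b) \<in> S2"
  using cpt_in_sphere[of E E' \<omega>, OF _ _ _ perp_frame_direction[OF assms(1)]] assms E0
  by (auto simp: perp_frame_def)

lemma mu_cont_E: "E' \<in> I \<Longrightarrow> continuous_on {E0..E'} (mu E')"
  by (rule continuous_on_compose2[OF mu_continuous[OF E0], where f="\<lambda>E. (E', E)", simplified])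
    (auto intro!: continuous_intros)

lemma muE_cont_E: "E' \<in> I \<Longrightarrow> continuous_on {E0..E'} (muE E')"
  by (rule continuous_on_compose2[OF muE_continuous[OF E0], where f="\<lambda>E. (E', E)", simplified])
    (auto intro!: continuous_intros)

lemma nu_cont_E: "E' \<in> I \<Longrightarrow> continuous_on {E0..E'} (nu E')"
  unfolding nu_def by (intro continuous_intros mu_cont_E)

lemma nuE_cont_E: "E' \<in> I \<Longrightarrow> continuous_on {E0..<E'} (nuE E')"
  unfolding nuE_def
  by (intro continuous_intros continuous_on_subset[OF mu_cont_E[of E']] continuous_on_subset[OF muE_cont_E[of E']]
    continuous_on_subset[OF nu_cont_E[of E']]) (use nu_pos[of _ E'] E0 in \<open>auto simp: less_imp_neq[OF nu_pos, symmetric]\<close>)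

lemma cpt_cont:
  assumes "E' \<in> I"
  shows "continuous_on ({E0..E'} \<times> UNIV) (\<lambda>(E, s). cpt E' E \<omega> (cos s *\<^sub>R a + sin s *\<^sub>R b))"
  unfolding cpt_def case_prod_unfold
  by (intro continuous_intros continuous_on_compose2[OF mu_cont_E[OF assms]] continuous_on_compose2[OF nu_cont_E[OF assms]]) auto

lemma cvel_cont:
  assumes "E' \<in> I"
  shows "continuous_on ({E0..<E'} \<times> UNIV) (\<lambda>(E, s). cvel E' E \<omega> (cos s *\<^sub>R a + sin s *\<^sub>R b))"
  unfolding cvel_def case_prod_unfold
  by (intro continuous_intros continuous_on_compose2[OF muE_cont_E[OF assms]] continuous_on_compose2[OF nuE_cont_E[OF assms]]) auto

lemma J_cpt_cont:
  assumes "E' \<in> I" "x \<in> K" "j \<le> 2" "length is \<le> 3" "perp_frame \<omega> a b"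
  shows "continuous_on ({E0..E'} \<times> UNIV) (\<lambda>(E, s). J j is x (cpt E' E \<omega> (cos s *\<^sub>R a + sin s *\<^sub>R b)) E)"
proof -
  have "continuous_on ({E0..E'} \<times> UNIV) (\<lambda>z. (\<lambda>(x, \<omega>, E). J j is x \<omega> E) (x, (\<lambda>(E, s). cpt E' E \<omega> (cos s *\<^sub>R a + sin s *\<^sub>R b)) z, fst z))"
    by (rule continuous_on_compose2[OF jet_continuous[OF v E0m assms(3,4)]])
      (use assms cpt_S2[OF assms(5)] in \<open>auto intro!: continuous_intros cpt_cont\<close>)
  then show ?thesis by (simp add: case_prod_unfold)
qed

lemma grad_cpt_cont:
  assumes "E' \<in> I" "x \<in> K" "perp_frame \<omega> a b"
  shows "continuous_on ({E0..<E'} \<times> UNIV) (\<lambda>(E, s). sphere_grad (\<lambda>\<xi>. v x \<xi> E) (cpt E' E \<omega> (cos s *\<^sub>R a + sin s *\<^sub>R b))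
    \<bullet> cvel E' E \<omega> (cos s *\<^sub>R a + sin s *\<^sub>R b))"
proof -
  have g: "sphere_grad (\<lambda>\<xi>. v x \<xi> E) \<xi> $ i = J 0 [i] x \<xi> E" for E \<xi> i
    by (simp add: jet_def)
  show ?thesis
    unfolding inner_vec_def g case_prod_unfold inner_real_def
    by (intro continuous_intros continuous_on_subset[OF J_cpt_cont[OF assms(1,2), unfolded case_prod_unfold]]
      cvel_cont[OF assms(1), unfolded case_prod_unfold]) (use assms in auto)
qed

lemma circle_int_continuous:
  assumes c: "continuous_on (U \<times> UNIV) (\<lambda>(E, s). \<Phi> E (cos s *\<^sub>R a + sin s *\<^sub>R b))"
  shows "continuous_on U (\<lambda>E. circle_int (\<Phi> E) a b)"
proof -
  have "continuous_on U (\<lambda>E. integral (cbox 0 (2*pi)) (\<lambda>s. \<Phi> E (cos s *\<^sub>R a + sin s *\<^sub>R b)))"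
    by (intro integral_continuous_on_param continuous_on_subset[OF c]) auto
  moreover have "circle_int (\<Phi> E) a b = integral (cbox 0 (2*pi)) (\<lambda>s. \<Phi> E (cos s *\<^sub>R a + sin s *\<^sub>R b))" if "E \<in> U" for E
    unfolding cbox_interval
    by (intro circle_int_eq_integral continuous_on_compose2[OF c, where f="\<lambda>s. (E, s)", simplified])
      (use that in \<open>auto intro!: continuous_intros\<close>)
  ultimately show ?thesis by (simp cong: continuous_on_cong)
qed

lemma V_cont:
  assumes "E' \<in> I" "x \<in> K" "j \<le> 2" "perp_frame \<omega> a b"
  shows "continuous_on {E0..E'} (V j x \<omega> a b E')"
  unfolding V_def using assms by (intro circle_int_continuous J_cpt_cont) auto

lemma W_cont:
  assumes "E' \<in> I" "x \<in> K" "perp_frame \<omega> a b"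
  shows "continuous_on {E0..<E'} (W x \<omega> a b E')"
  unfolding W_def using assms by (intro circle_int_continuous grad_cpt_cont) auto

lemma H_cont:
  assumes "E' \<in> I" "x \<in> K" "j \<le> 2"
  shows "continuous_on {E0..E'} (H j x E')"
proof -
  have "continuous_on {E0..E'} (\<lambda>E. (\<lambda>(x, E', E). H j x E' E) (x, E', E))"
    by (rule continuous_on_compose2[OF sjet_continuous[OF h E0m assms(3)]])
      (use assms in \<open>auto intro!: continuous_intros\<close>)
  then show ?thesis by simp
qed

text \<open>The constant precedes all other quantifiers because the integrals over phase space
  require a majorant that is uniform in the point, the direction, the energy and the frame.\<close>

lemma half_Hoelder_terms:
  "\<exists>C. \<forall>x\<in>K. \<forall>\<omega>\<in>S2. \<forall>E'\<in>{E0<..Em}. \<forall>a b. perp_frame \<omega> a b \<longrightarrow>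
     half_Hoelder E0 E' (f1 x \<omega> a b E') (L1 x \<omega> E') C \<and>
     half_Hoelder E0 E' (f3 x \<omega> a b E') (L3 x \<omega> E') C \<and>
     half_Hoelder E0 E' (f5 x \<omega> a b E') (L5 x \<omega> E') C"
proof -
  obtain B where B: "0 \<le> B \<and> (\<forall>j\<le>2. \<forall>is. length is \<le> 3 \<longrightarrow> (\<forall>x\<in>K. \<forall>\<omega>\<in>S2. \<forall>E\<in>I. \<bar>J j is x \<omega> E\<bar> \<le> B))
    \<and> (\<forall>j\<le>2. \<forall>x\<in>K. \<forall>E'\<in>I. \<forall>E\<in>I. \<bar>H j x E' E\<bar> \<le> B)"
    using jets_bounded by (elim exE)
  then have B0: "0 \<le> B"
    and BJ: "\<And>j is x \<omega> E. j \<le> 2 \<Longrightarrow> length is \<le> 3 \<Longrightarrow> x \<in> K \<Longrightarrow> \<omega> \<in> S2 \<Longrightarrow> E \<in> I \<Longrightarrow> \<bar>J j is x \<omega> E\<bar> \<le> B"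
    and BH: "\<And>j x E E'. j \<le> 2 \<Longrightarrow> x \<in> K \<Longrightarrow> E \<in> I \<Longrightarrow> E' \<in> I \<Longrightarrow> \<bar>H j x E' E\<bar> \<le> B"
    by simp_all
  obtain C where "0 \<le> C \<and> (\<forall>E'\<in>I. \<forall>E\<in>I. \<bar>muE E' E\<bar> \<le> C \<and> \<bar>muE E' E - muE E' E'\<bar> \<le> C * \<bar>E - E'\<bar>)"
    using muE_Lipschitz[OF E0, of Em] by (elim exE)
  then have C0: "0 \<le> C" and Cb: "\<And>E' E. E' \<in> I \<Longrightarrow> E \<in> I \<Longrightarrow> \<bar>muE E' E\<bar> \<le> C"
    and CL: "\<And>E' E. E' \<in> I \<Longrightarrow> E \<in> I \<Longrightarrow> \<bar>muE E' E - muE E' E'\<bar> \<le> C * \<bar>E - E'\<bar>"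
    by simp_all
  \<comment> \<open>The price of weakening a Lipschitz bound in |E - E'| to the rate sqrt (E' -
    E).\<close>
  define D where "D = sqrt (Em - E0)"
  define N where "N = 1 / sqrt E0"
  have D0: "0 \<le> D" and N0: "0 \<le> N" using E0 E0m by (auto simp: D_def N_def)
  have Dr: "\<bar>E - E'\<bar> \<le> D * sqrt (E' - E)" if "E' \<in> I" "E \<in> {E0..<E'}" for E E'
  proof -
    have "\<bar>E - E'\<bar> = sqrt (E' - E) * sqrt (E' - E)" using that by simp
    also have "\<dots> \<le> D * sqrt (E' - E)"
      unfolding D_def using that by (intro mult_right_mono) auto
    finally show ?thesis .
  qed
  have Nr: "nu E' E \<le> N * sqrt (E' - E)" if "E' \<in> I" "E \<in> {E0..<E'}" for E E'
    using nu_le_sqrt[of E0 E E'] that E0 by (auto simp: N_def)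
  have HL: "\<bar>H j x E' E - H j x E' E'\<bar> \<le> (B * D) * sqrt (E' - E)"
    if "j \<le> 1" "x \<in> K" "E' \<in> I" "E \<in> {E0..<E'}" for j x E E'
  proof -
    have "\<bar>H j x E' E - H j x E' E'\<bar> \<le> B * \<bar>E - E'\<bar>"
      using that by (intro H_Lipschitz B0 BH) auto
    also have "\<dots> \<le> B * (D * sqrt (E' - E))" using that by (intro mult_left_mono Dr B0)
    finally show ?thesis by simp
  qed
  have JL: "\<bar>J j is x \<omega> E - J j is x \<omega> E'\<bar> \<le> (B * D) * sqrt (E' - E)"
    if "j \<le> 1" "length is \<le> 3" "x \<in> K" "\<omega> \<in> S2" "E' \<in> I" "E \<in> {E0..<E'}" for j "is" x \<omega> E E'
  proof -
    have "\<bar>J j is x \<omega> E - J j is x \<omega> E'\<bar> \<le> B * \<bar>E - E'\<bar>"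
      using that by (intro J_Lipschitz B0 BJ) auto
    also have "\<dots> \<le> B * (D * sqrt (E' - E))" using that by (intro mult_left_mono Dr B0)
    finally show ?thesis by simp
  qed
  have mu01: "0 \<le> mu E' E" "mu E' E \<le> 1" if "E \<in> {E0..<E'}" for E E'
    using mu_pos[of E E'] mu_le_1[of E E'] that E0 by auto
  have nueq: "nu E' E = sqrt (1 - (mu E' E)\<^sup>2)" for E E' by (simp add: nu_def)
  have Jsgd: "sgD is (\<lambda>\<xi>. v x \<xi> E) \<omega> = J 0 is x \<omega> E" for "is" x E \<omega> by (simp add: jet_def)
  \<comment> \<open>The average is first compared with the value at the centre of the circle at the
    same energy, with an error of order \<open>nu\<close>; then the energy is moved to E'.\<close>
  have VL: "\<bar>V j x \<omega> a b E' E - 2 * pi * J j [] x \<omega> E'\<bar> \<le> (2 * pi * (9 * B * N + B * D)) * sqrt (E' - E)"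
    if "j \<le> 1" "x \<in> K" "\<omega> \<in> S2" "E' \<in> I" "E \<in> {E0..<E'}" "perp_frame \<omega> a b" for j x \<omega> E E' a b
  proof -
    have EI: "E \<in> I" using that by auto
    have "Ck_sphere 3 (\<lambda>\<omega>. J j [] x \<omega> E)"
      using jet_Ck_sphere[OF v that(2), of j "[]" E] that(1) EI by simp
    then have "Ck_sphere 1 (\<lambda>\<omega>. J j [] x \<omega> E)"
      using Ck_sphere_mono_Suc by (simp only: numeral_3_eq_3 One_nat_def)
    then have "\<bar>V j x \<omega> a b E' E - 2 * pi * J j [] x \<omega> E\<bar> \<le> 2 * pi * (9 * B * nu E' E)"
      unfolding V_def cpt_def
      by (intro circle_mean_first_order mu01 nueq that) (use that EI in \<open>auto simp: jet_sphere_grad intro!: BJ\<close>)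
    also have "\<dots> \<le> 2 * pi * (9 * B * (N * sqrt (E' - E)))"
      using Nr that B0 by (intro mult_left_mono) auto
    finally have "\<bar>V j x \<omega> a b E' E - 2 * pi * J j [] x \<omega> E\<bar> \<le> 2 * pi * (9 * B * N) * sqrt (E' - E)" by simp
    moreover have "\<bar>2 * pi * J j [] x \<omega> E - 2 * pi * J j [] x \<omega> E'\<bar> \<le> 2 * pi * (B * D) * sqrt (E' - E)"
      using mult_left_mono[OF JL[OF that(1) _ that(2-5), of "[]"], of "2 * pi"]
      by (simp add: abs_mult right_diff_distrib[symmetric] mult.assoc)
    ultimately have "\<bar>V j x \<omega> a b E' E - 2 * pi * J j [] x \<omega> E'\<bar>
      \<le> 2 * pi * (9 * B * N) * sqrt (E' - E) + 2 * pi * (B * D) * sqrt (E' - E)" by linarith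
    then show ?thesis by (simp add: algebra_simps)
  qed
  define lp where "lp = (\<lambda>x \<omega> E. \<Sum>i\<in>UNIV. J 0 [i, i] x \<omega> E)"
  have lpb: "\<bar>lp x \<omega> E\<bar> \<le> 3 * B" if "x \<in> K" "\<omega> \<in> S2" "E \<in> I" for x \<omega> E
  proof -
    have "\<bar>lp x \<omega> E\<bar> \<le> (\<Sum>i\<in>(UNIV::3 set). B)"
      unfolding lp_def using that by (intro order_trans[OF sum_abs] sum_mono BJ) auto
    then show ?thesis by simp
  qed
  have lpL: "\<bar>lp x \<omega> E - lp x \<omega> E'\<bar> \<le> (3 * (B * D)) * sqrt (E' - E)"
    if "x \<in> K" "\<omega> \<in> S2" "E' \<in> I" "E \<in> {E0..<E'}" for x \<omega> E E'
  proof -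
    have "\<bar>lp x \<omega> E - lp x \<omega> E'\<bar> \<le> (\<Sum>i\<in>(UNIV::3 set). (B * D) * sqrt (E' - E))"
      unfolding lp_def sum_subtractf[symmetric]
      using that by (intro order_trans[OF sum_abs] sum_mono JL) auto
    then show ?thesis by simp
  qed
  \<comment> \<open>The first summand comes from the remainder of the gradient average after
    division by \<open>nu\<close>, the second from moving the product of \<open>muE\<close> and the
    Laplacian from E to E'.\<close>
  define CW where "CW = 2 * pi * 288 * B * C * N + pi * (C * (3 * (B * D)) + C * D * (3 * B))"
  have WL: "\<bar>W x \<omega> a b E' E - - (muE E' E' * (pi * lp x \<omega> E'))\<bar> \<le> CW * sqrt (E' - E)"
    if "x \<in> K" "\<omega> \<in> S2" "E' \<in> I" "E \<in> {E0..<E'}" "perp_frame \<omega> a b" for x \<omega> E E' a b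
  proof -
    have EI: "E \<in> I" and E: "0 < E" "E < E'" using that E0 by auto
    have n: "0 < nu E' E" by (rule nu_pos[OF E])
    define Jc where "Jc = circle_int (\<lambda>e. sphere_grad (\<lambda>\<xi>. v x \<xi> E) (mu E' E *\<^sub>R \<omega> + nu E' E *\<^sub>R e)
      \<bullet> (- nu E' E *\<^sub>R \<omega> + mu E' E *\<^sub>R e)) a b"
    have "Ck_sphere 3 (\<lambda>\<omega>. v x \<omega> E)"
      using jet_Ck_sphere[OF v that(1), of 0 "[]" E] EI by simp
    then have "\<bar>Jc - nu E' E * (pi * lap (\<lambda>\<xi>. v x \<xi> E) \<omega>)\<bar> \<le> 2 * pi * (288 * B * (nu E' E)\<^sup>2)"
      unfolding Jc_def using that EI
      by (intro circle_gradient_mean mu01 nueq) (auto simp: Jsgd intro!: BJ)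
    then have J1: "\<bar>Jc - nu E' E * (pi * lp x \<omega> E)\<bar> \<le> 2 * pi * (288 * B * (nu E' E)\<^sup>2)"
      unfolding lap_def Jsgd lp_def .
    have "W x \<omega> a b E' E = - (muE E' E / nu E' E) * Jc"
      unfolding W_def Jc_def cvel_eq[OF E] cpt_def inner_scaleR_right circle_int_def
      by (rule set_integral_mult_right)
    then have "W x \<omega> a b E' E - - (muE E' E * (pi * lp x \<omega> E)) = - (muE E' E / nu E' E) * (Jc - nu E' E * (pi * lp x \<omega> E))"
      using n by (simp add: field_simps)
    then have "\<bar>W x \<omega> a b E' E - - (muE E' E * (pi * lp x \<omega> E))\<bar> = \<bar>muE E' E\<bar> / nu E' E * \<bar>Jc - nu E' E * (pi * lp x \<omega> E)\<bar>"
      using n by (simp add: abs_mult abs_divide)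
    also have "\<dots> \<le> \<bar>muE E' E\<bar> / nu E' E * (2 * pi * (288 * B * (nu E' E)\<^sup>2))"
      using n by (intro mult_left_mono J1) auto
    \<comment> \<open>Here the division by \<open>nu\<close> uses up one of the two powers in the
      remainder, which leaves the exponent 1/2.\<close>
    also have "\<dots> = \<bar>muE E' E\<bar> * (2 * pi * (288 * B * nu E' E))"
      using n by (simp add: power2_eq_square field_simps)
    also have "\<dots> \<le> C * (2 * pi * (288 * B * (N * sqrt (E' - E))))"
      using n B0 Cb[OF that(3) EI] Nr[OF that(3,4)] by (intro mult_mono) auto
    finally have 1: "\<bar>W x \<omega> a b E' E - - (muE E' E * (pi * lp x \<omega> E))\<bar> \<le> 2 * pi * 288 * B * C * N * sqrt (E' - E)"
      by (simp add: mult_ac)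
    have "\<bar>muE E' E - muE E' E'\<bar> \<le> C * (D * sqrt (E' - E))"
      using CL[OF that(3) EI] mult_left_mono[OF Dr[OF that(3,4)] C0] by linarith
    then have "\<bar>muE E' E * lp x \<omega> E - muE E' E' * lp x \<omega> E'\<bar> \<le> (C * (3 * (B * D)) + C * D * (3 * B)) * sqrt (E' - E)"
      using lpL[OF that(1-4)] Cb[OF that(3) EI] lpb[OF that(1-3)] B0 D0 that(4)
      by (intro hoelder_mult) auto
    from mult_left_mono[OF this, of pi]
    have "\<bar>pi * (muE E' E * lp x \<omega> E - muE E' E' * lp x \<omega> E')\<bar> \<le> pi * (C * (3 * (B * D)) + C * D * (3 * B)) * sqrt (E' - E)"
      unfolding abs_mult by (simp add: mult.assoc)
    then have 2: "\<bar>muE E' E * (pi * lp x \<omega> E) - muE E' E' * (pi * lp x \<omega> E')\<bar> \<le> pi * (C * (3 * (B * D)) + C * D * (3 * B)) * sqrt (E' - E)"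
      by (simp add: algebra_simps)
    from 1 2 have "\<bar>W x \<omega> a b E' E - - (muE E' E' * (pi * lp x \<omega> E'))\<bar>
      \<le> 2 * pi * 288 * B * C * N * sqrt (E' - E) + pi * (C * (3 * (B * D)) + C * D * (3 * B)) * sqrt (E' - E)"
      by linarith
    then show ?thesis by (simp add: CW_def distrib_right)
  qed
  have CW0: "0 \<le> CW" unfolding CW_def using B0 C0 N0 D0 by (intro add_nonneg_nonneg mult_nonneg_nonneg) auto
  define CV where "CV = 2 * pi * (9 * B * N + B * D)"
  have CV0: "0 \<le> CV" unfolding CV_def using B0 N0 D0 by (intro add_nonneg_nonneg mult_nonneg_nonneg) auto
  define K1 where "K1 = B * CV + B * D * (2 * pi * B)"
  define K3 where "K3 = B * CW + B * D * (C * (pi * (3 * B)))"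
  have K0: "0 \<le> K1" "0 \<le> K3" unfolding K1_def K3_def using B0 C0 CV0 CW0 D0 by (intro add_nonneg_nonneg mult_nonneg_nonneg; auto)+
  define KK where "KK = K1 + K3"
  have Jb: "\<bar>2 * pi * J j [] x \<omega> E\<bar> \<le> 2 * pi * B" if "j \<le> 1" "x \<in> K" "\<omega> \<in> S2" "E \<in> I" for j x \<omega> E
    using BJ[of j "[]" x \<omega> E] that by (simp add: abs_mult)
  have lb: "\<bar>- (muE E' E' * (pi * lp x \<omega> E'))\<bar> \<le> C * (pi * (3 * B))" if "x \<in> K" "\<omega> \<in> S2" "E' \<in> I" for x \<omega> E'
    unfolding abs_minus_cancel abs_mult using Cb[of E' E'] lpb[OF that] that C0 by (intro mult_mono) auto
  show ?thesis
  proof (intro exI[of _ KK] ballI allI impI conjI)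
    fix x \<omega> E' a b assume *: "x \<in> K" "\<omega> \<in> S2" "E' \<in> {E0<..Em}" "perp_frame \<omega> a b"
    have E'I: "E' \<in> I" and E': "E0 < E'" using *(3) by auto
    have sub: "{E0..<E'} \<subseteq> {E0..E'}" by auto
    have HB: "\<bar>H j x E' E\<bar> \<le> B" if "j \<le> 2" "E \<in> {E0..E'}" for j E
      using that E'I * by (intro BH) auto
    have le: "k * sqrt (E' - E) \<le> KK * sqrt (E' - E)" if "k \<le> KK" "E \<in> {E0..<E'}" for k E
      using that by (intro mult_right_mono) auto
    have KK: "K1 \<le> KK" "K3 \<le> KK" using K0 by (auto simp: KK_def)
    show "half_Hoelder E0 E' (f1 x \<omega> a b E') (L1 x \<omega> E') KK"
    proof (rule half_Hoelder_continuous[OF E'])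
      show "continuous_on {E0..<E'} (f1 x \<omega> a b E')"
        unfolding f1_def using * E'I by (intro continuous_intros continuous_on_subset[OF H_cont sub] continuous_on_subset[OF V_cont sub]) auto
      fix E assume E: "E \<in> {E0..<E'}"
      have "\<bar>f1 x \<omega> a b E' E - L1 x \<omega> E'\<bar> \<le> K1 * sqrt (E' - E)"
        unfolding f1_def L1_def K1_def CV_def using E * E'I CV0
        by (intro hoelder_mult HL VL HB Jb) (auto simp: CV_def)
      with le[OF KK(1) E] show "\<bar>f1 x \<omega> a b E' E - L1 x \<omega> E'\<bar> \<le> KK * sqrt (E' - E)" by linarith
    qed
    show "half_Hoelder E0 E' (f5 x \<omega> a b E') (L5 x \<omega> E') KK"
    proof (rule half_Hoelder_continuous[OF E'])
      show "continuous_on {E0..<E'} (f5 x \<omega> a b E')"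
        unfolding f5_def using * E'I by (intro continuous_intros continuous_on_subset[OF H_cont sub] continuous_on_subset[OF V_cont sub]) auto
      fix E assume E: "E \<in> {E0..<E'}"
      have "\<bar>f5 x \<omega> a b E' E - L5 x \<omega> E'\<bar> \<le> K1 * sqrt (E' - E)"
        unfolding f5_def L5_def K1_def CV_def using E * E'I CV0
        by (intro hoelder_mult HL VL HB Jb) (auto simp: CV_def)
      with le[OF KK(1) E] show "\<bar>f5 x \<omega> a b E' E - L5 x \<omega> E'\<bar> \<le> KK * sqrt (E' - E)" by linarith
    qed
    show "half_Hoelder E0 E' (f3 x \<omega> a b E') (L3 x \<omega> E') KK"
    proof (rule half_Hoelder_continuous[OF E'])
      show "continuous_on {E0..<E'} (f3 x \<omega> a b E')"
        unfolding f3_def using * E'I by (intro continuous_intros continuous_on_subset[OF H_cont sub] W_cont) auto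
      fix E assume E: "E \<in> {E0..<E'}"
      have "\<bar>f3 x \<omega> a b E' E - L3 x \<omega> E'\<bar> \<le> K3 * sqrt (E' - E)"
        unfolding f3_def L3_def K3_def lp_def[symmetric, THEN fun_cong, THEN fun_cong, THEN fun_cong] using E * E'I CW0
        by (intro hoelder_mult HL WL HB lb) auto
      with le[OF KK(2) E] show "\<bar>f3 x \<omega> a b E' E - L3 x \<omega> E'\<bar> \<le> KK * sqrt (E' - E)" by linarith
    qed
  qed
qed

end


section \<open>Energy derivative of the circle average and integration by parts\<close>

context scattering
begin

text \<open>A derivative in the first variable at one point and a continuous partial derivative in
  the second give a total derivative within the product of sphere and interval, which is then
  restricted to the graph of the curve.\<close>

lemma v_chain_rule:
  assumes x: "x \<in> K" and E: "E \<in> U" and U: "U \<subseteq> I" and c: "\<And>s. s \<in> U \<Longrightarrow> c s \<in> S2"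
    and c': "(c has_vector_derivative c') (at E within U)"
  shows "((\<lambda>E. v x (c E) E) has_real_derivative
    J 1 [] x (c E) E + sphere_grad (\<lambda>\<xi>. v x \<xi> E) (c E) \<bullet> c') (at E within U)"
proof -
  let ?fy = "\<lambda>\<xi> E. J 1 [] x \<xi> E *\<^sub>R id_blinfun :: real \<Rightarrow>\<^sub>L real"
  have EI: "E \<in> I" and cE: "c E \<in> S2" using E U c by auto
  have "Ck_sphere 3 (\<lambda>\<omega>. v x \<omega> E)"
    using jet_Ck_sphere[OF v x, of 0 "[]" E] EI by simp
  then have d: "(\<lambda>\<omega>. v x \<omega> E) differentiable (at (c E) within S2)"
    using cE by (auto simp: numeral_3_eq_3 differentiable_on_def)
  have cont: "continuous_on (S2 \<times> I) (\<lambda>(\<xi>, E). ?fy \<xi> E)"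
  proof -
    have "continuous_on (S2 \<times> I) (\<lambda>z. (\<lambda>(x, \<omega>, E). J 1 [] x \<omega> E) (x, fst z, snd z))"
      by (rule continuous_on_compose2[OF jet_continuous[OF v E0m, of 1 "[]"]])
        (use x in \<open>auto intro!: continuous_intros\<close>)
    then show ?thesis by (auto simp: case_prod_unfold intro!: continuous_intros)
  qed
  have "((\<lambda>(\<xi>, E). v x \<xi> E) has_derivative (\<lambda>(tx, ty). sphere_grad (\<lambda>\<xi>. v x \<xi> E) (c E) \<bullet> tx + ?fy (c E) E ty))
    (at (c E, E) within S2 \<times> I)"
  proof (rule has_derivative_partialsI)
    show "((\<lambda>\<xi>. v x \<xi> E) has_derivative (\<bullet>) (sphere_grad (\<lambda>\<xi>. v x \<xi> E) (c E))) (at (c E) within S2)"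
      by (rule sphere_grad_has_derivative[OF cE d])
    show "(v x \<xi> has_derivative blinfun_apply (?fy \<xi> E)) (at E within I)" if "\<xi> \<in> S2" "E \<in> I" for \<xi> E
      using jet_derivative[OF v x, of 0 "[]" E \<xi>] that
      by (auto simp: has_field_derivative_def blinfun.scaleR_left elim!: has_derivative_eq_rhs)
    show "continuous (at (c E, E) within S2 \<times> I) (\<lambda>(\<xi>, E). ?fy \<xi> E)"
      using cont cE EI by (auto simp: continuous_on_eq_continuous_within)
  qed (use EI in auto)
  moreover have "(\<lambda>E. (c E, E)) ` U \<subseteq> S2 \<times> I" using c U by auto
  ultimately have "((\<lambda>(\<xi>, E). v x \<xi> E) has_derivative (\<lambda>(tx, ty). sphere_grad (\<lambda>\<xi>. v x \<xi> E) (c E) \<bullet> tx + ?fy (c E) E ty))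
    (at (c E, E) within (\<lambda>E. (c E, E)) ` U)"
    by (rule has_derivative_subset)
  from diff_chain_within[OF has_derivative_Pair[OF c'[unfolded has_vector_derivative_def] has_derivative_ident] this]
  show ?thesis
    by (auto simp: has_field_derivative_def o_def blinfun.scaleR_left algebra_simps elim!: has_derivative_eq_rhs)
qed

text \<open>Differentiation under the integral is carried out on the half-open interval: there the
  velocity is continuous jointly in energy and angle, although it is unbounded near E'.\<close>

lemma V_derivative:
  assumes x: "x \<in> K" and E': "E' \<in> {E0<..Em}" and fr: "perp_frame \<omega> a b" and E: "E \<in> {E0..<E'}"
  shows "(V 0 x \<omega> a b E' has_real_derivative V 1 x \<omega> a b E' E + W x \<omega> a b E' E) (at E within {E0..<E'})"
proof -
  let ?e = "\<lambda>s. cos s *\<^sub>R a + sin s *\<^sub>R b"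
  let ?U = "{E0..<E'}"
  have E'I: "E' \<in> I" using E' by auto
  let ?d = "\<lambda>E s. J 1 [] x (cpt E' E \<omega> (?e s)) E + sphere_grad (\<lambda>\<xi>. v x \<xi> E) (cpt E' E \<omega> (?e s)) \<bullet> cvel E' E \<omega> (?e s)"
  have c0: "continuous_on (?U \<times> UNIV) (\<lambda>(E, s). J j [] x (cpt E' E \<omega> (?e s)) E)" if "j \<le> 2" for j
    by (rule continuous_on_subset[OF J_cpt_cont[OF E'I x that _ fr, of "[]"]]) auto
  note cg = grad_cpt_cont[OF E'I x fr]
  have slice: "continuous_on T (\<lambda>s. f (E, s))" if "E \<in> ?U" "continuous_on (?U \<times> UNIV) f" for f :: "real \<times> real \<Rightarrow> real" and E T
    by (rule continuous_on_compose2[OF that(2)]) (use that(1) in \<open>auto intro!: continuous_intros\<close>)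
  note s0 = slice[OF _ c0, unfolded split_conv] and sg = slice[OF _ cg, unfolded split_conv]
  have D: "((\<lambda>E. integral (cbox 0 (2*pi)) (\<lambda>s. v x (cpt E' E \<omega> (?e s)) E)) has_real_derivative
      integral (cbox 0 (2*pi)) (?d E)) (at E within ?U)"
  proof (rule leibniz_rule_field_derivative)
    fix E s assume E: "E \<in> ?U"
    show "((\<lambda>E. v x (cpt E' E \<omega> (?e s)) E) has_real_derivative ?d E s) (at E within ?U)"
      by (rule v_chain_rule[OF x E])
        (use E E' E0 cpt_S2[OF fr] in \<open>auto intro!: cpt_derivative\<close>)
  next
    fix E assume "E \<in> ?U"
    then show "(\<lambda>s. v x (cpt E' E \<omega> (?e s)) E) integrable_on cbox 0 (2*pi)"
      using s0[of E 0] by (intro integrable_continuous) simp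
  next
    show "continuous_on (?U \<times> cbox 0 (2*pi)) (\<lambda>(E, s). ?d E s)"
      using c0[of 1] cg by (auto simp: case_prod_unfold intro!: continuous_intros elim!: continuous_on_subset)
  qed (use E in auto)
  have V: "V 0 x \<omega> a b E' E = integral (cbox 0 (2*pi)) (\<lambda>s. v x (cpt E' E \<omega> (?e s)) E)" if "E \<in> ?U" for E
    unfolding V_def cbox_interval using s0[OF that, of 0] by (subst circle_int_eq_integral) auto
  have "integral (cbox 0 (2*pi)) (?d E) = V 1 x \<omega> a b E' E + W x \<omega> a b E' E"
    unfolding V_def W_def cbox_interval using s0[OF E, of 1] sg[OF E]
    by (subst (1 2) circle_int_eq_integral)
      (auto intro!: Henstock_Kurzweil_Integration.integral_add integrable_continuous_interval)
  from D[unfolded this] show ?thesis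
    unfolding has_field_derivative_def
    by (rule has_derivative_transform[rotated 2]) (use E V in auto)
qed

lemma pf_left2_identity:
  assumes x: "x \<in> K" and \<omega>: "\<omega> \<in> S2" and E': "E' \<in> {E0<..Em}" and fr: "perp_frame \<omega> a b"
  shows "pf_left2 E0 E' (\<lambda>E. h x E' E * V 0 x \<omega> a b E' E)
    = - (L1 x \<omega> E' + L3 x \<omega> E' + L5 x \<omega> E')
      - (pf_left1 E0 E' (f1 x \<omega> a b E') + pf_left1 E0 E' (f3 x \<omega> a b E') + pf_left1 E0 E' (f5 x \<omega> a b E'))"
proof -
  obtain C where "\<forall>x\<in>K. \<forall>\<omega>\<in>S2. \<forall>E'\<in>{E0<..Em}. \<forall>a b. perp_frame \<omega> a b \<longrightarrow>
     half_Hoelder E0 E' (f1 x \<omega> a b E') (L1 x \<omega> E') C \<and>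
     half_Hoelder E0 E' (f3 x \<omega> a b E') (L3 x \<omega> E') C \<and>
     half_Hoelder E0 E' (f5 x \<omega> a b E') (L5 x \<omega> E') C"
    using half_Hoelder_terms by (elim exE)
  then have h1: "half_Hoelder E0 E' (f1 x \<omega> a b E') (L1 x \<omega> E') C"
    and h3: "half_Hoelder E0 E' (f3 x \<omega> a b E') (L3 x \<omega> E') C"
    and h5: "half_Hoelder E0 E' (f5 x \<omega> a b E') (L5 x \<omega> E') C"
    using assms by simp_all
  note h13 = half_Hoelder_add[OF h1 h3]
  note h135 = half_Hoelder_add[OF h13 h5]
  have E'I: "E' \<in> I" and sub: "{E0..<E'} \<subseteq> {E0..E'}" using E' by auto
  have "pf_left2 E0 E' (\<lambda>E. h x E' E * V 0 x \<omega> a b E' E)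
    = - (L1 x \<omega> E' + L3 x \<omega> E' + L5 x \<omega> E')
      - pf_left1 E0 E' (\<lambda>E. f1 x \<omega> a b E' E + f3 x \<omega> a b E' E + f5 x \<omega> a b E' E)"
  proof (rule pf_left2_by_parts[OF h135])
    show "continuous_on {E0..<E'} (\<lambda>E. f1 x \<omega> a b E' E + f3 x \<omega> a b E' E + f5 x \<omega> a b E' E)"
      unfolding f1_def f3_def f5_def using x E'I fr
      by (intro continuous_intros continuous_on_subset[OF H_cont sub] continuous_on_subset[OF V_cont sub] W_cont) auto
    show "continuous_on {E0..E'} (\<lambda>E. h x E' E * V 0 x \<omega> a b E' E)"
      using H_cont[OF E'I x, of 0] V_cont[OF E'I x _ fr, of 0] by (intro continuous_intros) simp_all
    fix E assume E: "E \<in> {E0..<E'}"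
    have "((\<lambda>E. H 0 x E' E) has_real_derivative H (Suc 0) x E' E) (at E within {E0..<E'})"
      by (rule DERIV_subset[OF sjet_derivative[OF h E0m x]]) (use E E' in auto)
    from DERIV_mult[OF this V_derivative[OF x E' fr E]]
    show "((\<lambda>E. h x E' E * V 0 x \<omega> a b E' E) has_real_derivative f1 x \<omega> a b E' E + f3 x \<omega> a b E' E + f5 x \<omega> a b E' E) (at E within {E0..<E'})"
      by (simp add: f1_def f3_def f5_def algebra_simps)
  next
    \<comment> \<open>At the lowest energy \<open>v\<close> vanishes on the whole sphere, hence on
      the circle; this is the boundary term of the integration by parts.\<close>
    have "V 0 x \<omega> a b E' E0 = 0"
      using v0[OF x cpt_S2[OF fr, of E0 E']] E' by (simp add: V_def circle_int_def set_lebesgue_integral_def)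
    then show "h x E' E0 * V 0 x \<omega> a b E' E0 = 0" by simp
  qed
  then show ?thesis
    by (simp add: pf_left1_add[OF h13 h5] pf_left1_add[OF h1 h3])
qed

end


section \<open>Iterated integrals over phase space\<close>

lemma integrable_inverse_sqrt_right:
  assumes "a < (b::real)"
  shows "integrable (restrict_space lborel {a..b}) (\<lambda>t. 1 / sqrt (t - a))"
proof -
  have "integrable lborel (\<lambda>t. indicator {a..<b} t *\<^sub>R (1 / sqrt (b - t)))"
    using integrable_inverse_sqrt[OF assms] by (simp add: has_bochner_integral_iff)
  from lborel_integrable_real_affine[OF this, of "-1" "a + b"]
  have "integrable lborel (\<lambda>t. indicator {a..<b} (a + b - t) *\<^sub>R (1 / sqrt (t - a)))" by simp
  also have "(\<lambda>t. indicator {a..<b} (a + b - t) *\<^sub>R (1 / sqrt (t - a))) = (\<lambda>t. indicator {a..b} t *\<^sub>R (1 / sqrt (t - a)))"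
    by (auto simp: indicator_def fun_eq_iff)
  finally show ?thesis by (simp add: integrable_restrict_space)
qed

text \<open>Nothing is known about the integrands at the lowest energy, where the interval of the
  finite part degenerates. A change at one point preserves measurability as well as the
  integral.\<close>

lemma integral_one_point:
  assumes f: "f \<in> borel_measurable (restrict_space lborel {a..b})"
    and g: "\<And>t. t \<in> {a<..b} \<Longrightarrow> g t = f t"
  shows "(LINT t|restrict_space lborel {a..b}. g t) = (LINT t|restrict_space lborel {a..b::real}. f t :: real)"
proof (rule integral_cong_AE)
  let ?M = "restrict_space lborel {a..b}"
  have "(\<lambda>t. indicator {a} t * (g a - f a)) \<in> borel_measurable ?M"
    by (intro measurable_restrict_space1) simp
  then have "(\<lambda>t. f t + indicator {a} t * (g a - f a)) \<in> borel_measurable ?M"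
    by (intro borel_measurable_add f)
  moreover have "f t + indicator {a} t * (g a - f a) = g t" if "t \<in> space ?M" for t
    using g[of t] that by (cases "t = a") (auto simp: space_restrict_space)
  ultimately show "g \<in> borel_measurable ?M"
    by (rule measurable_cong[THEN iffD1, rotated])
  have "AE t in lborel. t \<noteq> a" by (rule AE_lborel_singleton)
  then have "AE t in lborel. t \<in> {a..b} \<longrightarrow> g t = f t"
    by eventually_elim (use g in auto)
  then show "AE t in ?M. g t = f t"
    by (subst AE_restrict_space_iff) auto
qed (rule f)

section \<open>Fubini's theorem with a singularity at the lowest energy\<close>

locale phase =
  fixes G :: "r3 set" and E0 Em :: real
  assumes E0m: "E0 < Em" and bG: "bounded G" and oG: "open G"
begin

sublocale Gf: finite_measure "mG G"
proof
  have "emeasure lborel G < \<infinity>" using bG by (rule emeasure_bounded_finite)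
  then show "emeasure (mG G) (space (mG G)) \<noteq> \<infinity>"
    using oG by (simp add: emeasure_restrict_space space_restrict_space)
qed

sublocale If: finite_measure "mI E0 Em"
  by standard (use E0m in \<open>simp add: emeasure_restrict_space space_restrict_space\<close>)

sublocale Sf: finite_measure mS by (rule finite_measure_sphere)

sublocale SI: pair_sigma_finite mS "mI E0 Em" ..

sublocale SIf: finite_measure "mS \<Otimes>\<^sub>M mI E0 Em"
  by (rule finite_measure_pair_measure) unfold_locales

sublocale GSI: pair_sigma_finite "mG G" "mS \<Otimes>\<^sub>M mI E0 Em" ..

lemma measurable_phase:
  assumes "f \<in> borel_measurable borel"
  shows "f \<in> borel_measurable (mG G \<Otimes>\<^sub>M mS \<Otimes>\<^sub>M mI E0 Em)"
proof -
  have 1: "(\<lambda>x. x) \<in> measurable (mG G) borel" "(\<lambda>x. x) \<in> measurable (mI E0 Em) borel"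
    by (auto intro!: measurable_restrict_space1)
  have 2: "(\<lambda>x. x) \<in> measurable mS borel"
    unfolding measurable_cong_sets[OF sets_sphere_measure refl] by (auto intro!: measurable_restrict_space1)
  have "(\<lambda>z. (fst z, fst (snd z), snd (snd z))) \<in> measurable (mG G \<Otimes>\<^sub>M mS \<Otimes>\<^sub>M mI E0 Em) (borel \<Otimes>\<^sub>M borel \<Otimes>\<^sub>M borel)"
    by (intro measurable_Pair measurable_compose[OF measurable_fst 1(1)]
        measurable_compose[OF measurable_snd measurable_compose[OF measurable_fst 2]]
        measurable_compose[OF measurable_snd measurable_compose[OF measurable_snd 1(2)]])
  then have "(\<lambda>z. z) \<in> measurable (mG G \<Otimes>\<^sub>M mS \<Otimes>\<^sub>M mI E0 Em) borel"
    by (simp add: borel_prod)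
  from measurable_compose[OF this assms] show ?thesis .
qed

text \<open>Integrands that are Borel functions away from \<open>E = E\<^sub>0\<close> and have at most the integrable
  singularity of order \<open>1/2\<close> there.\<close>

definition admissible :: "(r3 \<Rightarrow> r3 \<Rightarrow> real \<Rightarrow> real) \<Rightarrow> bool" where
  "admissible H \<longleftrightarrow> (\<exists>T C. T \<in> borel_measurable borel \<and>
     (\<forall>x\<in>G. \<forall>\<omega>\<in>S2. \<forall>E\<in>{E0<..Em}. T (x, \<omega>, E) = H x \<omega> E \<and> \<bar>H x \<omega> E\<bar> \<le> C / sqrt (E - E0)))"

definition iterated_integral :: "(r3 \<Rightarrow> r3 \<Rightarrow> real \<Rightarrow> real) \<Rightarrow> real" where
  "iterated_integral H = (LINT x|mG G. LINT \<omega>|mS. LINT E|mI E0 Em. H x \<omega> E)"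

lemma admissible_representative:
  assumes "admissible H"
  shows "\<exists>T. T \<in> borel_measurable borel \<and> (\<forall>x\<in>G. \<forall>\<omega>\<in>S2. \<forall>E\<in>{E0<..Em}. H x \<omega> E = T (x, \<omega>, E)) \<and>
    (\<forall>x\<in>G. integrable (mS \<Otimes>\<^sub>M mI E0 Em) (\<lambda>p. T (x, p))) \<and>
    integrable (mG G \<Otimes>\<^sub>M mS \<Otimes>\<^sub>M mI E0 Em) T"
proof -
  obtain T C where T: "T \<in> borel_measurable borel"
    and TH: "\<And>x \<omega> E. x \<in> G \<Longrightarrow> \<omega> \<in> S2 \<Longrightarrow> E \<in> {E0<..Em} \<Longrightarrow> T (x, \<omega>, E) = H x \<omega> E \<and> \<bar>H x \<omega> E\<bar> \<le> C / sqrt (E - E0)"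
    using assms unfolding admissible_def by blast
  \<comment> \<open>The Borel function is unconstrained on the slice E = E0 and is reset to 0 there.
    The bound then extends to the closed interval, since 1 / sqrt 0 evaluates to 0.\<close>
  define U where "U = (\<lambda>z. if snd (snd z) = E0 then 0 else T z)"
  have Um: "U \<in> borel_measurable borel"
  proof -
    have "closed {z::r3 \<times> r3 \<times> real. snd (snd z) = E0}"
      by (intro closed_Collect_eq continuous_intros)
    then have "{z::r3 \<times> r3 \<times> real. snd (snd z) = E0} \<in> sets borel" by (rule borel_closed)
    then show ?thesis unfolding U_def using T by (intro measurable_If) (auto simp: Collect_neg_eq)
  qed
  have UH: "H x \<omega> E = U (x, \<omega>, E)" if "x \<in> G" "\<omega> \<in> S2" "E \<in> {E0<..Em}" for x \<omega> E
    using TH[OF that] that by (simp add: U_def)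
  have Ub: "\<bar>U (x, \<omega>, E)\<bar> \<le> \<bar>C * (1 / sqrt (E - E0))\<bar>" if "x \<in> G" "\<omega> \<in> S2" "E \<in> {E0..Em}" for x \<omega> E
  proof (cases "E = E0")
    case False
    then have "\<bar>T (x, \<omega>, E)\<bar> \<le> C / sqrt (E - E0)" using TH[of x \<omega> E] that by auto
    also have "\<dots> \<le> \<bar>C * (1 / sqrt (E - E0))\<bar>"
      using abs_ge_self[of "C * (1 / sqrt (E - E0))"] by (simp only: times_divide_eq_right mult_1_right)
    finally show ?thesis using False by (simp add: U_def)
  qed (simp add: U_def)
  have di: "integrable (mI E0 Em) (\<lambda>E. C * (1 / sqrt (E - E0)))"
    by (intro integrable_mult_right integrable_inverse_sqrt_right E0m)
  have d2: "integrable (mS \<Otimes>\<^sub>M mI E0 Em) (\<lambda>p. C * (1 / sqrt (snd p - E0)))"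
  proof (rule SI.Fubini_integrable)
    show "(\<lambda>p. C * (1 / sqrt (snd p - E0))) \<in> borel_measurable (mS \<Otimes>\<^sub>M mI E0 Em)"
      by (rule measurable_compose[OF measurable_snd borel_measurable_integrable[OF di]])
  qed (use di in auto)
  have Um3: "U \<in> borel_measurable (mG G \<Otimes>\<^sub>M mS \<Otimes>\<^sub>M mI E0 Em)" by (rule measurable_phase[OF Um])
  have Um2: "(\<lambda>p. U (x, p)) \<in> borel_measurable (mS \<Otimes>\<^sub>M mI E0 Em)" if "x \<in> G" for x
    using measurable_Pair2[OF Um3, of x] that by (simp add: space_restrict_space)
  have b2: "norm (U (x, p)) \<le> norm (C * (1 / sqrt (snd p - E0)))"
    if "x \<in> G" "p \<in> space (mS \<Otimes>\<^sub>M mI E0 Em)" for x p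
    using Ub[of x "fst p" "snd p"] that by (auto simp: space_pair_measure space_restrict_space)
  have i2: "integrable (mS \<Otimes>\<^sub>M mI E0 Em) (\<lambda>p. U (x, p))" if "x \<in> G" for x
    using b2[OF that] by (intro Bochner_Integration.integrable_bound[OF d2 Um2[OF that]]) (auto intro: AE_I2)
  have d3: "integrable (mG G \<Otimes>\<^sub>M mS \<Otimes>\<^sub>M mI E0 Em) (\<lambda>z. C * (1 / sqrt (snd (snd z) - E0)))"
  proof (rule GSI.Fubini_integrable)
    show "(\<lambda>z. C * (1 / sqrt (snd (snd z) - E0))) \<in> borel_measurable (mG G \<Otimes>\<^sub>M mS \<Otimes>\<^sub>M mI E0 Em)"
      by (rule measurable_compose[OF measurable_snd borel_measurable_integrable[OF d2]])
  qed (use d2 in auto)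
  have i3: "integrable (mG G \<Otimes>\<^sub>M mS \<Otimes>\<^sub>M mI E0 Em) U"
  proof (rule Bochner_Integration.integrable_bound[OF d3 Um3], rule AE_I2)
    fix z assume z: "z \<in> space (mG G \<Otimes>\<^sub>M mS \<Otimes>\<^sub>M mI E0 Em)"
    then have "fst z \<in> G" "snd z \<in> space (mS \<Otimes>\<^sub>M mI E0 Em)"
      by (auto simp: space_pair_measure space_restrict_space)
    from b2[OF this] show "norm (U z) \<le> norm (C * (1 / sqrt (snd (snd z) - E0)))" by (simp only: prod.collapse)
  qed
  show ?thesis using Um UH i2 i3 by blast
qed

text \<open>\<open>H\<close> may be arbitrary on the slice E = E0, so it need not be measurable on
  the product. In either order of integration that slice is a single point of the energy integral,
  and there \<open>H\<close> can be exchanged for its Borel representative.\<close>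

lemma iterated_integral_representative:
  assumes T: "T \<in> borel_measurable borel"
    and H: "\<And>x \<omega> E. x \<in> G \<Longrightarrow> \<omega> \<in> S2 \<Longrightarrow> E \<in> {E0<..Em} \<Longrightarrow> H x \<omega> E = T (x, \<omega>, E)"
    and i2: "\<And>x. x \<in> G \<Longrightarrow> integrable (mS \<Otimes>\<^sub>M mI E0 Em) (\<lambda>p. T (x, p))"
    and i3: "integrable (mG G \<Otimes>\<^sub>M mS \<Otimes>\<^sub>M mI E0 Em) T"
  shows "iterated_integral H = integral\<^sup>L (mG G \<Otimes>\<^sub>M mS \<Otimes>\<^sub>M mI E0 Em) T"
    and "(LINT x|mG G. LINT E|mI E0 Em. LINT \<omega>|mS. H x \<omega> E) = iterated_integral H"
proof -
  have m: "(\<lambda>E. T (x, \<omega>, E)) \<in> borel_measurable (mI E0 Em)" if "x \<in> G" "\<omega> \<in> S2" for x \<omega>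
  proof -
    have "(\<lambda>p. T (x, p)) \<in> borel_measurable (mS \<Otimes>\<^sub>M mI E0 Em)"
      by (rule borel_measurable_integrable[OF i2[OF that(1)]])
    from measurable_Pair2[OF this, of \<omega>] that show ?thesis by simp
  qed
  have 1: "(LINT \<omega>|mS. LINT E|mI E0 Em. H x \<omega> E) = (LINT p|(mS \<Otimes>\<^sub>M mI E0 Em). T (x, p))"
    if x: "x \<in> G" for x
  proof -
    have "(LINT \<omega>|mS. LINT E|mI E0 Em. H x \<omega> E) = (LINT \<omega>|mS. LINT E|mI E0 Em. T (x, \<omega>, E))"
      using x by (intro Bochner_Integration.integral_cong refl integral_one_point m H) auto
    then show ?thesis using SI.integral_fst'[OF i2[OF x]] by simp
  qed
  show *: "iterated_integral H = integral\<^sup>L (mG G \<Otimes>\<^sub>M mS \<Otimes>\<^sub>M mI E0 Em) T"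
    unfolding iterated_integral_def GSI.integral_fst'[OF i3, symmetric]
    by (intro Bochner_Integration.integral_cong refl 1) (auto simp: space_restrict_space)
  have 2: "(LINT E|mI E0 Em. LINT \<omega>|mS. H x \<omega> E) = (LINT p|(mS \<Otimes>\<^sub>M mI E0 Em). T (x, p))"
    if x: "x \<in> G" for x
  proof -
    have i: "integrable (mS \<Otimes>\<^sub>M mI E0 Em) (case_prod (\<lambda>\<omega> E. T (x, \<omega>, E)))"
      using i2[OF x] by (simp add: case_prod_unfold)
    have "(LINT E|mI E0 Em. LINT \<omega>|mS. H x \<omega> E) = (LINT E|mI E0 Em. LINT \<omega>|mS. T (x, \<omega>, E))"
      using x by (intro integral_one_point Bochner_Integration.integral_cong refl H
        borel_measurable_integrable[OF SI.integrable_snd[OF i]]) auto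
    then show ?thesis using SI.integral_snd[OF i] by (simp add: case_prod_unfold)
  qed
  show "(LINT x|mG G. LINT E|mI E0 Em. LINT \<omega>|mS. H x \<omega> E) = iterated_integral H"
    unfolding * GSI.integral_fst'[OF i3, symmetric]
    by (intro Bochner_Integration.integral_cong refl 2) (auto simp: space_restrict_space)
qed

lemma iterated_integral_swap:
  assumes "admissible H"
  shows "(LINT x|mG G. LINT E|mI E0 Em. LINT \<omega>|mS. H x \<omega> E) = iterated_integral H"
  using admissible_representative[OF assms] iterated_integral_representative(2)[of _ H] by blast

lemma iterated_integral_cong:
  assumes "admissible H'" "\<And>x \<omega> E. x \<in> G \<Longrightarrow> \<omega> \<in> S2 \<Longrightarrow> E \<in> {E0<..Em} \<Longrightarrow> H x \<omega> E = H' x \<omega> E"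
  shows "iterated_integral H = iterated_integral H'"
proof -
  obtain T where T: "T \<in> borel_measurable borel" "\<forall>x\<in>G. \<forall>\<omega>\<in>S2. \<forall>E\<in>{E0<..Em}. H' x \<omega> E = T (x, \<omega>, E)"
    "\<forall>x\<in>G. integrable (mS \<Otimes>\<^sub>M mI E0 Em) (\<lambda>p. T (x, p))"
    "integrable (mG G \<Otimes>\<^sub>M mS \<Otimes>\<^sub>M mI E0 Em) T"
    using admissible_representative[OF assms(1)] by blast
  have "iterated_integral H = integral\<^sup>L (mG G \<Otimes>\<^sub>M mS \<Otimes>\<^sub>M mI E0 Em) T"
    using T assms(2) by (intro iterated_integral_representative(1)) auto
  moreover have "iterated_integral H' = integral\<^sup>L (mG G \<Otimes>\<^sub>M mS \<Otimes>\<^sub>M mI E0 Em) T"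
    using T by (intro iterated_integral_representative(1)) auto
  ultimately show ?thesis by simp
qed

lemma iterated_integral_add:
  assumes "admissible H1" "admissible H2"
  shows "iterated_integral (\<lambda>x \<omega> E. H1 x \<omega> E + H2 x \<omega> E) = iterated_integral H1 + iterated_integral H2"
proof -
  let ?M = "mG G \<Otimes>\<^sub>M mS \<Otimes>\<^sub>M mI E0 Em"
  obtain T1 where T1: "T1 \<in> borel_measurable borel" "\<forall>x\<in>G. \<forall>\<omega>\<in>S2. \<forall>E\<in>{E0<..Em}. H1 x \<omega> E = T1 (x, \<omega>, E)"
    "\<forall>x\<in>G. integrable (mS \<Otimes>\<^sub>M mI E0 Em) (\<lambda>p. T1 (x, p))" "integrable ?M T1"
    using admissible_representative[OF assms(1)] by blast
  obtain T2 where T2: "T2 \<in> borel_measurable borel" "\<forall>x\<in>G. \<forall>\<omega>\<in>S2. \<forall>E\<in>{E0<..Em}. H2 x \<omega> E = T2 (x, \<omega>, E)"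
    "\<forall>x\<in>G. integrable (mS \<Otimes>\<^sub>M mI E0 Em) (\<lambda>p. T2 (x, p))" "integrable ?M T2"
    using admissible_representative[OF assms(2)] by blast
  have "iterated_integral (\<lambda>x \<omega> E. H1 x \<omega> E + H2 x \<omega> E) = (LINT z|?M. T1 z + T2 z)"
    using T1 T2 by (intro iterated_integral_representative(1)) auto
  also have "\<dots> = integral\<^sup>L ?M T1 + integral\<^sup>L ?M T2"
    using T1 T2 by (intro Bochner_Integration.integral_add) auto
  also have "integral\<^sup>L ?M T1 = iterated_integral H1" using T1 by (intro iterated_integral_representative(1)[symmetric]) auto
  also have "integral\<^sup>L ?M T2 = iterated_integral H2" using T2 by (intro iterated_integral_representative(1)[symmetric]) auto
  finally show ?thesis .
qed

lemma iterated_integral_const: "iterated_integral (\<lambda>x \<omega> E. c * u x \<omega> E) = c * iterated_integral u"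
  by (simp add: iterated_integral_def)

lemma admissible_add:
  assumes "admissible H1" "admissible H2"
  shows "admissible (\<lambda>x \<omega> E. H1 x \<omega> E + H2 x \<omega> E)"
proof -
  obtain T1 C1 where T1: "T1 \<in> borel_measurable borel"
    "\<And>x \<omega> E. x \<in> G \<Longrightarrow> \<omega> \<in> S2 \<Longrightarrow> E \<in> {E0<..Em} \<Longrightarrow> T1 (x, \<omega>, E) = H1 x \<omega> E \<and> \<bar>H1 x \<omega> E\<bar> \<le> C1 / sqrt (E - E0)"
    using assms(1) unfolding admissible_def by blast
  obtain T2 C2 where T2: "T2 \<in> borel_measurable borel"
    "\<And>x \<omega> E. x \<in> G \<Longrightarrow> \<omega> \<in> S2 \<Longrightarrow> E \<in> {E0<..Em} \<Longrightarrow> T2 (x, \<omega>, E) = H2 x \<omega> E \<and> \<bar>H2 x \<omega> E\<bar> \<le> C2 / sqrt (E - E0)"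
    using assms(2) unfolding admissible_def by blast
  show ?thesis
    unfolding admissible_def
  proof (intro exI[of _ "\<lambda>z. T1 z + T2 z"] exI[of _ "C1 + C2"] conjI ballI)
    show "(\<lambda>z. T1 z + T2 z) \<in> borel_measurable borel" using T1 T2 by measurable
    fix x \<omega> E assume *: "x \<in> G" "\<omega> \<in> S2" "E \<in> {E0<..Em}"
    show "T1 (x, \<omega>, E) + T2 (x, \<omega>, E) = H1 x \<omega> E + H2 x \<omega> E" using T1(2)[OF *] T2(2)[OF *] by simp
    show "\<bar>H1 x \<omega> E + H2 x \<omega> E\<bar> \<le> (C1 + C2) / sqrt (E - E0)"
      using T1(2)[OF *] T2(2)[OF *] unfolding add_divide_distrib by linarith
  qed
qed

lemma admissible_mult:
  assumes u: "continuous_on (closure G \<times> S2 \<times> {E0..Em}) (\<lambda>(x, \<omega>, E). u x \<omega> E)" and H: "admissible H"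
  shows "admissible (\<lambda>x \<omega> E. u x \<omega> E * H x \<omega> E)"
proof -
  let ?D = "closure G \<times> S2 \<times> {E0..Em}"
  have cD: "compact ?D" using bG by (intro compact_Times) (auto simp: compact_closure)
  obtain T C where T: "T \<in> borel_measurable borel"
    "\<And>x \<omega> E. x \<in> G \<Longrightarrow> \<omega> \<in> S2 \<Longrightarrow> E \<in> {E0<..Em} \<Longrightarrow> T (x, \<omega>, E) = H x \<omega> E \<and> \<bar>H x \<omega> E\<bar> \<le> C / sqrt (E - E0)"
    using H unfolding admissible_def by blast
  have "?D \<in> sets borel" using cD by (intro borel_closed compact_imp_closed)
  then have um: "(\<lambda>z. indicator ?D z *\<^sub>R (case z of (x, \<omega>, E) \<Rightarrow> u x \<omega> E)) \<in> borel_measurable borel"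
    using u by (rule borel_measurable_continuous_on_indicator)
  obtain B where B: "\<And>z. z \<in> ?D \<Longrightarrow> \<bar>case z of (x, \<omega>, E) \<Rightarrow> u x \<omega> E\<bar> \<le> B"
    using compact_bound[OF cD u] by blast
  show ?thesis
    unfolding admissible_def
  proof (intro exI[of _ "\<lambda>z. (indicator ?D z *\<^sub>R (case z of (x, \<omega>, E) \<Rightarrow> u x \<omega> E)) * T z"] exI[of _ "B * C"] conjI ballI)
    show "(\<lambda>z. (indicator ?D z *\<^sub>R (case z of (x, \<omega>, E) \<Rightarrow> u x \<omega> E)) * T z) \<in> borel_measurable borel"
      using um T(1) by (rule borel_measurable_times)
    fix x \<omega> E assume *: "x \<in> G" "\<omega> \<in> S2" "E \<in> {E0<..Em}"
    then have D: "(x, \<omega>, E) \<in> ?D" using closure_subset by auto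
    show "(indicator ?D (x, \<omega>, E) *\<^sub>R (case (x, \<omega>, E) of (x, \<omega>, E) \<Rightarrow> u x \<omega> E)) * T (x, \<omega>, E) = u x \<omega> E * H x \<omega> E"
      using T(2)[OF *] D by simp
    have "\<bar>u x \<omega> E * H x \<omega> E\<bar> \<le> B * (C / sqrt (E - E0))"
      unfolding abs_mult using B[OF D] T(2)[OF *] by (intro mult_mono) auto
    then show "\<bar>u x \<omega> E * H x \<omega> E\<bar> \<le> B * C / sqrt (E - E0)" by simp
  qed
qed

lemma admissible_one: "admissible (\<lambda>x \<omega> E. 1)"
  unfolding admissible_def
proof (intro exI[of _ "\<lambda>_. 1"] exI[of _ "sqrt (Em - E0)"] conjI ballI)
  fix E assume "E \<in> {E0<..Em}"
  then have "0 < sqrt (E - E0)" "sqrt (E - E0) \<le> sqrt (Em - E0)" by auto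
  then show "\<bar>1\<bar> \<le> sqrt (Em - E0) / sqrt (E - E0)" by simp
qed auto

lemma admissible_continuous:
  assumes "continuous_on (closure G \<times> S2 \<times> {E0..Em}) (\<lambda>(x, \<omega>, E). u x \<omega> E)"
  shows "admissible u"
  using admissible_mult[OF assms admissible_one] by simp

text \<open>Besides ln y \<le> y - 1 itself, the same inequality at 1 / sqrt y, doubled, bounds - ln
  y. The logarithm at 0 is thereby traded for the admissible singularity.\<close>

lemma ln_bound:
  assumes "0 < (y::real)"
  shows "\<bar>ln y\<bar> \<le> y + 2 / sqrt y"
proof -
  have "ln y \<le> y - 1" using assms by (rule ln_le_minus_one)
  moreover have "ln (1 / sqrt y) \<le> 1 / sqrt y - 1" using assms by (intro ln_le_minus_one) auto
  then have "- ln y \<le> 2 / sqrt y - 2" using assms by (simp add: ln_div ln_sqrt)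
  moreover have "0 < 2 / sqrt y" using assms by simp
  ultimately show ?thesis using assms unfolding abs_le_iff by linarith
qed

text \<open>Measurability is not visible in a limit over eps. It is read off from the closed form of
  the finite part, an integral of a Borel function depending on parameters plus a logarithm.\<close>

lemma admissible_pf_left1:
  assumes g: "g \<in> borel_measurable borel"
    and L: "continuous_on (closure G \<times> S2 \<times> {E0..Em}) (\<lambda>(x, \<omega>, E). L x \<omega> E)"
    and hH: "\<And>x \<omega> E. x \<in> G \<Longrightarrow> \<omega> \<in> S2 \<Longrightarrow> E \<in> {E0<..Em} \<Longrightarrow> half_Hoelder E0 E (f x \<omega> E) (L x \<omega> E) C"
    and fg: "\<And>x \<omega> E t. x \<in> G \<Longrightarrow> \<omega> \<in> S2 \<Longrightarrow> E \<in> {E0<..Em} \<Longrightarrow> t \<in> {E0..<E} \<Longrightarrow> f x \<omega> E t = g ((x, \<omega>, E), t)"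
  shows "admissible (\<lambda>x \<omega> E. pf_left1 E0 E (f x \<omega> E))"
proof -
  let ?D = "closure G \<times> S2 \<times> {E0..Em}"
  have cD: "compact ?D" using bG by (intro compact_Times) (auto simp: compact_closure)
  define l where "l = (\<lambda>z. indicator ?D z *\<^sub>R (case z of (x, \<omega>, E) \<Rightarrow> L x \<omega> E))"
  have "?D \<in> sets borel" using cD by (intro borel_closed compact_imp_closed)
  then have l: "l \<in> borel_measurable borel"
    unfolding l_def using L by (rule borel_measurable_continuous_on_indicator)
  have lL: "l (x, \<omega>, E) = L x \<omega> E" if "x \<in> G" "\<omega> \<in> S2" "E \<in> {E0<..Em}" for x \<omega> E
    using that closure_subset[of G] by (auto simp: l_def indicator_def)
  obtain B where B: "\<And>z. z \<in> ?D \<Longrightarrow> \<bar>case z of (x, \<omega>, E) \<Rightarrow> L x \<omega> E\<bar> \<le> B"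
    using compact_bound[OF cD L] by blast
  \<comment> \<open>Zero outside of [E0, E), so that the domain of integration no longer depends on
    the parameters.\<close>
  define q where "q = (\<lambda>(z::r3 \<times> r3 \<times> real) t. if E0 \<le> t \<and> t < snd (snd z) then (g (z, t) - l z) / (snd (snd z) - t) else 0)"
  define T where "T = (\<lambda>z. (LINT t|lborel. q z t) + l z * ln (snd (snd z) - E0))"
  have sm: "(\<lambda>z. snd (snd z)) \<in> borel_measurable (borel :: (r3 \<times> r3 \<times> real) measure)"
    by (intro borel_measurable_continuous_onI continuous_intros)
  have "case_prod q \<in> borel_measurable (borel \<Otimes>\<^sub>M lborel)"
  proof -
    have [measurable]: "g \<in> borel_measurable (borel \<Otimes>\<^sub>M lborel)"
    proof -
      have e: "(borel \<Otimes>\<^sub>M borel :: ((r3 \<times> r3 \<times> real) \<times> real) measure) = borel"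
        by (rule borel_prod)
      have "sets (borel \<Otimes>\<^sub>M lborel :: ((r3 \<times> r3 \<times> real) \<times> real) measure) = sets (borel \<Otimes>\<^sub>M borel)"
        by (rule sets_pair_measure_cong) simp_all
      also have "\<dots> = sets borel" by (simp only: e)
      finally have "sets (borel \<Otimes>\<^sub>M lborel :: ((r3 \<times> r3 \<times> real) \<times> real) measure) = sets borel" .
      then show ?thesis using g by (simp cong: measurable_cong_sets)
    qed
    note [measurable] = l sm
    show ?thesis unfolding q_def by measurable
  qed
  then have "(\<lambda>z. LINT t|lborel. q z t) \<in> borel_measurable borel"
    by (rule lborel.borel_measurable_lebesgue_integral)
  then have Tm: "T \<in> borel_measurable borel"
    unfolding T_def using l sm by measurable
  have TH: "T (x, \<omega>, E) = pf_left1 E0 E (f x \<omega> E)" if *: "x \<in> G" "\<omega> \<in> S2" "E \<in> {E0<..Em}" for x \<omega> E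
  proof -
    interpret half_Hoelder E0 E "f x \<omega> E" "L x \<omega> E" C by (rule hH[OF *])
    have "(LINT t|lborel. q (x, \<omega>, E) t) = (LINT t:{E0..<E}|lborel. (f x \<omega> E t - L x \<omega> E) / (E - t))"
      unfolding set_lebesgue_integral_def
      by (intro Bochner_Integration.integral_cong refl) (auto simp: q_def indicator_def fg[OF *] lL[OF *])
    then show ?thesis by (simp add: T_def pf_left1_eq lL[OF *])
  qed
  define Y where "Y = Em - E0"
  have Y0: "0 < Y" using E0m by (simp add: Y_def)
  \<comment> \<open>With y = E - E0 \<le> Y every contribution is written over sqrt y: sqrt y \<le>
    Y / sqrt y, y \<le> Y sqrt Y / sqrt y, and 2 / sqrt y comes from the logarithm.\<close>
  define Q where "Q = 2 * \<bar>C\<bar> * Y + \<bar>B\<bar> * (Y * sqrt Y + 2)"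
  have bound: "\<bar>pf_left1 E0 E (f x \<omega> E)\<bar> \<le> Q / sqrt (E - E0)" if *: "x \<in> G" "\<omega> \<in> S2" "E \<in> {E0<..Em}" for x \<omega> E
  proof -
    interpret half_Hoelder E0 E "f x \<omega> E" "L x \<omega> E" C by (rule hH[OF *])
    define y where "y = E - E0"
    have y: "0 < y" "y \<le> Y" using *(3) by (auto simp: y_def Y_def)
    have s: "0 < sqrt y" "sqrt y * sqrt y = y" using y by auto
    have e1: "sqrt y \<le> Y / sqrt y" using y s by (simp add: pos_le_divide_eq)
    have e2: "y \<le> Y * sqrt Y / sqrt y"
      using y s by (simp add: pos_le_divide_eq mult_mono)
    have LB: "\<bar>L x \<omega> E\<bar> \<le> \<bar>B\<bar>"
      using B[of "(x, \<omega>, E)"] * closure_subset by force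
    have "\<bar>pf_left1 E0 E (f x \<omega> E)\<bar> \<le> 2 * C * sqrt y + \<bar>L x \<omega> E\<bar> * \<bar>ln y\<bar>"
      unfolding y_def by (rule pf_left1_bound)
    also have "\<dots> \<le> 2 * \<bar>C\<bar> * (Y / sqrt y) + \<bar>B\<bar> * (Y * sqrt Y / sqrt y + 2 / sqrt y)"
      using e1 e2 LB ln_bound[OF y(1)] s C_nonneg by (intro add_mono mult_mono) auto
    also have "\<dots> = Q / sqrt y" by (simp add: Q_def add_divide_distrib distrib_left)
    finally show ?thesis by (simp add: y_def)
  qed
  show ?thesis unfolding admissible_def using Tm TH bound by blast
qed

end


section \<open>Borel versions of the circle averages\<close>

locale scattering_phase = scattering + assumes oG: "open G"

sublocale scattering_phase \<subseteq> phase
  using E0m bG oG by unfold_locales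

context scattering_phase
begin

text \<open>Extension by zero turns a function that is continuous on a closed set into a Borel
  function on the whole space.\<close>

definition Jt :: "nat \<Rightarrow> 3 list \<Rightarrow> r3 \<times> r3 \<times> real \<Rightarrow> real" where
  "Jt j is z = indicator (K \<times> S2 \<times> {E0..Em}) z *\<^sub>R (case z of (x, \<omega>, E) \<Rightarrow> J j is x \<omega> E)"

definition Ht :: "nat \<Rightarrow> r3 \<times> real \<times> real \<Rightarrow> real" where
  "Ht j z = indicator (K \<times> {E0..Em} \<times> {E0..Em}) z *\<^sub>R (case z of (x, E', E) \<Rightarrow> H j x E' E)"

lemma Jt_measurable: "j \<le> 2 \<Longrightarrow> length is \<le> 3 \<Longrightarrow> Jt j is \<in> borel_measurable (borel \<Otimes>\<^sub>M borel \<Otimes>\<^sub>M borel)"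
  unfolding Jt_def borel_prod
  by (intro borel_measurable_continuous_on_indicator jet_continuous[OF v E0m] borel_closed closed_Times) auto

lemma Ht_measurable: "j \<le> 2 \<Longrightarrow> Ht j \<in> borel_measurable (borel \<Otimes>\<^sub>M borel \<Otimes>\<^sub>M borel)"
  unfolding Ht_def borel_prod
  by (intro borel_measurable_continuous_on_indicator sjet_continuous[OF h E0m] borel_closed closed_Times) auto

lemma nth_measurable: "(\<lambda>x::r3. x $ i) \<in> borel_measurable borel"
  by (intro borel_measurable_continuous_onI continuous_intros)

definition edir :: "r3 \<Rightarrow> real \<Rightarrow> r3" where
  "edir \<omega> s = cos s *\<^sub>R frame1 \<omega> + sin s *\<^sub>R frame2 \<omega>"

text \<open>Together with \<open>gW\<close> the version of the averages in the Borel frames, total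
  and composed of Borel functions; it agrees with \<open>V\<close> below the diagonal.\<close>

definition gV :: "nat \<Rightarrow> (r3 \<times> r3 \<times> real) \<times> real \<Rightarrow> real" where
  "gV j = (\<lambda>((x, \<omega>, E'), E). LINT s|lborel. indicator {0..2*pi} s *\<^sub>R Jt j [] (x, cpt E' E \<omega> (edir \<omega> s), E))"

definition gW :: "(r3 \<times> r3 \<times> real) \<times> real \<Rightarrow> real" where
  "gW = (\<lambda>((x, \<omega>, E'), E). LINT s|lborel. indicator {0..2*pi} s *\<^sub>R
     (\<Sum>i\<in>UNIV. Jt 0 [i] (x, cpt E' E \<omega> (edir \<omega> s), E) * cvel E' E \<omega> (edir \<omega> s) $ i))"

abbreviation "N4 \<equiv> (borel \<Otimes>\<^sub>M borel \<Otimes>\<^sub>M borel) \<Otimes>\<^sub>M borel :: ((r3 \<times> r3 \<times> real) \<times> real) measure"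

lemma N4_eq: "N4 = borel"
  by (simp only: borel_prod)

lemma cpt_measurable:
  "(\<lambda>p. cpt (snd (snd (fst (fst p)))) (snd (fst p)) (fst (snd (fst (fst p)))) (edir (fst (snd (fst (fst p)))) (snd p)))
    \<in> borel_measurable (N4 \<Otimes>\<^sub>M lborel)"
  unfolding cpt_def edir_def nu_def mu_def by measurable

lemma cvel_measurable:
  "(\<lambda>p. cvel (snd (snd (fst (fst p)))) (snd (fst p)) (fst (snd (fst (fst p)))) (edir (fst (snd (fst (fst p)))) (snd p)))
    \<in> borel_measurable (N4 \<Otimes>\<^sub>M lborel)"
  unfolding cvel_def edir_def nuE_def muE_def nu_def mu_def by measurable

lemma Jt_cpt_measurable:
  assumes "j \<le> 2" "length is \<le> 3"
  shows "(\<lambda>p. Jt j is (fst (fst (fst p)), cpt (snd (snd (fst (fst p)))) (snd (fst p)) (fst (snd (fst (fst p)))) (edir (fst (snd (fst (fst p)))) (snd p)), snd (fst p)))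
    \<in> borel_measurable (N4 \<Otimes>\<^sub>M lborel)"
  by (rule measurable_compose[OF _ Jt_measurable[OF assms]]) (intro measurable_Pair cpt_measurable; measurable)

lemma indicator_snd_measurable:
  "(\<lambda>p. indicator {0..2*pi} (snd p) :: real) \<in> borel_measurable (N4 \<Otimes>\<^sub>M lborel)"
  by (rule measurable_compose[OF measurable_snd]) simp

lemma gV_measurable: "j \<le> 2 \<Longrightarrow> gV j \<in> borel_measurable N4"
  unfolding gV_def case_prod_unfold
  by (rule lborel.borel_measurable_lebesgue_integral)
    (auto simp: case_prod_unfold intro!: borel_measurable_times indicator_snd_measurable Jt_cpt_measurable)

lemma gW_measurable: "gW \<in> borel_measurable N4"
  unfolding gW_def case_prod_unfold
  by (rule lborel.borel_measurable_lebesgue_integral)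
    (auto simp: case_prod_unfold intro!: borel_measurable_times indicator_snd_measurable borel_measurable_sum
      Jt_cpt_measurable measurable_compose[OF cvel_measurable nth_measurable])

lemma cpt_edir_S2: "\<omega> \<in> S2 \<Longrightarrow> E \<in> {E0..E'} \<Longrightarrow> cpt E' E \<omega> (edir \<omega> s) \<in> S2"
  unfolding edir_def by (rule cpt_S2[OF perp_frame_frame12]) auto

lemma V_eq_gV:
  assumes "x \<in> K" "\<omega> \<in> S2" "E' \<in> {E0..Em}" "E \<in> {E0..<E'}"
  shows "V j x \<omega> (frame1 \<omega>) (frame2 \<omega>) E' E = gV j ((x, \<omega>, E'), E)"
  unfolding V_def circle_int_def gV_def set_lebesgue_integral_def split_conv edir_def[symmetric]
  using assms cpt_edir_S2[of \<omega> E E'] by (simp add: Jt_def)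

lemma W_eq_gW:
  assumes "x \<in> K" "\<omega> \<in> S2" "E' \<in> {E0..Em}" "E \<in> {E0..<E'}"
  shows "W x \<omega> (frame1 \<omega>) (frame2 \<omega>) E' E = gW ((x, \<omega>, E'), E)"
proof -
  have g: "sphere_grad (\<lambda>\<xi>. v x \<xi> E) \<xi> $ i = J 0 [i] x \<xi> E" for \<xi> i by (simp add: jet_def)
  show ?thesis
    unfolding W_def circle_int_def gW_def set_lebesgue_integral_def split_conv edir_def[symmetric] inner_vec_def g inner_real_def
    using assms cpt_edir_S2[of \<omega> E E'] by (simp add: Jt_def)
qed

lemma J_circle_continuous:
  assumes "x \<in> K" "norm \<omega> = 1" "E' \<in> {E0..Em}" "E \<in> {E0..<E'}" "j \<le> 2" "length is \<le> 3"
  shows "continuous_on {e. norm e = 1 \<and> e \<bullet> \<omega> = 0} (\<lambda>e. J j is x (cpt E' E \<omega> e) E)"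
proof -
  have "continuous_on {e. norm e = 1 \<and> e \<bullet> \<omega> = 0} (\<lambda>e. (\<lambda>(x, \<omega>, E). J j is x \<omega> E) (x, cpt E' E \<omega> e, E))"
    by (rule continuous_on_compose2[OF jet_continuous[OF v E0m assms(5,6)]])
      (use assms E0 in \<open>auto simp: cpt_def[abs_def] intro!: continuous_intros cpt_in_sphere[unfolded cpt_def]\<close>)
  then show ?thesis by simp
qed

lemma V_frame:
  assumes "x \<in> K" "perp_frame \<omega> a b" "E' \<in> {E0..Em}" "E \<in> {E0..<E'}" "j \<le> 2"
  shows "V j x \<omega> a b E' E = V j x \<omega> (frame1 \<omega>) (frame2 \<omega>) E' E"
proof -
  have n: "norm \<omega> = 1" using assms by (simp add: perp_frame_def)
  show ?thesis
    unfolding V_def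
    by (rule circle_int_frame[OF perp_frame_frame12[OF n] assms(2)])
      (use assms n in \<open>auto intro!: J_circle_continuous\<close>)
qed

text \<open>The velocity depends on the frame only through the direction, and continuously so at
  fixed E < E'; hence the independence of circle averages applies to it as well.\<close>

lemma W_frame:
  assumes "x \<in> K" "perp_frame \<omega> a b" "E' \<in> {E0..Em}" "E \<in> {E0..<E'}"
  shows "W x \<omega> a b E' E = W x \<omega> (frame1 \<omega>) (frame2 \<omega>) E' E"
proof -
  have g: "sphere_grad (\<lambda>\<xi>. v x \<xi> E) \<xi> $ i = J 0 [i] x \<xi> E" for \<xi> i by (simp add: jet_def)
  have n: "norm \<omega> = 1" using assms by (simp add: perp_frame_def)
  show ?thesis
    unfolding W_def
    by (rule circle_int_frame[OF perp_frame_frame12[OF n] assms(2)])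
      (unfold inner_vec_def[of "sphere_grad _ _"] g inner_real_def cvel_def,
        use assms n in \<open>auto intro!: continuous_intros J_circle_continuous\<close>)
qed

lemma L_continuous:
  "continuous_on (K \<times> S2 \<times> {E0..Em}) (\<lambda>(x, \<omega>, E). L1 x \<omega> E)"
  "continuous_on (K \<times> S2 \<times> {E0..Em}) (\<lambda>(x, \<omega>, E). L3 x \<omega> E)"
  "continuous_on (K \<times> S2 \<times> {E0..Em}) (\<lambda>(x, \<omega>, E). L5 x \<omega> E)"
proof -
  have Hc: "continuous_on (K \<times> S2 \<times> {E0..Em}) (\<lambda>z. H j (fst z) (snd (snd z)) (snd (snd z)))" if "j \<le> 2" for j
  proof -
    have "continuous_on (K \<times> S2 \<times> {E0..Em}) (\<lambda>z. (\<lambda>(x, E', E). H j x E' E) (fst z, snd (snd z), snd (snd z)))"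
      by (rule continuous_on_compose2[OF sjet_continuous[OF h E0m that]]) (auto intro!: continuous_intros)
    then show ?thesis by simp
  qed
  have Jc: "continuous_on (K \<times> S2 \<times> {E0..Em}) (\<lambda>z. J j is (fst z) (fst (snd z)) (snd (snd z)))" if "j \<le> 2" "length is \<le> 3" for j "is"
    using jet_continuous[OF v E0m that] by (simp add: case_prod_unfold)
  have mc: "continuous_on (K \<times> S2 \<times> {E0..Em}) (\<lambda>z::r3 \<times> r3 \<times> real. muE (snd (snd z)) (snd (snd z)))"
  proof -
    have "continuous_on (K \<times> S2 \<times> {E0..Em}) (\<lambda>z. (\<lambda>(E', E). muE E' E) (snd (snd z), snd (snd z)))"
      by (rule continuous_on_compose2[OF muE_continuous[OF E0]]) (auto intro!: continuous_intros)
    then show ?thesis by simp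
  qed
  show "continuous_on (K \<times> S2 \<times> {E0..Em}) (\<lambda>(x, \<omega>, E). L1 x \<omega> E)"
    "continuous_on (K \<times> S2 \<times> {E0..Em}) (\<lambda>(x, \<omega>, E). L3 x \<omega> E)"
    "continuous_on (K \<times> S2 \<times> {E0..Em}) (\<lambda>(x, \<omega>, E). L5 x \<omega> E)"
    unfolding L1_def L3_def L5_def case_prod_unfold by (intro continuous_intros Hc Jc mc; simp)+
qed

text \<open>The frames \<open>a\<close> and \<open>b\<close> are arbitrary functions of the
  direction. Frame independence exchanges them for the Borel frames under the integral sign.\<close>

lemma
  assumes fr: "\<And>\<omega>. \<omega> \<in> S2 \<Longrightarrow> perp_frame \<omega> (a \<omega>) (b \<omega>)"
  shows admissible_f1: "admissible (\<lambda>x \<omega> E'. pf_left1 E0 E' (f1 x \<omega> (a \<omega>) (b \<omega>) E'))"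
    and admissible_f3: "admissible (\<lambda>x \<omega> E'. pf_left1 E0 E' (f3 x \<omega> (a \<omega>) (b \<omega>) E'))"
    and admissible_f5: "admissible (\<lambda>x \<omega> E'. pf_left1 E0 E' (f5 x \<omega> (a \<omega>) (b \<omega>) E'))"
proof -
  obtain C where C: "\<forall>x\<in>K. \<forall>\<omega>\<in>S2. \<forall>E'\<in>{E0<..Em}. \<forall>a b. perp_frame \<omega> a b \<longrightarrow>
     half_Hoelder E0 E' (f1 x \<omega> a b E') (L1 x \<omega> E') C \<and>
     half_Hoelder E0 E' (f3 x \<omega> a b E') (L3 x \<omega> E') C \<and>
     half_Hoelder E0 E' (f5 x \<omega> a b E') (L5 x \<omega> E') C"
    using half_Hoelder_terms by (elim exE)
  have GK: "x \<in> K" if "x \<in> G" for x using that closure_subset by auto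
  have hh: "half_Hoelder E0 E' (f1 x \<omega> (a \<omega>) (b \<omega>) E') (L1 x \<omega> E') C"
    "half_Hoelder E0 E' (f3 x \<omega> (a \<omega>) (b \<omega>) E') (L3 x \<omega> E') C"
    "half_Hoelder E0 E' (f5 x \<omega> (a \<omega>) (b \<omega>) E') (L5 x \<omega> E') C"
    if "x \<in> G" "\<omega> \<in> S2" "E' \<in> {E0<..Em}" for x \<omega> E'
    using C[rule_format, OF GK[OF that(1)] that(2,3) fr[OF that(2)]] by auto
  have Hm: "(\<lambda>z. Ht j (fst (fst z), snd (snd (fst z)), snd z)) \<in> borel_measurable N4" if "j \<le> 2" for j
    by (rule measurable_compose[OF _ Ht_measurable[OF that]]) measurable
  have HH: "H j x E' E = Ht j (x, E', E)" if "x \<in> G" "E' \<in> {E0<..Em}" "E \<in> {E0..<E'}" for j x E' E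
    using that GK[OF that(1)] by (auto simp: Ht_def)
  have VV: "V j x \<omega> (a \<omega>) (b \<omega>) E' E = gV j ((x, \<omega>, E'), E)"
    if "x \<in> G" "\<omega> \<in> S2" "E' \<in> {E0<..Em}" "E \<in> {E0..<E'}" "j \<le> 2" for j x \<omega> E' E
    using V_frame[OF GK[OF that(1)] fr[OF that(2)] _ that(4,5)] V_eq_gV[OF GK[OF that(1)] that(2) _ that(4)] that(3) by auto
  have WW: "W x \<omega> (a \<omega>) (b \<omega>) E' E = gW ((x, \<omega>, E'), E)"
    if "x \<in> G" "\<omega> \<in> S2" "E' \<in> {E0<..Em}" "E \<in> {E0..<E'}" for x \<omega> E' E
    using W_frame[OF GK[OF that(1)] fr[OF that(2)] _ that(4)] W_eq_gW[OF GK[OF that(1)] that(2) _ that(4)] that(3) by auto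
  show "admissible (\<lambda>x \<omega> E'. pf_left1 E0 E' (f1 x \<omega> (a \<omega>) (b \<omega>) E'))"
    by (rule admissible_pf_left1[where g="\<lambda>z. Ht 0 (fst (fst z), snd (snd (fst z)), snd z) * gV 1 z", OF _ L_continuous(1) hh(1)])
      (auto simp: f1_def HH HH[where j=0, simplified] VV VV[where j=1, simplified] simp flip: N4_eq intro!: borel_measurable_times Hm gV_measurable)
  show "admissible (\<lambda>x \<omega> E'. pf_left1 E0 E' (f3 x \<omega> (a \<omega>) (b \<omega>) E'))"
    by (rule admissible_pf_left1[where g="\<lambda>z. Ht 0 (fst (fst z), snd (snd (fst z)), snd z) * gW z", OF _ L_continuous(2) hh(2)])
      (auto simp: f3_def HH HH[where j=0, simplified] WW simp flip: N4_eq intro!: borel_measurable_times Hm gW_measurable)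
  show "admissible (\<lambda>x \<omega> E'. pf_left1 E0 E' (f5 x \<omega> (a \<omega>) (b \<omega>) E'))"
    by (rule admissible_pf_left1[where g="\<lambda>z. Ht 1 (fst (fst z), snd (snd (fst z)), snd z) * gV 0 z", OF _ L_continuous(3) hh(3)])
      (auto simp: f5_def HH HH[where j=0, simplified] VV VV[where j=1, simplified] simp flip: N4_eq intro!: borel_measurable_times Hm gV_measurable)
qed

end


section \<open>Green's formula and the assembly of the six terms\<close>

context scattering_phase
begin

text \<open>\<open>L3\<close> carries minus pi times the Laplacian and Green's formula contributes
  the second minus sign; the factors depending only on position and energy leave the integral over
  the sphere.\<close>

lemma Green_term:
  assumes \<psi>: "C123 G E0 Em \<psi>" and x: "x \<in> K" and E: "E \<in> {E0..Em}"
  shows "(LINT \<omega>|mS. \<psi> x \<omega> E * L3 x \<omega> E)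
    = pi * (LINT \<omega>|mS. h x E E * deriv (mu E) E *
         (sphere_grad (\<lambda>\<xi>. \<psi> x \<xi> E) \<omega> \<bullet> sphere_grad (\<lambda>\<xi>. v x \<xi> E) \<omega>))"
proof -
  have "Ck_sphere 3 (\<lambda>\<omega>. \<psi> x \<omega> E)" "Ck_sphere 3 (\<lambda>\<omega>. v x \<omega> E)"
    using jet_Ck_sphere[OF \<psi> x, of 0 "[]" E] jet_Ck_sphere[OF v x, of 0 "[]" E] E by simp_all
  then have 1: "Ck_sphere 1 (\<lambda>\<omega>. \<psi> x \<omega> E)" and 2: "Ck_sphere 2 (\<lambda>\<omega>. v x \<omega> E)"
    using Ck_sphere_mono_Suc by (simp_all only: numeral_3_eq_3 numeral_2_eq_2 One_nat_def)
  have "\<psi> x \<omega> E * L3 x \<omega> E = - (pi * h x E E * muE E E) * (\<psi> x \<omega> E * lap (\<lambda>\<xi>. v x \<xi> E) \<omega>)" for \<omega>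
    by (simp add: L3_def lap_def jet_def)
  then have "(LINT \<omega>|mS. \<psi> x \<omega> E * L3 x \<omega> E)
    = - (pi * h x E E * muE E E) * (LINT \<omega>|mS. \<psi> x \<omega> E * lap (\<lambda>\<xi>. v x \<xi> E) \<omega>)"
    by (simp only: integral_mult_right_zero)
  also have "\<dots> = pi * (h x E E * muE E E * (LINT \<omega>|mS. sphere_grad (\<lambda>\<xi>. \<psi> x \<xi> E) \<omega> \<bullet> sphere_grad (\<lambda>\<xi>. v x \<xi> E) \<omega>))"
    unfolding sphere_Green[OF 1 2] by simp
  also have "muE E E = deriv (mu E) E"
    using E E0 by (intro deriv_mu_diag[symmetric]) auto
  finally show ?thesis by (simp only: integral_mult_right_zero)
qed

lemma B2_identity:
  assumes R: "rotation_to R" and \<psi>: "C123 G E0 Em \<psi>"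
  shows "B2 G E0 Em R h \<psi> v =
      (LINT x|mG G. LINT E'|mI E0 Em. LINT \<omega>|mS. \<psi> x \<omega> E' *
         pf_left1 E0 E' (\<lambda>E. h x E' E *
           (LINT s:{0..2*pi}|lborel. deriv_in E0 Em (v x (gam R E' E \<omega> s)) E)))
    + 2 * pi * (LINT x|mG G. LINT E'|mI E0 Em. LINT \<omega>|mS.
         \<psi> x \<omega> E' * h x E' E' * deriv_in E0 Em (v x \<omega>) E')
    + (LINT x|mG G. LINT \<omega>|mS. LINT E'|mI E0 Em. \<psi> x \<omega> E' *
         pf_left1 E0 E' (\<lambda>E. h x E' E *
           (LINT s:{0..2*pi}|lborel.
              sphere_grad (\<lambda>\<xi>. v x \<xi> E) (gam R E' E \<omega> s) \<bullet>
              vector_derivative (\<lambda>e. gam R E' e \<omega> s) (at E))))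
    + pi * (LINT x|mG G. LINT E'|mI E0 Em. LINT \<omega>|mS.
         h x E' E' * deriv (mu E') E' *
         (sphere_grad (\<lambda>\<xi>. \<psi> x \<xi> E') \<omega> \<bullet> sphere_grad (\<lambda>\<xi>. v x \<xi> E') \<omega>))
    + (LINT x|mG G. LINT \<omega>|mS. LINT E'|mI E0 Em. \<psi> x \<omega> E' *
         pf_left1 E0 E' (\<lambda>E. deriv_in E0 Em (h x E') E *
           (LINT s:{0..2*pi}|lborel. v x (gam R E' E \<omega> s) E)))
    + 2 * pi * (LINT x|mG G. LINT E|mI E0 Em. LINT \<omega>|mS.
         \<psi> x \<omega> E * deriv_in E0 Em (h x E) E * v x \<omega> E)"
    (is "_ = ?T1 + 2 * pi * ?T2 + ?T3 + pi * ?T4 + ?T5 + 2 * pi * ?T6")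
proof -
  \<comment> \<open>The first two columns of \<open>R \<omega>\<close>; the third is
    \<open>\<omega>\<close>.\<close>
  define a b where "a = (\<lambda>\<omega>. R \<omega> *v axis 1 1 :: r3)" and "b = (\<lambda>\<omega>. R \<omega> *v axis 2 1 :: r3)"
  have fr: "perp_frame \<omega> (a \<omega>) (b \<omega>)" if "\<omega> \<in> S2" for \<omega>
    unfolding a_def b_def by (rule rotation_frame[OF R that])
  have gam: "gam R E' E \<omega> s = cpt E' E \<omega> (cos s *\<^sub>R a \<omega> + sin s *\<^sub>R b \<omega>)" if "\<omega> \<in> S2" for \<omega> E' E s
    unfolding a_def b_def by (rule gam_eq[OF R that])
  have GK: "x \<in> K" if "x \<in> G" for x using that closure_subset by auto
  have spG: "x \<in> G" if "x \<in> space (mG G)" for x using that by (simp add: space_restrict_space)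
  have spI: "E \<in> {E0..Em}" if "E \<in> space (mI E0 Em)" for E using that by (simp add: space_restrict_space)
  have spS: "\<omega> \<in> S2" if "\<omega> \<in> space mS" for \<omega> using that by simp
  define P1 where "P1 = (\<lambda>x \<omega> E'. \<psi> x \<omega> E' * pf_left1 E0 E' (f1 x \<omega> (a \<omega>) (b \<omega>) E'))"
  define P3 where "P3 = (\<lambda>x \<omega> E'. \<psi> x \<omega> E' * pf_left1 E0 E' (f3 x \<omega> (a \<omega>) (b \<omega>) E'))"
  define P5 where "P5 = (\<lambda>x \<omega> E'. \<psi> x \<omega> E' * pf_left1 E0 E' (f5 x \<omega> (a \<omega>) (b \<omega>) E'))"
  define Q1 where "Q1 = (\<lambda>x \<omega> E'. \<psi> x \<omega> E' * L1 x \<omega> E')"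
  define Q3 where "Q3 = (\<lambda>x \<omega> E'. \<psi> x \<omega> E' * L3 x \<omega> E')"
  define Q5 where "Q5 = (\<lambda>x \<omega> E'. \<psi> x \<omega> E' * L5 x \<omega> E')"
  have \<psi>c: "continuous_on (K \<times> S2 \<times> {E0..Em}) (\<lambda>(x, \<omega>, E). \<psi> x \<omega> E)"
    using jet_continuous[OF \<psi> E0m, of 0 "[]"] by simp
  have admissible: "admissible P1" "admissible P3" "admissible P5" "admissible Q1" "admissible Q3" "admissible Q5"
    unfolding P1_def P3_def P5_def Q1_def Q3_def Q5_def
    by (intro admissible_mult[OF \<psi>c] admissible_f1 admissible_f3 admissible_f5 admissible_continuous L_continuous fr; assumption)+
  have V0: "(LINT s:{0..2*pi}|lborel. v x (gam R E' E \<omega> s) E) = V 0 x \<omega> (a \<omega>) (b \<omega>) E' E"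
    if "\<omega> \<in> S2" for x \<omega> E' E
    by (simp add: V_def circle_int_def gam[OF that])
  have V1: "(LINT s:{0..2*pi}|lborel. deriv_in E0 Em (v x (gam R E' E \<omega> s)) E) = V 1 x \<omega> (a \<omega>) (b \<omega>) E' E"
    if "\<omega> \<in> S2" for x \<omega> E' E
    by (simp add: V_def circle_int_def gam[OF that] jet_Suc_Nil)
  have W: "(LINT s:{0..2*pi}|lborel. sphere_grad (\<lambda>\<xi>. v x \<xi> E) (gam R E' E \<omega> s) \<bullet>
      vector_derivative (\<lambda>e. gam R E' e \<omega> s) (at E)) = W x \<omega> (a \<omega>) (b \<omega>) E' E"
    if "\<omega> \<in> S2" "E \<in> {E0..<E'}" for x \<omega> E' E
  proof -
    have "vector_derivative (\<lambda>e. gam R E' e \<omega> s) (at E) = cvel E' E \<omega> (cos s *\<^sub>R a \<omega> + sin s *\<^sub>R b \<omega>)" for s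
      unfolding gam[OF that(1)] using that(2) E0 by (intro vector_derivative_at cpt_derivative) auto
    then show ?thesis by (simp add: W_def circle_int_def gam[OF that(1)])
  qed
  obtain C where C: "\<forall>x\<in>K. \<forall>\<omega>\<in>S2. \<forall>E'\<in>{E0<..Em}. \<forall>a b. perp_frame \<omega> a b \<longrightarrow>
     half_Hoelder E0 E' (f1 x \<omega> a b E') (L1 x \<omega> E') C \<and>
     half_Hoelder E0 E' (f3 x \<omega> a b E') (L3 x \<omega> E') C \<and>
     half_Hoelder E0 E' (f5 x \<omega> a b E') (L5 x \<omega> E') C"
    using half_Hoelder_terms by (elim exE)
  \<comment> \<open>In this term the integral over the sphere is innermost, so the order has to be
    exchanged to reach \<open>iterated_integral\<close>.\<close>
  have T1: "?T1 = iterated_integral P1"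
  proof -
    have "?T1 = (LINT x|mG G. LINT E'|mI E0 Em. LINT \<omega>|mS. P1 x \<omega> E')"
      unfolding P1_def f1_def
      by (intro Bochner_Integration.integral_cong refl) (simp only: V1[OF spS] sjet_0)
    then show ?thesis by (simp only: iterated_integral_swap[OF admissible(1)])
  qed
  have T5: "?T5 = iterated_integral P5"
    unfolding iterated_integral_def P5_def f5_def
    by (intro Bochner_Integration.integral_cong refl) (simp only: V0[OF spS] sjet_1 One_nat_def)
  \<comment> \<open>The vector derivative of \<open>gam\<close> is identified with the velocity for
    E < E' only, so the finite parts are compared by congruence to the left of E' and not by
    rewriting the integrand.\<close>
  have T3: "?T3 = iterated_integral P3"
    unfolding iterated_integral_def[symmetric]
  proof (rule iterated_integral_cong[OF admissible(2)])
    fix x \<omega> E' assume *: "x \<in> G" "\<omega> \<in> S2" "E' \<in> {E0<..Em}"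
    have "half_Hoelder E0 E' (f3 x \<omega> (a \<omega>) (b \<omega>) E') (L3 x \<omega> E') C"
      using C[rule_format, OF GK[OF *(1)] *(2,3) fr[OF *(2)]] by auto
    from half_Hoelder_cong(2)[OF this, of "\<lambda>E. h x E' E * (LINT s:{0..2*pi}|lborel.
        sphere_grad (\<lambda>\<xi>. v x \<xi> E) (gam R E' E \<omega> s) \<bullet> vector_derivative (\<lambda>e. gam R E' e \<omega> s) (at E))"]
    show "\<psi> x \<omega> E' * pf_left1 E0 E' (\<lambda>E. h x E' E * (LINT s:{0..2*pi}|lborel.
        sphere_grad (\<lambda>\<xi>. v x \<xi> E) (gam R E' E \<omega> s) \<bullet> vector_derivative (\<lambda>e. gam R E' e \<omega> s) (at E))) = P3 x \<omega> E'"
      by (simp add: P3_def f3_def W[OF *(2)])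
  qed
  have T2: "2 * pi * ?T2 = iterated_integral Q1"
  proof -
    have "iterated_integral Q1 = (LINT x|mG G. LINT E'|mI E0 Em. LINT \<omega>|mS. 2 * pi * (\<psi> x \<omega> E' * h x E' E' * deriv_in E0 Em (v x \<omega>) E'))"
      unfolding iterated_integral_swap[OF admissible(4), symmetric] unfolding Q1_def L1_def One_nat_def jet_Suc_Nil sjet_0
      by (intro Bochner_Integration.integral_cong refl) simp
    then show ?thesis by (simp only: integral_mult_right_zero)
  qed
  have T6: "2 * pi * ?T6 = iterated_integral Q5"
  proof -
    have "iterated_integral Q5 = (LINT x|mG G. LINT E|mI E0 Em. LINT \<omega>|mS. 2 * pi * (\<psi> x \<omega> E * deriv_in E0 Em (h x E) E * v x \<omega> E))"
      unfolding iterated_integral_swap[OF admissible(6), symmetric] unfolding Q5_def L5_def One_nat_def sjet_1 jet_0_Nil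
      by (intro Bochner_Integration.integral_cong refl) simp
    then show ?thesis by (simp only: integral_mult_right_zero)
  qed
  have T4: "pi * ?T4 = iterated_integral Q3"
  proof -
    have "iterated_integral Q3 = (LINT x|mG G. LINT E'|mI E0 Em. pi * (LINT \<omega>|mS. h x E' E' * deriv (mu E') E' *
         (sphere_grad (\<lambda>\<xi>. \<psi> x \<xi> E') \<omega> \<bullet> sphere_grad (\<lambda>\<xi>. v x \<xi> E') \<omega>)))"
      unfolding iterated_integral_swap[OF admissible(5), symmetric] unfolding Q3_def
      by (intro Bochner_Integration.integral_cong refl Green_term[OF \<psi>] GK spG spI)
    then show ?thesis by (simp only: integral_mult_right_zero)
  qed
  \<comment> \<open>The minus sign of \<open>B2\<close> cancels those of the integration by parts,
    so all six contributions enter with a plus.\<close>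
  let ?S = "\<lambda>x \<omega> E'. P1 x \<omega> E' + Q1 x \<omega> E' + P3 x \<omega> E' + Q3 x \<omega> E' + P5 x \<omega> E' + Q5 x \<omega> E'"
  have "B2 G E0 Em R h \<psi> v = (-1) * iterated_integral (\<lambda>x \<omega> E'. \<psi> x \<omega> E' *
          pf_left2 E0 E' (\<lambda>E. h x E' E * (LINT s:{0..2*pi}|lborel. v x (gam R E' E \<omega> s) E)))"
    by (simp add: B2_def iterated_integral_def)
  also have "\<dots> = iterated_integral (\<lambda>x \<omega> E'. (-1) * (\<psi> x \<omega> E' *
          pf_left2 E0 E' (\<lambda>E. h x E' E * (LINT s:{0..2*pi}|lborel. v x (gam R E' E \<omega> s) E))))"
    by (rule iterated_integral_const[symmetric])
  also have "\<dots> = iterated_integral ?S"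
  proof (rule iterated_integral_cong)
    show "admissible ?S" by (intro admissible_add admissible)
    fix x \<omega> E' assume *: "x \<in> G" "\<omega> \<in> S2" "E' \<in> {E0<..Em}"
    show "(-1) * (\<psi> x \<omega> E' * pf_left2 E0 E' (\<lambda>E. h x E' E * (LINT s:{0..2*pi}|lborel. v x (gam R E' E \<omega> s) E))) = ?S x \<omega> E'"
      unfolding V0[OF *(2)] pf_left2_identity[OF GK[OF *(1)] *(2,3) fr[OF *(2)]]
        P1_def P3_def P5_def Q1_def Q3_def Q5_def
      by (simp add: algebra_simps)
  qed
  also have "\<dots> = iterated_integral P1 + iterated_integral Q1 + iterated_integral P3 + iterated_integral Q3 + iterated_integral P5 + iterated_integral Q5"
    by (simp add: iterated_integral_add admissible_add admissible)
  finally show ?thesis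
    unfolding T1 T2 T3 T4 T5 T6 .
qed

end

theorem theorem5p4:
  fixes G :: "r3 set" and \<nu> :: "r3 \<Rightarrow> r3" and \<sigma> :: "r3 measure"
    and E0 Em M1 M2 :: real
    and R :: "r3 \<Rightarrow> real^3^3"
    and \<sigma>h1 \<sigma>h2 \<sigma>3 :: "r3 \<Rightarrow> real \<Rightarrow> real \<Rightarrow> real"
    and \<sigma>1 :: "r3 \<Rightarrow> r3 \<Rightarrow> r3 \<Rightarrow> real \<Rightarrow> real \<Rightarrow> real"
    and \<sigma>2 :: "r3 \<Rightarrow> r3 \<Rightarrow> r3 \<Rightarrow> real \<Rightarrow> real"
    and \<Sigma> f g \<psi> v :: "r3 \<Rightarrow> r3 \<Rightarrow> real \<Rightarrow> real"
  assumes "open G" and "bounded G" and "C1_manifold_with_boundary (closure G)"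
    and "\<forall>y\<in>frontier G. outward_unit_normal (closure G) y (\<nu> y)"
    and "is_surface_measure (frontier G) \<sigma>"
    and "0 < E0" and "E0 < Em"
    and "rotation_to R"
    and "(\<lambda>(x, \<omega>, E). \<Sigma> x \<omega> E) \<in> Linfty (phase_measure G E0 Em)"
    and "collision_kernel1 G E0 Em M1 M2 \<sigma>1"
    and "collision_kernel2 G E0 Em M1 M2 \<sigma>2"
    and "collision_kernel3 G E0 Em M1 M2 \<sigma>3"
    and "C0k G E0 Em 1 \<sigma>h1"
    and "C0k G E0 Em 2 \<sigma>h2"
    and "(\<lambda>(x, \<omega>, E). f x \<omega> E) \<in> L2 (phase_measure G E0 Em)"
    and "(\<lambda>(y, \<omega>, E). g y \<omega> E) \<in> L2 (boundary_measure \<sigma> \<nu> E0 Em)"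
    and "C123 G E0 Em \<psi>"
    and "AE (x, \<omega>, E) in phase_measure G E0 Em.
           transport_op E0 Em R \<sigma>h1 \<sigma>h2 \<Sigma> \<sigma>1 \<sigma>2 \<sigma>3 \<psi> x \<omega> E = f x \<omega> E"
    and "AE (y, \<omega>, E) in boundary_measure \<sigma> \<nu> E0 Em.
           (y, \<omega>, E) \<in> Gamma_minus G \<nu> E0 Em \<longrightarrow> \<psi> y \<omega> E = g y \<omega> E"
    and "\<forall>x\<in>closure G. \<forall>\<omega>\<in>S2. \<psi> x \<omega> Em = 0"
    and "v \<in> D_zero G E0 Em"
  shows "B2 G E0 Em R \<sigma>h2 \<psi> v =
      (LINT x|mG G. LINT E'|mI E0 Em. LINT \<omega>|mS. \<psi> x \<omega> E' *
         pf_left1 E0 E' (\<lambda>E. \<sigma>h2 x E' E *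
           (LINT s:{0..2*pi}|lborel. deriv_in E0 Em (v x (gam R E' E \<omega> s)) E)))
    + 2 * pi * (LINT x|mG G. LINT E'|mI E0 Em. LINT \<omega>|mS.
         \<psi> x \<omega> E' * \<sigma>h2 x E' E' * deriv_in E0 Em (v x \<omega>) E')
    + (LINT x|mG G. LINT \<omega>|mS. LINT E'|mI E0 Em. \<psi> x \<omega> E' *
         pf_left1 E0 E' (\<lambda>E. \<sigma>h2 x E' E *
           (LINT s:{0..2*pi}|lborel.
              sphere_grad (\<lambda>\<xi>. v x \<xi> E) (gam R E' E \<omega> s) \<bullet>
              vector_derivative (\<lambda>e. gam R E' e \<omega> s) (at E))))
    + pi * (LINT x|mG G. LINT E'|mI E0 Em. LINT \<omega>|mS.
         \<sigma>h2 x E' E' * deriv (mu E') E' *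
         (sphere_grad (\<lambda>\<xi>. \<psi> x \<xi> E') \<omega> \<bullet> sphere_grad (\<lambda>\<xi>. v x \<xi> E') \<omega>))
    + (LINT x|mG G. LINT \<omega>|mS. LINT E'|mI E0 Em. \<psi> x \<omega> E' *
         pf_left1 E0 E' (\<lambda>E. deriv_in E0 Em (\<sigma>h2 x E') E *
           (LINT s:{0..2*pi}|lborel. v x (gam R E' E \<omega> s) E)))
    + 2 * pi * (LINT x|mG G. LINT E|mI E0 Em. LINT \<omega>|mS.
         \<psi> x \<omega> E * deriv_in E0 Em (\<sigma>h2 x E) E * v x \<omega> E)"

proof -
  interpret scattering_phase G E0 Em v \<sigma>h2
    using assms by unfold_locales (auto simp: D_zero_def)
  show ?thesis by (rule B2_identity) fact+
qed

end
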